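(* Let $R$ be a prime PI-ring such that its centre $Z(R)$ is Noetherian. If $S$ is a subring with $Z(R)\subseteq S\subseteq R$, then $S\cap U(R)=U(S)$.
   Context: All rings are associative with identity (not necessarily commutative), and every subring contains the identity of the larger ring. $U(R)$ denotes the group of units of $R$ and $Z(R)$ the centre of $R$. A PI-ring is a ring satisfying a polynomial identity $f=0$, where $f$ is a polynomial in noncommuting variables with integer coefficients, at least one of whose monomials of highest degree has coefficient $1$. *)

theory Defs
  imports "HOL-Algebra.Algebra" "HOL-Library.Poly_Mapping"
begin

definition ring_center :: "('a, 'b) ring_scheme \<Rightarrow> 'a set" where
  "ring_center R = {z \<in> carrier R. \<forall>x\<in>carrier R. z \<otimes>\<^bsub>R\<^esub> x = x \<otimes>\<^bsub>R\<^esub> z}"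

(* The library's notion primeideal presupposes a commutative ring, so the zero ideal being
   prime is spelt out here with products of two-sided ideals.  As usual, prime rings are nonzero. *)
definition prime_ring :: "('a, 'b) ring_scheme \<Rightarrow> bool" where
  "prime_ring R \<longleftrightarrow>
     ring R \<and> carrier R \<noteq> {\<zero>\<^bsub>R\<^esub>} \<and>
     (\<forall>I J. ideal I R \<longrightarrow> ideal J R \<longrightarrow> ideal_prod R I J = {\<zero>\<^bsub>R\<^esub>} \<longrightarrow>
        I = {\<zero>\<^bsub>R\<^esub>} \<or> J = {\<zero>\<^bsub>R\<^esub>})"

(* A polynomial with integer coefficients in noncommuting variables x_0, x_1, x_2, ... is a
   finitely supported function from words in the variable indices to the integers: the word
   [i, j, ...] is the monomial x_i x_j ..., and its degree is the length of the word. *)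
type_synonym ncpoly = "nat list \<Rightarrow>\<^sub>0 int"

definition ncmonom_eval :: "('a, 'b) ring_scheme \<Rightarrow> (nat \<Rightarrow> 'a) \<Rightarrow> nat list \<Rightarrow> 'a" where
  "ncmonom_eval R a w = foldr (\<lambda>i y. a i \<otimes>\<^bsub>R\<^esub> y) w \<one>\<^bsub>R\<^esub>"

definition ncpoly_eval :: "('a, 'b) ring_scheme \<Rightarrow> (nat \<Rightarrow> 'a) \<Rightarrow> ncpoly \<Rightarrow> 'a" where
  "ncpoly_eval R a f =
     (\<Oplus>\<^bsub>R\<^esub>w\<in>Poly_Mapping.keys f. add_pow R (Poly_Mapping.lookup f w) (ncmonom_eval R a w))"

definition PI_ring :: "('a, 'b) ring_scheme \<Rightarrow> bool" where
  "PI_ring R \<longleftrightarrow>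
     ring R \<and>
     (\<exists>f :: ncpoly.
        (\<exists>w\<in>Poly_Mapping.keys f. Poly_Mapping.lookup f w = 1 \<and>
           (\<forall>v\<in>Poly_Mapping.keys f. length v \<le> length w)) \<and>
        (\<forall>a. range a \<subseteq> carrier R \<longrightarrow> ncpoly_eval R a f = \<zero>\<^bsub>R\<^esub>))"

end

theory Submission
  imports Defs "HOL-Combinatorics.Multiset_Permutations"
begin

text \<open>Let \<open>Z\<close> be the centre of \<open>R\<close>, and let \<open>u \<in> S\<close> be a unit of \<open>R\<close> with inverse \<open>v\<close>.  If \<open>v\<close> is integral over \<open>Z\<close>, say
\<open>v^K = z_0 + \<dots> + z_(K-1) v^(K-1)\<close>, then multiplying by \<open>u^(K-1)\<close> expresses \<open>v\<close> as a polynomial in \<open>u\<close> with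
coefficients in \<open>Z\<close>, so \<open>v \<in> S\<close>.  As \<open>Z\<close> is Noetherian, integrality follows once some nonzero central element \<open>c\<close>
multiplies \<open>R\<close> into a finitely generated \<open>Z\<close>-module: the chain of submodules \<open>c (Z + Z v + \<dots> + Z v^k)\<close> then
becomes constant, and \<open>c\<close> can be cancelled (\<open>inverse_in_intermediate_subring\<close>).  That such a \<open>c\<close> exists in every
prime PI-ring is Formanek's theorem.

It is proved here without the extended centroid and without structure theory, by means of the operators
\<open>r \<mapsto> \<Sum>k. p k r q k\<close> on \<open>R\<close>.  Say that \<open>r\<close> is in the closure of \<open>B\<close> if every such operator that kills \<open>B\<close> kills \<open>r\<close>.
The proof has two parts.

First, some nonzero ideal \<open>I\<close> lies in the closure of a finite set (\<open>exists_ideal_in_finite_closure\<close>).  Otherwise there are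
arbitrarily many operators for which just one order of composition gives a nonzero result at some element.  But
the operators satisfy a multilinear identity, by Regev's counting argument: modulo an identity of degree
\<open>d\<close> all multilinear words in \<open>n\<close> letters reduce to those with no decreasing subsequence of length \<open>d\<close>, of which there
are at most \<open>d^(2n)\<close>; hence words of operators, which are pairs of words in \<open>R\<close>, depend on at most
\<open>d^(4n)\<close> products, which is less than \<open>n!\<close> for some \<open>n\<close> (\<open>mult_ops_satisfy_identity\<close>).

Second, a minimal \<open>B\<close> with \<open>I\<close> in its closure has a dual basis of operators, up to a common factor, and therefore
operators with values in \<open>I\<close> have a trace.  The operator \<open>w \<mapsto> tr (x \<mapsto> w x b)\<close> vanishes on commutators, so its transpose
(exchange \<open>p k\<close> and \<open>q k\<close>) has central values; this is Razmyslov's construction of central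
polynomials (\<open>exists_central_valued_op\<close>).  Applying that transpose to the coefficients of the expansion of an element in the
basis \<open>B\<close> produces \<open>c\<close> (\<open>central_multiple_in_span\<close>).\<close>

section \<open>Finite sums and the centre\<close>

context abelian_monoid
begin

lemma finsum_in_carrier [intro]: "(\<And>i. i \<in> A \<Longrightarrow> f i \<in> carrier G) \<Longrightarrow> finsum G f A \<in> carrier G"
  by (rule finsum_closed) auto

lemma finsum_eqI:
  assumes "\<And>i. i \<in> A \<Longrightarrow> f i = g i" "\<And>i. i \<in> A \<Longrightarrow> g i \<in> carrier G"
  shows "finsum G f A = finsum G g A"
  by (rule finsum_cong') (use assms in auto)

lemma finsum_eq_zero: "(\<And>i. i \<in> A \<Longrightarrow> f i = \<zero>) \<Longrightarrow> finsum G f A = \<zero>"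
  by (rule add.finprod_one_eqI)

lemma finsum_insert':
  assumes "finite A" "a \<notin> A" "f a \<in> carrier G" "\<And>i. i \<in> A \<Longrightarrow> f i \<in> carrier G"
  shows "finsum G f (insert a A) = f a \<oplus> finsum G f A"
  using assms by (subst finsum_insert) auto

lemma finsum_add':
  assumes "\<And>i. i \<in> A \<Longrightarrow> f i \<in> carrier G" "\<And>i. i \<in> A \<Longrightarrow> g i \<in> carrier G"
  shows "(\<Oplus>i\<in>A. f i \<oplus> g i) = finsum G f A \<oplus> finsum G g A"
  using assms by (subst finsum_addf) auto

lemma finsum_only:
  assumes "finite A" "a \<in> A" "f a \<in> carrier G" "\<And>i. i \<in> A \<Longrightarrow> i \<noteq> a \<Longrightarrow> f i = \<zero>"
  shows "finsum G f A = f a"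
proof -
  have "finsum G f A = finsum G f (insert a (A - {a}))"
    using assms(2) by (simp add: insert_absorb)
  also have "\<dots> = f a \<oplus> finsum G f (A - {a})"
    using assms by (intro finsum_insert') auto
  also have "finsum G f (A - {a}) = \<zero>"
    using assms by (intro finsum_eq_zero) auto
  finally show ?thesis using assms by simp
qed

lemma finsum_swap:
  assumes "finite A" "finite B" "\<And>a b. a \<in> A \<Longrightarrow> b \<in> B \<Longrightarrow> f a b \<in> carrier G"
  shows "(\<Oplus>a\<in>A. \<Oplus>b\<in>B. f a b) = (\<Oplus>b\<in>B. \<Oplus>a\<in>A. f a b)"
  using assms(1,3)
proof (induction A rule: finite_induct)
  case (insert x F)
  have "(\<Oplus>a\<in>insert x F. \<Oplus>b\<in>B. f a b) = (\<Oplus>b\<in>B. f x b) \<oplus> (\<Oplus>b\<in>B. \<Oplus>a\<in>F. f a b)"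
    using insert by (subst finsum_insert') auto
  also have "\<dots> = (\<Oplus>b\<in>B. f x b \<oplus> (\<Oplus>a\<in>F. f a b))"
    using insert.prems by (intro finsum_add'[symmetric]) auto
  also have "\<dots> = (\<Oplus>b\<in>B. \<Oplus>a\<in>insert x F. f a b)"
    using insert by (intro finsum_eqI finsum_insert'[symmetric]) auto
  finally show ?case .
qed (simp add: finsum_eq_zero)

lemma finsum_Sigma:
  assumes "finite A" "finite B" "\<And>a b. a \<in> A \<Longrightarrow> b \<in> B \<Longrightarrow> f (a, b) \<in> carrier G"
  shows "finsum G f (A \<times> B) = (\<Oplus>a\<in>A. \<Oplus>b\<in>B. f (a, b))"
  using assms(1,3)
proof (induction A rule: finite_induct)
  case (insert x F)
  have "finsum G f (insert x F \<times> B) = finsum G f ((Pair x ` B) \<union> F \<times> B)"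
    by (rule arg_cong[of _ _ "finsum G f"]) auto
  also have "\<dots> = finsum G f (Pair x ` B) \<oplus> finsum G f (F \<times> B)"
    using insert assms(2) by (intro finsum_Un_disjoint) auto
  also have "finsum G f (Pair x ` B) = (\<Oplus>b\<in>B. f (x, b))"
    using insert by (subst finsum_reindex) (auto simp: inj_on_def)
  also have "finsum G f (F \<times> B) = (\<Oplus>a\<in>F. \<Oplus>b\<in>B. f (a, b))"
    using insert by auto
  finally show ?case using insert by (subst finsum_insert') auto
qed simp

end

context ring
begin

lemma finsum_mult_left:
  assumes "finite A" "a \<in> carrier R" "\<And>i. i \<in> A \<Longrightarrow> f i \<in> carrier R"
  shows "a \<otimes> (\<Oplus>i\<in>A. f i) = (\<Oplus>i\<in>A. a \<otimes> f i)"
  using assms by (intro finsum_rdistr) auto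

lemma finsum_mult_right:
  assumes "finite A" "a \<in> carrier R" "\<And>i. i \<in> A \<Longrightarrow> f i \<in> carrier R"
  shows "(\<Oplus>i\<in>A. f i) \<otimes> a = (\<Oplus>i\<in>A. f i \<otimes> a)"
  using assms by (intro finsum_ldistr) auto

lemma center_closed [simp]: "z \<in> ring_center R \<Longrightarrow> z \<in> carrier R"
  by (simp add: ring_center_def)

lemma center_commute: "z \<in> ring_center R \<Longrightarrow> x \<in> carrier R \<Longrightarrow> z \<otimes> x = x \<otimes> z"
  unfolding ring_center_def by blast

lemma centerI: "z \<in> carrier R \<Longrightarrow> (\<And>x. x \<in> carrier R \<Longrightarrow> z \<otimes> x = x \<otimes> z) \<Longrightarrow> z \<in> ring_center R"
  unfolding ring_center_def by blast

lemma center_lcomm: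
  assumes "z \<in> ring_center R" "x \<in> carrier R" "y \<in> carrier R"
  shows "x \<otimes> (z \<otimes> y) = z \<otimes> (x \<otimes> y)"
  using assms m_assoc[of x z y] m_assoc[of z x y] center_commute[of z x] by simp

lemma center_zero: "\<zero> \<in> ring_center R" and center_one: "\<one> \<in> ring_center R"
  by (auto intro: centerI)

lemma center_add: "a \<in> ring_center R \<Longrightarrow> b \<in> ring_center R \<Longrightarrow> a \<oplus> b \<in> ring_center R"
  by (rule centerI) (simp_all add: l_distr r_distr center_commute)

lemma center_neg: "a \<in> ring_center R \<Longrightarrow> \<ominus> a \<in> ring_center R"
  by (rule centerI) (simp_all add: l_minus r_minus center_commute)

lemma center_mult:
  assumes "a \<in> ring_center R" "b \<in> ring_center R"
  shows "a \<otimes> b \<in> ring_center R"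
proof (rule centerI)
  fix x assume x: "x \<in> carrier R"
  have "a \<otimes> b \<otimes> x = a \<otimes> (b \<otimes> x)" using assms x by (simp add: m_assoc)
  also have "b \<otimes> x = x \<otimes> b" by (rule center_commute[OF assms(2) x])
  also have "a \<otimes> (x \<otimes> b) = x \<otimes> (a \<otimes> b)" using assms x by (simp add: center_lcomm)
  finally show "a \<otimes> b \<otimes> x = x \<otimes> (a \<otimes> b)" .
qed (use assms in auto)

lemma center_finsum:
  assumes "\<And>i. i \<in> A \<Longrightarrow> f i \<in> ring_center R"
  shows "(\<Oplus>i\<in>A. f i) \<in> ring_center R"
proof (cases "finite A")
  case True
  then show ?thesis
    using assms
  proof (induction A rule: finite_induct)
    case (insert i A)
    then show ?case by (subst finsum_insert') (auto intro: center_add)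
  qed (simp add: center_zero)
qed (simp add: center_zero finsum_infinite)

section \<open>Multiplication operators and their closure\<close>

text \<open>The operators \<open>x \<mapsto> \<Sum>k. p k x q k\<close>, each together with \<open>x \<mapsto> \<Sum>k. q k x p k\<close>. The transpose of a
given operator depends a priori on the chosen sum, so the two are related by a predicate; where a
dual basis exists, \<open>transposed_vanishes\<close> below shows that it depends on the operator only.\<close>

inductive transposed_ops :: "('a \<Rightarrow> 'a) \<Rightarrow> ('a \<Rightarrow> 'a) \<Rightarrow> bool" where
  elem: "a \<in> carrier R \<Longrightarrow> b \<in> carrier R \<Longrightarrow> transposed_ops (\<lambda>x. a \<otimes> x \<otimes> b) (\<lambda>x. b \<otimes> x \<otimes> a)"
| add: "transposed_ops f f' \<Longrightarrow> transposed_ops g g' \<Longrightarrow>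
    transposed_ops (\<lambda>x. f x \<oplus> g x) (\<lambda>x. f' x \<oplus> g' x)"
| ext_eq: "transposed_ops f f' \<Longrightarrow> (\<And>x. x \<in> carrier R \<Longrightarrow> g x = f x) \<Longrightarrow>
    (\<And>x. x \<in> carrier R \<Longrightarrow> g' x = f' x) \<Longrightarrow> transposed_ops g g'"

definition mult_ops :: "('a \<Rightarrow> 'a) set" where
  "mult_ops = {f. \<exists>f'. transposed_ops f f'}"

lemma transposed_ops_sym: "transposed_ops f f' \<Longrightarrow> transposed_ops f' f"
proof (induction rule: transposed_ops.induct)
  case (ext_eq f f' g g')
  show ?case by (rule transposed_ops.ext_eq[OF ext_eq.IH]) (use ext_eq in auto)
qed (auto intro: transposed_ops.elem transposed_ops.add)

lemma transposed_ops_mult_ops: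
  "transposed_ops f f' \<Longrightarrow> f \<in> mult_ops" "transposed_ops f f' \<Longrightarrow> f' \<in> mult_ops"
  using transposed_ops_sym by (auto simp: mult_ops_def)

lemma mult_ops_elem: "a \<in> carrier R \<Longrightarrow> b \<in> carrier R \<Longrightarrow> (\<lambda>x. a \<otimes> x \<otimes> b) \<in> mult_ops"
  by (auto simp: mult_ops_def intro: elem)

lemma mult_ops_add: "f \<in> mult_ops \<Longrightarrow> g \<in> mult_ops \<Longrightarrow> (\<lambda>x. f x \<oplus> g x) \<in> mult_ops"
  by (auto simp: mult_ops_def intro: add)

lemma mult_ops_cong: "f \<in> mult_ops \<Longrightarrow> (\<And>x. x \<in> carrier R \<Longrightarrow> g x = f x) \<Longrightarrow> g \<in> mult_ops"
  unfolding mult_ops_def using ext_eq[of f _ g] by blast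

lemma mult_ops_induct [consumes 1, case_names elem add cong]:
  assumes "f \<in> mult_ops"
    and "\<And>a b. a \<in> carrier R \<Longrightarrow> b \<in> carrier R \<Longrightarrow> P (\<lambda>x. a \<otimes> x \<otimes> b)"
    and "\<And>f g. f \<in> mult_ops \<Longrightarrow> g \<in> mult_ops \<Longrightarrow> P f \<Longrightarrow> P g \<Longrightarrow> P (\<lambda>x. f x \<oplus> g x)"
    and "\<And>f g. f \<in> mult_ops \<Longrightarrow> P f \<Longrightarrow> (\<And>x. x \<in> carrier R \<Longrightarrow> g x = f x) \<Longrightarrow> P g"
  shows "P f"
proof -
  obtain f' where "transposed_ops f f'" using assms(1) by (auto simp: mult_ops_def)
  then show ?thesis
    by (induction rule: transposed_ops.induct)
      (auto intro: assms(2-4) transposed_ops_mult_ops)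
qed

lemma mult_ops_closed: "f \<in> mult_ops \<Longrightarrow> x \<in> carrier R \<Longrightarrow> f x \<in> carrier R"
  by (induction rule: mult_ops_induct) auto

lemma mult_ops_hom:
  "f \<in> mult_ops \<Longrightarrow> x \<in> carrier R \<Longrightarrow> y \<in> carrier R \<Longrightarrow> f (x \<oplus> y) = f x \<oplus> f y"
proof (induction rule: mult_ops_induct)
  case (add f g)
  then show ?case by (simp add: mult_ops_closed a_ac)
qed (auto simp: l_distr r_distr)

lemma mult_ops_zero: "f \<in> mult_ops \<Longrightarrow> f \<zero> = \<zero>"
  by (induction rule: mult_ops_induct) auto

lemma mult_ops_id: "(\<lambda>x. x) \<in> mult_ops"
  by (rule mult_ops_cong[OF mult_ops_elem[of \<one> \<one>]]) auto

lemma mult_ops_const_zero: "(\<lambda>x. \<zero>) \<in> mult_ops"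
  by (rule mult_ops_cong[OF mult_ops_elem[of \<zero> \<zero>]]) auto

lemma mult_ops_scale:
  assumes "f \<in> mult_ops" "a \<in> carrier R" "b \<in> carrier R"
  shows "(\<lambda>x. a \<otimes> f x \<otimes> b) \<in> mult_ops"
  using assms(1)
proof (induction rule: mult_ops_induct)
  case (elem c d)
  show ?case
    by (rule mult_ops_cong[OF mult_ops_elem[of "a \<otimes> c" "d \<otimes> b"]]) (use elem assms in \<open>auto simp: m_assoc\<close>)
next
  case (add f g)
  show ?case
    by (rule mult_ops_cong[OF mult_ops_add[OF add.IH]])
      (use add assms in \<open>auto simp: l_distr r_distr mult_ops_closed\<close>)
next
  case (cong f g)
  show ?case by (rule mult_ops_cong[OF cong.IH]) (simp add: cong)
qed

lemma mult_ops_lscale: "f \<in> mult_ops \<Longrightarrow> a \<in> carrier R \<Longrightarrow> (\<lambda>x. a \<otimes> f x) \<in> mult_ops"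
  by (rule mult_ops_cong[OF mult_ops_scale[of f a \<one>]]) (auto simp: mult_ops_closed)

lemma mult_ops_rscale: "f \<in> mult_ops \<Longrightarrow> a \<in> carrier R \<Longrightarrow> (\<lambda>x. f x \<otimes> a) \<in> mult_ops"
  by (rule mult_ops_cong[OF mult_ops_scale[of f \<one> a]]) (auto simp: mult_ops_closed)

lemma mult_ops_neg: "f \<in> mult_ops \<Longrightarrow> (\<lambda>x. \<ominus> f x) \<in> mult_ops"
  by (rule mult_ops_cong[OF mult_ops_lscale[of f "\<ominus> \<one>"]]) (auto simp: mult_ops_closed l_minus)

lemma mult_ops_diff: "f \<in> mult_ops \<Longrightarrow> g \<in> mult_ops \<Longrightarrow> (\<lambda>x. f x \<ominus> g x) \<in> mult_ops"
  unfolding a_minus_def by (intro mult_ops_add mult_ops_neg)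

lemma mult_ops_comp:
  assumes "f \<in> mult_ops" "g \<in> mult_ops"
  shows "(\<lambda>x. f (g x)) \<in> mult_ops"
  using assms(1)
proof (induction rule: mult_ops_induct)
  case (elem a b)
  then show ?case by (rule mult_ops_scale[OF assms(2)])
next
  case (add f g)
  from mult_ops_add[OF add.IH] show ?case .
next
  case (cong f h)
  show ?case by (rule mult_ops_cong[OF cong.IH]) (simp add: cong mult_ops_closed[OF assms(2)])
qed

lemma mult_ops_finsum:
  assumes "finite A" "\<And>i. i \<in> A \<Longrightarrow> F i \<in> mult_ops"
  shows "(\<lambda>x. \<Oplus>i\<in>A. F i x) \<in> mult_ops"
  using assms
proof (induction A rule: finite_induct)
  case empty
  then show ?case by (simp add: mult_ops_const_zero)
next
  case (insert i A)
  show ?case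
    by (rule mult_ops_cong[OF mult_ops_add[of "F i" "\<lambda>x. \<Oplus>i\<in>A. F i x"]])
      (use insert in \<open>auto intro!: finsum_insert' simp: mult_ops_closed\<close>)
qed

lemma mult_ops_ideal:
  assumes "ideal I R" "f \<in> mult_ops" "x \<in> I"
  shows "f x \<in> I"
proof -
  interpret ideal I R by fact
  have xc: "x \<in> carrier R" using assms(3) a_Hcarr by blast
  show ?thesis
    using assms(2)
  proof (induction rule: mult_ops_induct)
    case (elem a b)
    then show ?case using assms(3) by (simp add: I_l_closed I_r_closed)
  qed (use xc in \<open>auto simp: a_closed\<close>)
qed

lemma transposed_ops_repr:
  assumes "transposed_ops f f'"
  obtains n :: nat and p q where
    "\<And>k. p k \<in> carrier R" "\<And>k. q k \<in> carrier R"
    "\<And>x. x \<in> carrier R \<Longrightarrow> f x = (\<Oplus>k\<in>{..<n}. p k \<otimes> x \<otimes> q k)"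
    "\<And>x. x \<in> carrier R \<Longrightarrow> f' x = (\<Oplus>k\<in>{..<n}. q k \<otimes> x \<otimes> p k)"
proof -
  have "\<exists>(n::nat) p q. (\<forall>k. p k \<in> carrier R) \<and> (\<forall>k. q k \<in> carrier R) \<and>
    (\<forall>x\<in>carrier R. f x = (\<Oplus>k\<in>{..<n}. p k \<otimes> x \<otimes> q k) \<and> f' x = (\<Oplus>k\<in>{..<n}. q k \<otimes> x \<otimes> p k))"
    using assms
  proof (induction rule: transposed_ops.induct)
    case (elem a b)
    have "{..<Suc 0} = {0}" by auto
    with elem show ?case
      by (intro exI[of _ "Suc 0"] exI[of _ "\<lambda>_. a"] exI[of _ "\<lambda>_. b"]) (simp add: Pi_def)
  next
    case (add f f' g g')
    then obtain n p q m r s where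
      f: "\<forall>k. p k \<in> carrier R" "\<forall>k. q k \<in> carrier R"
        "\<forall>x\<in>carrier R. f x = (\<Oplus>k\<in>{..<n::nat}. p k \<otimes> x \<otimes> q k) \<and> f' x = (\<Oplus>k\<in>{..<n}. q k \<otimes> x \<otimes> p k)" and
      g: "\<forall>k. r k \<in> carrier R" "\<forall>k. s k \<in> carrier R"
        "\<forall>x\<in>carrier R. g x = (\<Oplus>k\<in>{..<m::nat}. r k \<otimes> x \<otimes> s k) \<and> g' x = (\<Oplus>k\<in>{..<m}. s k \<otimes> x \<otimes> r k)"
      by blast
    define p' where "p' k = (if k < n then p k else r (k - n))" for k
    define q' where "q' k = (if k < n then q k else s (k - n))" for k
    have split: "(\<Oplus>k\<in>{..<n+m}. h (p' k) (q' k)) = (\<Oplus>k\<in>{..<n}. h (p k) (q k)) \<oplus> (\<Oplus>k\<in>{..<m}. h (r k) (s k))"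
      if h: "\<And>a b. a \<in> carrier R \<Longrightarrow> b \<in> carrier R \<Longrightarrow> h a b \<in> carrier R" for h
    proof -
      have c: "h (p' k) (q' k) \<in> carrier R" for k using h f g by (auto simp: p'_def q'_def)
      have e: "{..<n+m} = {..<n} \<union> (\<lambda>k. k + n) ` {..<m}"
      proof (intro equalityI subsetI)
        fix k assume "k \<in> {..<n+m}"
        then show "k \<in> {..<n} \<union> (\<lambda>k. k + n) ` {..<m}"
          by (cases "k < n") (auto intro!: image_eqI[of _ _ "k - n"])
      qed auto
      have "(\<Oplus>k\<in>{..<n+m}. h (p' k) (q' k)) =
        (\<Oplus>k\<in>{..<n}. h (p' k) (q' k)) \<oplus> (\<Oplus>k\<in>(\<lambda>k. k + n) ` {..<m}. h (p' k) (q' k))"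
        unfolding e by (rule finsum_Un_disjoint) (use c in auto)
      also have "(\<Oplus>k\<in>{..<n}. h (p' k) (q' k)) = (\<Oplus>k\<in>{..<n}. h (p k) (q k))"
        by (rule finsum_eqI) (use f h in \<open>auto simp: p'_def q'_def\<close>)
      also have "(\<Oplus>k\<in>(\<lambda>k. k + n) ` {..<m}. h (p' k) (q' k)) = (\<Oplus>k\<in>{..<m}. h (p' (k+n)) (q' (k+n)))"
        by (rule finsum_reindex) (use c in \<open>auto simp: inj_on_def\<close>)
      also have "\<dots> = (\<Oplus>k\<in>{..<m}. h (r k) (s k))"
        by (rule finsum_eqI) (use g h in \<open>auto simp: p'_def q'_def\<close>)
      finally show ?thesis .
    qed
    show ?case
    proof (intro exI conjI ballI)
      show "\<forall>k. p' k \<in> carrier R" "\<forall>k. q' k \<in> carrier R" using f g by (auto simp: p'_def q'_def)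
      fix x assume x: "x \<in> carrier R"
      show "f x \<oplus> g x = (\<Oplus>k\<in>{..<n+m}. p' k \<otimes> x \<otimes> q' k)"
        using split[of "\<lambda>a b. a \<otimes> x \<otimes> b"] f(3) g(3) x by simp
      show "f' x \<oplus> g' x = (\<Oplus>k\<in>{..<n+m}. q' k \<otimes> x \<otimes> p' k)"
        using split[of "\<lambda>a b. b \<otimes> x \<otimes> a"] f(3) g(3) x by simp
    qed
  next
    case (ext_eq f f' g g')
    then show ?case by simp
  qed
  then show ?thesis using that by blast
qed

lemma transposed_ops_precomp_left:
  assumes "transposed_ops f f'" "a \<in> carrier R"
  shows "transposed_ops (\<lambda>x. f (a \<otimes> x)) (\<lambda>x. f' x \<otimes> a)"
  using assms(1)
proof (induction rule: transposed_ops.induct)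
  case (elem c d)
  show ?case
    by (rule transposed_ops.ext_eq[OF transposed_ops.elem[of "c \<otimes> a" d]])
      (use elem assms(2) in \<open>auto simp: m_assoc\<close>)
next
  case (add f f' g g')
  show ?case
    by (rule transposed_ops.ext_eq[OF transposed_ops.add[OF add.IH]])
      (use add transposed_ops_mult_ops assms(2) in \<open>auto simp: l_distr mult_ops_closed\<close>)
next
  case (ext_eq f f' g g')
  show ?case
    by (rule transposed_ops.ext_eq[OF ext_eq.IH]) (use ext_eq assms(2) in auto)
qed

lemma transposed_ops_precomp_right:
  assumes "transposed_ops f f'" "a \<in> carrier R"
  shows "transposed_ops (\<lambda>x. f (x \<otimes> a)) (\<lambda>x. a \<otimes> f' x)"
  using assms(1)
proof (induction rule: transposed_ops.induct)
  case (elem c d)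
  show ?case
    by (rule transposed_ops.ext_eq[OF transposed_ops.elem[of c "a \<otimes> d"]])
      (use elem assms(2) in \<open>auto simp: m_assoc\<close>)
next
  case (add f f' g g')
  show ?case
    by (rule transposed_ops.ext_eq[OF transposed_ops.add[OF add.IH]])
      (use add transposed_ops_mult_ops assms(2) in \<open>auto simp: r_distr mult_ops_closed\<close>)
next
  case (ext_eq f f' g g')
  show ?case
    by (rule transposed_ops.ext_eq[OF ext_eq.IH]) (use ext_eq assms(2) in auto)
qed

lemma transposed_ops_neg:
  assumes "transposed_ops f f'"
  shows "transposed_ops (\<lambda>x. \<ominus> f x) (\<lambda>x. \<ominus> f' x)"
  using assms
proof (induction rule: transposed_ops.induct)
  case (elem c d)
  show ?case
    by (rule transposed_ops.ext_eq[OF transposed_ops.elem[of "\<ominus> c" d]])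
      (use elem in \<open>auto simp: l_minus r_minus\<close>)
next
  case (add f f' g g')
  show ?case
    by (rule transposed_ops.ext_eq[OF transposed_ops.add[OF add.IH]])
      (use add transposed_ops_mult_ops in \<open>auto simp: minus_add mult_ops_closed a_comm\<close>)
next
  case (ext_eq f f' g g')
  show ?case
    by (rule transposed_ops.ext_eq[OF ext_eq.IH]) (use ext_eq in auto)
qed

text \<open>For a finite set and a prime ring, these are the elements of the ring in the span of the set over the
extended centroid; the description by operators makes it possible to work without these scalars.\<close>

definition op_closure :: "'a set \<Rightarrow> 'a set" where
  "op_closure B = {r \<in> carrier R. \<forall>f\<in>mult_ops. (\<forall>x\<in>B. f x = \<zero>) \<longrightarrow> f r = \<zero>}"

lemma op_closureD: "r \<in> op_closure B \<Longrightarrow> f \<in> mult_ops \<Longrightarrow> (\<And>x. x \<in> B \<Longrightarrow> f x = \<zero>) \<Longrightarrow> f r = \<zero>"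
  by (auto simp: op_closure_def)

end

section \<open>Primeness in terms of elements\<close>

locale elementwise_prime_ring = ring R for R (structure) +
  assumes one_not_zero: "\<one> \<noteq> \<zero>"
    and prime: "\<lbrakk>a \<in> carrier R; b \<in> carrier R; \<And>x. x \<in> carrier R \<Longrightarrow> a \<otimes> x \<otimes> b = \<zero>\<rbrakk>
      \<Longrightarrow> a = \<zero> \<or> b = \<zero>"

text \<open>Given \<open>a R b = 0\<close>, the ideals need not be generated explicitly: all \<open>x\<close> with \<open>x R b = 0\<close> form a
two-sided ideal containing \<open>a\<close>, and all \<open>y\<close> with \<open>x R y = 0\<close> for each such \<open>x\<close> form one containing \<open>b\<close>.\<close>

lemma prime_ring_imp_elementwise:
  fixes R (structure)
  assumes "prime_ring R"
  shows "elementwise_prime_ring R"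
proof -
  interpret ring R using assms by (simp add: prime_ring_def)
  have prime: "ideal I R \<Longrightarrow> ideal J R \<Longrightarrow> ideal_prod R I J = {\<zero>} \<Longrightarrow> I = {\<zero>} \<or> J = {\<zero>}" for I J
    using assms by (auto simp: prime_ring_def)
  show ?thesis
  proof unfold_locales
    show "\<one> \<noteq> \<zero>" using assms one_zeroD by (auto simp: prime_ring_def)
    fix a b assume a: "a \<in> carrier R" and b: "b \<in> carrier R"
      and z: "\<And>x. x \<in> carrier R \<Longrightarrow> a \<otimes> x \<otimes> b = \<zero>"
    define I where "I = {x \<in> carrier R. \<forall>r\<in>carrier R. x \<otimes> r \<otimes> b = \<zero>}"
    define J where "J = {y \<in> carrier R. \<forall>x\<in>I. \<forall>r\<in>carrier R. x \<otimes> r \<otimes> y = \<zero>}"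
    have Ic: "I \<subseteq> carrier R" and Jc: "J \<subseteq> carrier R" by (auto simp: I_def J_def)
    have I: "ideal I R"
    proof (rule idealI[OF ring_axioms])
      show "subgroup I (add_monoid R)"
        by (rule add.subgroupI) (auto simp: I_def b l_distr l_minus)
      fix x y assume x: "x \<in> I" and y: "y \<in> carrier R"
      then show "y \<otimes> x \<in> I" "x \<otimes> y \<in> I"
        using b by (auto simp: I_def m_assoc) (metis m_assoc m_closed)
    qed
    have J: "ideal J R"
    proof (rule idealI[OF ring_axioms])
      show "subgroup J (add_monoid R)"
        using Ic by (intro add.subgroupI) (auto simp: J_def r_distr r_minus subset_iff)
      fix x y assume x: "x \<in> J" and y: "y \<in> carrier R"
      then have "i \<otimes> r \<otimes> (y \<otimes> x) = i \<otimes> (r \<otimes> y) \<otimes> x" "i \<otimes> r \<otimes> (x \<otimes> y) = i \<otimes> r \<otimes> x \<otimes> y"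
        if "i \<in> I" "r \<in> carrier R" for i r using that Ic Jc by (auto simp: m_assoc subset_iff)
      then show "y \<otimes> x \<in> J" "x \<otimes> y \<in> J" using x y by (auto simp: J_def)
    qed
    have prod_zero: "x = \<zero>" if "x \<in> ideal_prod R I J" for x
      using that
    proof (induction rule: ideal_prod.induct)
      case (prod i j)
      then have "i \<otimes> \<one> \<otimes> j = \<zero>" by (auto simp: J_def)
      then show ?case using prod Ic by auto
    qed auto
    have "\<zero> \<in> ideal_prod R I J"
      using ideal_prod.prod[of \<zero> I \<zero> J R] I J
      by (simp add: additive_subgroup.zero_closed ideal.axioms(1))
    with prod_zero have "ideal_prod R I J = {\<zero>}" by blast
    from prime[OF I J this] have "I = {\<zero>} \<or> J = {\<zero>}" .
    moreover have "a \<in> I" "b \<in> J" using a b z by (auto simp: I_def J_def)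
    ultimately show "a = \<zero> \<or> b = \<zero>" by auto
  qed
qed

context elementwise_prime_ring
begin

lemma prime_witness:
  assumes "a \<in> carrier R" "b \<in> carrier R" "a \<noteq> \<zero>" "b \<noteq> \<zero>"
  obtains x where "x \<in> carrier R" "a \<otimes> x \<otimes> b \<noteq> \<zero>"
  using prime[of a b] assms by blast

end

section \<open>Dual bases\<close>

text \<open>An ideal inside the closure of a finite set \<open>B\<close>, with operators \<open>lam x\<close> dual to the elements of
\<open>B\<close>.  Division is not available, so duality holds up to the common factor \<open>d\<close>; for \<open>r\<close> in \<open>I\<close> the
element \<open>lam x r\<close> is to be thought of as \<open>d\<close> times the \<open>x\<close>-coordinate of \<open>r\<close>.\<close>

locale dual_basis = elementwise_prime_ring R + ideal I R for I and R (structure) +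
  fixes B :: "'a set" and lam :: "'a \<Rightarrow> 'a \<Rightarrow> 'a" and d :: 'a
  assumes I_nonzero: "I \<noteq> {\<zero>}"
    and fin: "finite B" and B_carrier: "B \<subseteq> carrier R"
    and I_closure: "I \<subseteq> op_closure B"
    and lam_ops: "x \<in> B \<Longrightarrow> lam x \<in> mult_ops"
    and lam_diag: "x \<in> B \<Longrightarrow> lam x x = d"
    and lam_offdiag: "x \<in> B \<Longrightarrow> y \<in> B \<Longrightarrow> x \<noteq> y \<Longrightarrow> lam x y = \<zero>"
    and d_carrier [simp]: "d \<in> carrier R" and d_nonzero: "d \<noteq> \<zero>"
begin

lemma B_closed [simp]: "x \<in> B \<Longrightarrow> x \<in> carrier R" using B_carrier by auto
lemma I_in_carrier [simp]: "x \<in> I \<Longrightarrow> x \<in> carrier R" by (rule a_Hcarr)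
lemma lam_closed [simp]: "x \<in> B \<Longrightarrow> r \<in> carrier R \<Longrightarrow> lam x r \<in> carrier R"
  using lam_ops mult_ops_closed by blast

text \<open>The expansion of \<open>r\<close> in the basis \<open>B\<close>, pushed through an operator \<open>f\<close>; operators are linear over the coordinates.
Both sides are operators in \<open>r\<close> that agree on \<open>B\<close>, hence on its closure.\<close>

lemma expand:
  assumes "f \<in> mult_ops" "r \<in> I" "w \<in> carrier R"
  shows "d \<otimes> w \<otimes> f r = (\<Oplus>x\<in>B. lam x r \<otimes> w \<otimes> f x)"
proof -
  define g where "g z = d \<otimes> w \<otimes> f z \<ominus> (\<Oplus>x\<in>B. lam x z \<otimes> (w \<otimes> f x))" for z
  have c: "f z \<in> carrier R" if "z \<in> carrier R" for z using assms mult_ops_closed that by blast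
  have "g \<in> mult_ops"
    unfolding g_def using assms fin c
    by (intro mult_ops_diff mult_ops_finsum mult_ops_lscale mult_ops_rscale lam_ops) auto
  moreover have "g y = \<zero>" if y: "y \<in> B" for y
  proof -
    have "(\<Oplus>x\<in>B. lam x y \<otimes> (w \<otimes> f x)) = lam y y \<otimes> (w \<otimes> f y)"
      using y fin assms c lam_offdiag by (intro finsum_only) auto
    then show ?thesis using y assms c by (simp add: g_def lam_diag m_assoc r_neg a_minus_def)
  qed
  ultimately have "g r = \<zero>" using I_closure assms(2) op_closureD by blast
  moreover have "(\<Oplus>x\<in>B. lam x r \<otimes> (w \<otimes> f x)) = (\<Oplus>x\<in>B. lam x r \<otimes> w \<otimes> f x)"
    using assms c by (intro finsum_eqI) (auto simp: m_assoc)
  moreover have "(\<Oplus>x\<in>B. lam x r \<otimes> w \<otimes> f x) \<in> carrier R"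
    using assms c by auto
  ultimately show ?thesis
    using assms c by (simp add: g_def)
qed

text \<open>The elements that are multiples of \<open>d\<close> by a scalar of the extended centroid.\<close>

definition scalar :: "'a \<Rightarrow> bool" where
  "scalar e \<longleftrightarrow> e \<in> carrier R \<and> (\<forall>w\<in>carrier R. e \<otimes> w \<otimes> d = d \<otimes> w \<otimes> e)"

lemma scalar_lam:
  assumes "x \<in> B" "r \<in> I"
  shows "scalar (lam x r)"
  unfolding scalar_def
proof (intro conjI ballI)
  fix w assume w: "w \<in> carrier R"
  have "d \<otimes> w \<otimes> lam x r = (\<Oplus>y\<in>B. lam y r \<otimes> w \<otimes> lam x y)"
    using assms w by (intro expand lam_ops)
  also have "\<dots> = lam x r \<otimes> w \<otimes> lam x x"
    using assms w fin lam_offdiag by (intro finsum_only) auto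
  finally show "lam x r \<otimes> w \<otimes> d = d \<otimes> w \<otimes> lam x r" using assms by (simp add: lam_diag)
qed (use assms in auto)

lemma cancel_d:
  assumes "a \<in> carrier R" "b \<in> carrier R" "\<And>u. u \<in> carrier R \<Longrightarrow> a \<otimes> u \<otimes> d = b \<otimes> u \<otimes> d"
  shows "a = b"
proof -
  have "(a \<ominus> b) \<otimes> u \<otimes> d = \<zero>" if "u \<in> carrier R" for u
    using assms that by (simp add: a_minus_def l_distr l_minus r_neg)
  then have "a \<ominus> b = \<zero>" using prime[of "a \<ominus> b" d] assms d_nonzero by auto
  then show ?thesis using assms by simp
qed

text \<open>Writing \<open>e = s d\<close> and \<open>e' = s' d\<close> with scalars \<open>s\<close>, \<open>s'\<close>, both sides would be \<open>s s' d w d\<close>.  Without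
these scalars, the factor \<open>d\<close> is carried along on the right until \<open>e\<close> and \<open>e'\<close> have passed each other.\<close>

lemma scalar_commute:
  assumes "scalar e" "scalar e'" "w \<in> carrier R"
  shows "e \<otimes> w \<otimes> e' = e' \<otimes> w \<otimes> e"
proof (rule cancel_d)
  note [simp] = assms(3)
  have c [simp]: "e \<in> carrier R" "e' \<in> carrier R" using assms by (auto simp: scalar_def)
  have s: "e \<otimes> v \<otimes> d = d \<otimes> v \<otimes> e" "e' \<otimes> v \<otimes> d = d \<otimes> v \<otimes> e'" if "v \<in> carrier R" for v
    using assms that by (auto simp: scalar_def)
  fix u assume u [simp]: "u \<in> carrier R"
  have "e \<otimes> w \<otimes> e' \<otimes> u \<otimes> d = e \<otimes> (w \<otimes> e' \<otimes> u) \<otimes> d" by (simp add: m_assoc)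
  also have "\<dots> = d \<otimes> w \<otimes> e' \<otimes> (u \<otimes> e)" by (subst s) (simp_all add: m_assoc)
  also have "\<dots> = e' \<otimes> w \<otimes> (d \<otimes> u \<otimes> e)" by (subst s(2)[symmetric]) (simp_all add: m_assoc)
  also have "\<dots> = e' \<otimes> w \<otimes> e \<otimes> u \<otimes> d" by (subst s(1)[symmetric]) (simp_all add: m_assoc)
  finally show "e \<otimes> w \<otimes> e' \<otimes> u \<otimes> d = e' \<otimes> w \<otimes> e \<otimes> u \<otimes> d" .
qed (use assms in \<open>auto simp: scalar_def\<close>)

lemma I_element:
  obtains i where "i \<in> I" "i \<noteq> \<zero>"
  using I_nonzero additive_subgroup.zero_closed[OF is_additive_subgroup] by blast

text \<open>If \<open>f = \<Sum>k. p k \<cdot> q k\<close> vanishes on a nonzero ideal, then \<open>\<Sum>k. p k \<otimes> q k\<close> is zero as a tensor over the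
extended centroid, and so is its mirror image.  In coordinates: the \<open>y\<close>-coordinates of the \<open>q k\<close>
satisfy \<open>\<Sum>k. p k v lam y (q k) = 0\<close>; being scalars, they can be moved to the left of \<open>p k\<close>, and then the
expansion of the \<open>q k\<close> shows that the transpose vanishes.  As only elements of \<open>I\<close> have coordinates,
the \<open>q k\<close> are first multiplied on the left by an element \<open>j\<close> of \<open>I\<close> that is a multiple of \<open>s\<close>.\<close>

lemma transposed_vanishes:
  assumes tr: "transposed_ops f f'" and s: "s \<in> carrier R" "s \<noteq> \<zero>"
    and van: "\<And>a b. a \<in> carrier R \<Longrightarrow> b \<in> carrier R \<Longrightarrow> f (a \<otimes> s \<otimes> b) = \<zero>"
    and x: "x \<in> carrier R"
  shows "f' x = \<zero>"
proof -
  note [simp] = s(1) x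
  have fM: "f \<in> mult_ops" "f' \<in> mult_ops" using tr transposed_ops_mult_ops by auto
  obtain n :: nat and p q where pq [simp]: "\<And>k. p k \<in> carrier R" "\<And>k. q k \<in> carrier R"
    and f: "\<And>x. x \<in> carrier R \<Longrightarrow> f x = (\<Oplus>k\<in>{..<n}. p k \<otimes> x \<otimes> q k)"
    and f': "\<And>x. x \<in> carrier R \<Longrightarrow> f' x = (\<Oplus>k\<in>{..<n}. q k \<otimes> x \<otimes> p k)"
    by (rule transposed_ops_repr[OF tr]) (rule that)
  obtain i where i: "i \<in> I" "i \<noteq> \<zero>" by (rule I_element)
  obtain r where r [simp]: "r \<in> carrier R" and ri: "i \<otimes> r \<otimes> s \<noteq> \<zero>"
    using prime_witness[of i s] i s by auto
  define j where "j = i \<otimes> r \<otimes> s"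
  have jI: "j \<in> I" using i by (simp add: j_def I_r_closed)
  then have jc [simp]: "j \<in> carrier R" by simp
  have van_j: "f (a \<otimes> j \<otimes> b) = \<zero>" if "a \<in> carrier R" "b \<in> carrier R" for a b
    using van[of "a \<otimes> i \<otimes> r" b] that i by (simp add: j_def m_assoc)
  \<comment> \<open>The extra factor \<open>c\<close> is for cancelling \<open>j\<close> by primeness at the end.\<close>
  have jfx: "j \<otimes> c \<otimes> f' x = \<zero>" if c [simp]: "c \<in> carrier R" for c
  proof -
    have jq: "j \<otimes> c \<otimes> q k \<in> I" for k using jI by (simp add: I_r_closed)
    have G: "(\<Oplus>k\<in>{..<n}. p k \<otimes> v \<otimes> h (j \<otimes> c \<otimes> q k)) = \<zero>"
      if "h \<in> mult_ops" "v \<in> carrier R" for h v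
      using that
    proof (induction rule: mult_ops_induct)
      case (elem a b)
      have "(\<Oplus>k\<in>{..<n}. p k \<otimes> v \<otimes> (a \<otimes> (j \<otimes> c \<otimes> q k) \<otimes> b)) =
        (\<Oplus>k\<in>{..<n}. p k \<otimes> (v \<otimes> a \<otimes> j \<otimes> c) \<otimes> q k \<otimes> b)"
        using elem by (intro finsum_eqI) (auto simp: m_assoc)
      also have "\<dots> = f ((v \<otimes> a) \<otimes> j \<otimes> c) \<otimes> b"
        using elem by (subst f) (auto simp: finsum_mult_right)
      also have "\<dots> = \<zero>" using elem by (subst van_j) auto
      finally show ?case .
    next
      case (add g h)
      have "(\<Oplus>k\<in>{..<n}. p k \<otimes> v \<otimes> (g (j \<otimes> c \<otimes> q k) \<oplus> h (j \<otimes> c \<otimes> q k))) =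
        (\<Oplus>k\<in>{..<n}. p k \<otimes> v \<otimes> g (j \<otimes> c \<otimes> q k) \<oplus> p k \<otimes> v \<otimes> h (j \<otimes> c \<otimes> q k))"
        using add by (intro finsum_eqI) (auto simp: r_distr mult_ops_closed)
      also have "\<dots> = (\<Oplus>k\<in>{..<n}. p k \<otimes> v \<otimes> g (j \<otimes> c \<otimes> q k)) \<oplus> (\<Oplus>k\<in>{..<n}. p k \<otimes> v \<otimes> h (j \<otimes> c \<otimes> q k))"
        using add by (intro finsum_add') (auto simp: mult_ops_closed)
      finally show ?case using add by simp
    next
      case (cong g h)
      then show ?case by simp
    qed
    have H: "(\<Oplus>k\<in>{..<n}. lam y (j \<otimes> c \<otimes> q k) \<otimes> v \<otimes> p k) = \<zero>"
      if y: "y \<in> B" and v [simp]: "v \<in> carrier R" for y v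
    proof (rule cancel_d)
      fix u assume u [simp]: "u \<in> carrier R"
      have "(\<Oplus>k\<in>{..<n}. lam y (j \<otimes> c \<otimes> q k) \<otimes> v \<otimes> p k) \<otimes> u \<otimes> d =
         (\<Oplus>k\<in>{..<n}. lam y (j \<otimes> c \<otimes> q k) \<otimes> v \<otimes> p k) \<otimes> (u \<otimes> d)"
        using y by (intro m_assoc) auto
      also have "\<dots> = (\<Oplus>k\<in>{..<n}. lam y (j \<otimes> c \<otimes> q k) \<otimes> v \<otimes> p k \<otimes> (u \<otimes> d))"
        using y by (intro finsum_mult_right) auto
      also have "\<dots> = (\<Oplus>k\<in>{..<n}. (d \<otimes> v) \<otimes> (p k \<otimes> u \<otimes> lam y (j \<otimes> c \<otimes> q k)))"
      proof (rule finsum_eqI)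
        fix k
        have "lam y (j \<otimes> c \<otimes> q k) \<otimes> (v \<otimes> p k \<otimes> u) \<otimes> d = d \<otimes> (v \<otimes> p k \<otimes> u) \<otimes> lam y (j \<otimes> c \<otimes> q k)"
          using scalar_lam[OF y jq] by (auto simp: scalar_def)
        then show "lam y (j \<otimes> c \<otimes> q k) \<otimes> v \<otimes> p k \<otimes> (u \<otimes> d) = (d \<otimes> v) \<otimes> (p k \<otimes> u \<otimes> lam y (j \<otimes> c \<otimes> q k))"
          using y by (simp add: m_assoc)
      qed (use y in auto)
      also have "\<dots> = (d \<otimes> v) \<otimes> (\<Oplus>k\<in>{..<n}. p k \<otimes> u \<otimes> lam y (j \<otimes> c \<otimes> q k))"
        using y by (intro finsum_mult_left[symmetric]) auto
      also have "\<dots> = \<zero>" using G[OF lam_ops[OF y], of u] by simp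
      finally show "(\<Oplus>k\<in>{..<n}. lam y (j \<otimes> c \<otimes> q k) \<otimes> v \<otimes> p k) \<otimes> u \<otimes> d = \<zero> \<otimes> u \<otimes> d" by simp
    qed (use y in auto)
    have "d \<otimes> w \<otimes> (j \<otimes> c \<otimes> f' x) = \<zero>" if w [simp]: "w \<in> carrier R" for w
    proof -
      have "d \<otimes> w \<otimes> (j \<otimes> c \<otimes> f' x) = (\<Oplus>k\<in>{..<n}. d \<otimes> w \<otimes> (j \<otimes> c \<otimes> (q k \<otimes> x \<otimes> p k)))"
        by (simp add: f' finsum_mult_left)
      also have "\<dots> = (\<Oplus>k\<in>{..<n}. \<Oplus>y\<in>B. lam y (j \<otimes> c \<otimes> q k) \<otimes> (w \<otimes> y \<otimes> x) \<otimes> p k)"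
      proof (rule finsum_eqI)
        fix k
        have "d \<otimes> w \<otimes> (j \<otimes> c \<otimes> q k) = (\<Oplus>y\<in>B. lam y (j \<otimes> c \<otimes> q k) \<otimes> w \<otimes> y)"
          using expand[OF mult_ops_id jq] by simp
        then have "d \<otimes> w \<otimes> (j \<otimes> c \<otimes> q k) \<otimes> (x \<otimes> p k) = (\<Oplus>y\<in>B. lam y (j \<otimes> c \<otimes> q k) \<otimes> w \<otimes> y) \<otimes> (x \<otimes> p k)"
          by simp
        also have "\<dots> = (\<Oplus>y\<in>B. lam y (j \<otimes> c \<otimes> q k) \<otimes> w \<otimes> y \<otimes> (x \<otimes> p k))"
          using fin by (intro finsum_mult_right) auto
        also have "\<dots> = (\<Oplus>y\<in>B. lam y (j \<otimes> c \<otimes> q k) \<otimes> (w \<otimes> y \<otimes> x) \<otimes> p k)"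
          by (intro finsum_eqI) (auto simp: m_assoc)
        finally show "d \<otimes> w \<otimes> (j \<otimes> c \<otimes> (q k \<otimes> x \<otimes> p k)) = (\<Oplus>y\<in>B. lam y (j \<otimes> c \<otimes> q k) \<otimes> (w \<otimes> y \<otimes> x) \<otimes> p k)"
          by (simp add: m_assoc)
      qed auto
      also have "\<dots> = (\<Oplus>y\<in>B. \<Oplus>k\<in>{..<n}. lam y (j \<otimes> c \<otimes> q k) \<otimes> (w \<otimes> y \<otimes> x) \<otimes> p k)"
        using fin by (intro finsum_swap) auto
      also have "\<dots> = \<zero>"
        by (rule finsum_eq_zero) (simp add: H)
      finally show ?thesis .
    qed
    then show ?thesis using prime[of d "j \<otimes> c \<otimes> f' x"] d_nonzero fM by (auto simp: mult_ops_closed)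
  qed
  show ?thesis
    using prime[of j "f' x"] jfx ri fM jc by (auto simp: mult_ops_closed simp flip: j_def)
qed

text \<open>An operator that vanishes on the ideal generated by \<open>s\<close> has zero transpose, and therefore, transposing
back, is zero.\<close>

lemma op_faithful:
  assumes "f \<in> mult_ops" "s \<in> carrier R" "s \<noteq> \<zero>" "x \<in> carrier R" "f x \<noteq> \<zero>"
  obtains a b where "a \<in> carrier R" "b \<in> carrier R" "f (a \<otimes> s \<otimes> b) \<noteq> \<zero>"
proof -
  obtain f' where tr: "transposed_ops f f'" using assms(1) by (auto simp: mult_ops_def)
  note witness = that
  show ?thesis
  proof (rule ccontr)
    assume "\<not> thesis"
    then have "f (a \<otimes> s \<otimes> b) = \<zero>" if "a \<in> carrier R" "b \<in> carrier R" for a b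
      using witness[of a b] that by blast
    then have "f' y = \<zero>" if "y \<in> carrier R" for y
      using transposed_vanishes[OF tr assms(2,3)] that by blast
    then have "f x = \<zero>"
      using transposed_vanishes[OF transposed_ops_sym[OF tr] one_closed one_not_zero _ assms(4)] by simp
    with assms(5) show False by simp
  qed
qed

section \<open>The trace of an operator\<close>

definition op_trace :: "('a \<Rightarrow> 'a) \<Rightarrow> 'a" where
  "op_trace f = (\<Oplus>x\<in>B. lam x (f x))"

lemma op_trace_closed: "f \<in> mult_ops \<Longrightarrow> op_trace f \<in> carrier R"
  by (auto simp: op_trace_def mult_ops_closed)

text \<open>The usual proof that \<open>tr (f g) = tr (g f)\<close>: by \<open>expand\<close> both traces are sums of products of matrix entries,
and matrix entries commute as they are scalars.\<close>

lemma op_trace_comp_commute: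
  assumes f: "f \<in> mult_ops" and g: "g \<in> mult_ops"
    and fI: "\<And>x. x \<in> B \<Longrightarrow> f x \<in> I" and gI: "\<And>x. x \<in> B \<Longrightarrow> g x \<in> I"
  shows "op_trace (\<lambda>x. f (g x)) = op_trace (\<lambda>x. g (f x))"
proof -
  have c: "f x \<in> carrier R" "g x \<in> carrier R" if "x \<in> carrier R" for x
    using f g mult_ops_closed that by auto
  have tr: "d \<otimes> w \<otimes> op_trace (\<lambda>x. h (k x)) =
      (\<Oplus>x\<in>B. \<Oplus>y\<in>B. lam y (k x) \<otimes> w \<otimes> lam x (h y))"
    if h: "h \<in> mult_ops" and k: "k \<in> mult_ops" "\<And>x. x \<in> B \<Longrightarrow> k x \<in> I" and w: "w \<in> carrier R" for h k w
  proof -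
    have hc: "h x \<in> carrier R" if "x \<in> carrier R" for x using h mult_ops_closed that by auto
    have "d \<otimes> w \<otimes> op_trace (\<lambda>x. h (k x)) = (\<Oplus>x\<in>B. d \<otimes> w \<otimes> lam x (h (k x)))"
      unfolding op_trace_def using w k(2) hc fin by (intro finsum_mult_left) auto
    also have "\<dots> = (\<Oplus>x\<in>B. \<Oplus>y\<in>B. lam y (k x) \<otimes> w \<otimes> lam x (h y))"
    proof (rule finsum_eqI)
      fix x assume x: "x \<in> B"
      show "d \<otimes> w \<otimes> lam x (h (k x)) = (\<Oplus>y\<in>B. lam y (k x) \<otimes> w \<otimes> lam x (h y))"
        using expand[OF mult_ops_comp[OF lam_ops[OF x] h] k(2)[OF x] w] .
    qed (use k hc w in auto)
    finally show ?thesis .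
  qed
  show ?thesis
  proof -
    have "d \<otimes> w \<otimes> op_trace (\<lambda>x. f (g x)) = d \<otimes> w \<otimes> op_trace (\<lambda>x. g (f x))"
      if w: "w \<in> carrier R" for w
    proof -
      have "d \<otimes> w \<otimes> op_trace (\<lambda>x. f (g x)) = (\<Oplus>x\<in>B. \<Oplus>y\<in>B. lam y (g x) \<otimes> w \<otimes> lam x (f y))"
        by (rule tr[OF f g gI w])
      also have "\<dots> = (\<Oplus>y\<in>B. \<Oplus>x\<in>B. lam y (g x) \<otimes> w \<otimes> lam x (f y))"
        using fin w c by (intro finsum_swap) auto
      also have "\<dots> = (\<Oplus>y\<in>B. \<Oplus>x\<in>B. lam x (f y) \<otimes> w \<otimes> lam y (g x))"
        using fI gI w c by (intro finsum_eqI finsum_in_carrier scalar_commute scalar_lam) auto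
      also have "\<dots> = d \<otimes> w \<otimes> op_trace (\<lambda>x. g (f x))"
        by (rule tr[OF g f fI w, symmetric])
      finally show ?thesis .
    qed
    then have "d \<otimes> w \<otimes> (op_trace (\<lambda>x. f (g x)) \<ominus> op_trace (\<lambda>x. g (f x))) = \<zero>" if "w \<in> carrier R" for w
      using that op_trace_closed[OF mult_ops_comp[OF f g]] op_trace_closed[OF mult_ops_comp[OF g f]]
      by (simp add: a_minus_def r_distr r_minus r_neg)
    then have "op_trace (\<lambda>x. f (g x)) \<ominus> op_trace (\<lambda>x. g (f x)) = \<zero>"
      using prime[of d "op_trace (\<lambda>x. f (g x)) \<ominus> op_trace (\<lambda>x. g (f x))"] d_nonzero
        op_trace_closed[OF mult_ops_comp[OF f g]] op_trace_closed[OF mult_ops_comp[OF g f]] by auto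
    then show ?thesis
      using op_trace_closed[OF mult_ops_comp[OF f g]] op_trace_closed[OF mult_ops_comp[OF g f]] by simp
  qed
qed

lemma B_nonempty: "B \<noteq> {}"
proof
  assume e: "B = {}"
  obtain i where i: "i \<in> I" "i \<noteq> \<zero>" by (rule I_element)
  then have "i \<in> op_closure {}" using I_closure e by auto
  from op_closureD[OF this mult_ops_id] i show False by simp
qed

text \<open>The operator \<open>x \<mapsto> u lam y x v\<close> has at most one nonzero diagonal entry, and \<open>op_faithful\<close> provides \<open>u\<close> and
\<open>v\<close> for which this entry is nonzero.  It is a sum of elementary operators, so one of them has nonzero trace.
The factor \<open>b\<close> is essential: on matrices of size \<open>n\<close>, left multiplication by \<open>w\<close> has trace \<open>n tr w\<close>, which is
always zero if the characteristic divides \<open>n\<close>.\<close>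

lemma op_trace_elem_nonzero:
  obtains w b where "w \<in> I" "b \<in> carrier R" "op_trace (\<lambda>x. w \<otimes> x \<otimes> b) \<noteq> \<zero>"
proof (rule ccontr)
  note witness = that
  assume "\<not> thesis"
  then have z: "op_trace (\<lambda>x. w \<otimes> x \<otimes> b) = \<zero>" if "w \<in> I" "b \<in> carrier R" for w b
    using witness[of w b] that by blast
  have z': "op_trace (\<lambda>x. u \<otimes> f x \<otimes> v) = \<zero>" if "f \<in> mult_ops" "u \<in> I" "v \<in> carrier R" for f u v
    using that
  proof (induction rule: mult_ops_induct)
    case (elem a b)
    then have "op_trace (\<lambda>x. (u \<otimes> a) \<otimes> x \<otimes> (b \<otimes> v)) = \<zero>" by (intro z) (auto simp: I_r_closed)
    moreover have "op_trace (\<lambda>x. u \<otimes> (a \<otimes> x \<otimes> b) \<otimes> v) = op_trace (\<lambda>x. (u \<otimes> a) \<otimes> x \<otimes> (b \<otimes> v))"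
      unfolding op_trace_def
    proof (rule finsum_eqI)
      fix x assume x: "x \<in> B"
      then have "u \<otimes> (a \<otimes> x \<otimes> b) \<otimes> v = u \<otimes> a \<otimes> x \<otimes> (b \<otimes> v)" using elem by (simp add: m_assoc)
      then show "lam x (u \<otimes> (a \<otimes> x \<otimes> b) \<otimes> v) = lam x (u \<otimes> a \<otimes> x \<otimes> (b \<otimes> v))" by simp
    qed (use elem in auto)
    ultimately show ?case by simp
  next
    case (add f g)
    have "op_trace (\<lambda>x. u \<otimes> (f x \<oplus> g x) \<otimes> v) = (\<Oplus>x\<in>B. lam x (u \<otimes> f x \<otimes> v) \<oplus> lam x (u \<otimes> g x \<otimes> v))"
      unfolding op_trace_def
    proof (rule finsum_eqI)
      fix x assume x: "x \<in> B"
      have "u \<otimes> (f x \<oplus> g x) \<otimes> v = u \<otimes> f x \<otimes> v \<oplus> u \<otimes> g x \<otimes> v"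
        using add x by (simp add: l_distr r_distr mult_ops_closed)
      then show "lam x (u \<otimes> (f x \<oplus> g x) \<otimes> v) = lam x (u \<otimes> f x \<otimes> v) \<oplus> lam x (u \<otimes> g x \<otimes> v)"
        using add x mult_ops_hom[OF lam_ops[OF x]] by (simp add: mult_ops_closed)
    qed (use add in \<open>auto simp: mult_ops_closed\<close>)
    also have "\<dots> = op_trace (\<lambda>x. u \<otimes> f x \<otimes> v) \<oplus> op_trace (\<lambda>x. u \<otimes> g x \<otimes> v)"
      unfolding op_trace_def using add by (intro finsum_add') (auto simp: mult_ops_closed)
    finally show ?case using add by simp
  next
    case (cong f g)
    have "op_trace (\<lambda>x. u \<otimes> g x \<otimes> v) = op_trace (\<lambda>x. u \<otimes> f x \<otimes> v)"
      unfolding op_trace_def using cong by (intro finsum_eqI) (auto simp: mult_ops_closed)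
    then show ?case using cong by simp
  qed
  obtain y where y: "y \<in> B" using B_nonempty by auto
  obtain i where i: "i \<in> I" "i \<noteq> \<zero>" by (rule I_element)
  obtain r where r: "r \<in> carrier R" and ird: "i \<otimes> r \<otimes> d \<noteq> \<zero>"
    using prime_witness[of i d] i d_nonzero by auto
  obtain a b where ab: "a \<in> carrier R" "b \<in> carrier R" "lam y (a \<otimes> (i \<otimes> r \<otimes> d) \<otimes> b) \<noteq> \<zero>"
    using op_faithful[OF lam_ops[OF y], of "i \<otimes> r \<otimes> d" y] ird i r y d_nonzero by (auto simp: lam_diag)
  define u where "u = a \<otimes> i \<otimes> r"
  have u: "u \<in> I" using ab i r by (simp add: u_def I_l_closed I_r_closed)
  have "op_trace (\<lambda>x. u \<otimes> lam y x \<otimes> b) = lam y (u \<otimes> lam y y \<otimes> b)"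
    unfolding op_trace_def
  proof (rule finsum_only)
    fix x assume "x \<in> B" "x \<noteq> y"
    then show "lam x (u \<otimes> lam y x \<otimes> b) = \<zero>"
      using y u ab lam_offdiag[of y x] mult_ops_zero[OF lam_ops] by auto
  qed (use fin y u ab in auto)
  also have "\<dots> = lam y (a \<otimes> (i \<otimes> r \<otimes> d) \<otimes> b)"
    using y ab i r by (simp add: lam_diag u_def m_assoc)
  finally show False using z'[OF lam_ops[OF y] u ab(2)] ab(3) by simp
qed

text \<open>Razmyslov's transposition trick.  The operator \<open>t w = tr (x \<mapsto> w x b)\<close> satisfies \<open>t (a w) = t (w a)\<close>.
The transpose of \<open>w \<mapsto> t (a w) - t (w a)\<close> is \<open>x \<mapsto> f x a - a f x\<close>, where \<open>f\<close> is the transpose of \<open>t\<close>;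
so the values of \<open>f\<close> commute with every \<open>a\<close> in \<open>I\<close>, and then with all of \<open>R\<close>.\<close>

lemma exists_central_valued_op:
  obtains f where "f \<in> mult_ops" "\<And>x. x \<in> carrier R \<Longrightarrow> f x \<in> ring_center R"
    "\<exists>x\<in>carrier R. f x \<noteq> \<zero>"
proof -
  obtain w0 b where w0: "w0 \<in> I" and b: "b \<in> carrier R" and nz: "op_trace (\<lambda>x. w0 \<otimes> x \<otimes> b) \<noteq> \<zero>"
    by (rule op_trace_elem_nonzero)
  define t where "t w = op_trace (\<lambda>x. w \<otimes> x \<otimes> b)" for w
  have "t \<in> mult_ops"
    unfolding t_def op_trace_def
  proof (rule mult_ops_finsum[OF fin])
    fix x assume x: "x \<in> B"
    have "(\<lambda>w. w \<otimes> x \<otimes> b) \<in> mult_ops"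
      by (rule mult_ops_cong[OF mult_ops_elem[of \<one> "x \<otimes> b"]]) (use x b in \<open>auto simp: m_assoc\<close>)
    then show "(\<lambda>w. lam x (w \<otimes> x \<otimes> b)) \<in> mult_ops" by (rule mult_ops_comp[OF lam_ops[OF x]])
  qed
  then obtain f where tr: "transposed_ops t f" by (auto simp: mult_ops_def)
  have f: "f \<in> mult_ops" and t: "t \<in> mult_ops" using tr transposed_ops_mult_ops by auto
  have fc: "f x \<in> carrier R" if "x \<in> carrier R" for x using f that mult_ops_closed by auto
  have tc: "t x \<in> carrier R" if "x \<in> carrier R" for x using t that mult_ops_closed by auto
  \<comment> \<open>The composites of \<open>x \<mapsto> a x\<close> and \<open>x \<mapsto> w x b\<close> are \<open>x \<mapsto> a w x b\<close> and \<open>x \<mapsto> w a x b\<close>.\<close>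
  have tcomm: "t (a \<otimes> w) = t (w \<otimes> a)" if a: "a \<in> I" and w: "w \<in> I" for a w
  proof -
    have "op_trace (\<lambda>x. a \<otimes> (w \<otimes> x \<otimes> b) \<otimes> \<one>) = op_trace (\<lambda>x. w \<otimes> (a \<otimes> x \<otimes> \<one>) \<otimes> b)"
      by (rule op_trace_comp_commute[of "\<lambda>x. a \<otimes> x \<otimes> \<one>" "\<lambda>x. w \<otimes> x \<otimes> b"])
        (use a w b in \<open>auto intro: mult_ops_elem simp: I_r_closed\<close>)
    moreover have "op_trace (\<lambda>x. a \<otimes> (w \<otimes> x \<otimes> b) \<otimes> \<one>) = t (a \<otimes> w)"
      unfolding t_def op_trace_def using a w b by (intro finsum_eqI) (auto simp: m_assoc)
    moreover have "op_trace (\<lambda>x. w \<otimes> (a \<otimes> x \<otimes> \<one>) \<otimes> b) = t (w \<otimes> a)"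
      unfolding t_def op_trace_def using a w b by (intro finsum_eqI) (auto simp: m_assoc)
    ultimately show ?thesis by simp
  qed
  have comm_I: "f x \<otimes> a = a \<otimes> f x" if a: "a \<in> I" and x: "x \<in> carrier R" for a x
  proof -
    have ac: "a \<in> carrier R" using a by simp
    have tr': "transposed_ops (\<lambda>w. t (a \<otimes> w) \<oplus> (\<ominus> t (w \<otimes> a))) (\<lambda>x. f x \<otimes> a \<oplus> (\<ominus> (a \<otimes> f x)))"
      by (intro transposed_ops.add transposed_ops_neg transposed_ops_precomp_left
          transposed_ops_precomp_right tr ac)
    obtain i where i: "i \<in> I" "i \<noteq> \<zero>" by (rule I_element)
    have "f x \<otimes> a \<oplus> (\<ominus> (a \<otimes> f x)) = \<zero>"
    proof (rule transposed_vanishes[OF tr' _ i(2) _ x])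
      fix u v assume uv: "u \<in> carrier R" "v \<in> carrier R"
      then have m: "u \<otimes> i \<otimes> v \<in> I" using i by (simp add: I_l_closed I_r_closed)
      then have mc: "u \<otimes> i \<otimes> v \<in> carrier R" by simp
      show "t (a \<otimes> (u \<otimes> i \<otimes> v)) \<oplus> (\<ominus> t (u \<otimes> i \<otimes> v \<otimes> a)) = \<zero>"
        unfolding tcomm[OF a m] using mc ac by (intro r_neg tc) auto
    qed (use i in auto)
    then show ?thesis using fc[OF x] ac by (simp flip: a_minus_def)
  qed
  show ?thesis
  proof (rule that[OF f])
    fix x assume x: "x \<in> carrier R"
    have "f x \<otimes> r = r \<otimes> f x" if r: "r \<in> carrier R" for r
    proof -
      obtain i where i: "i \<in> I" "i \<noteq> \<zero>" by (rule I_element)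
      have "(f x \<otimes> r \<ominus> r \<otimes> f x) \<otimes> u \<otimes> i = \<zero>" if u: "u \<in> carrier R" for u
      proof -
        have ui: "u \<otimes> i \<in> I" "r \<otimes> (u \<otimes> i) \<in> I" using u i r by (simp_all add: I_l_closed)
        have "f x \<otimes> r \<otimes> (u \<otimes> i) = f x \<otimes> (r \<otimes> (u \<otimes> i))" using u i r fc[OF x] by (simp add: m_assoc)
        also have "\<dots> = r \<otimes> ((u \<otimes> i) \<otimes> f x)"
          using comm_I[OF ui(2) x] u i r fc[OF x] by (simp add: m_assoc)
        also have "\<dots> = r \<otimes> f x \<otimes> (u \<otimes> i)"
          using comm_I[OF ui(1) x] u i r fc[OF x] by (simp add: m_assoc)
        finally show ?thesis using u i r fc[OF x] by (simp add: m_assoc a_minus_def l_distr l_minus r_neg)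
      qed
      then have "f x \<otimes> r \<ominus> r \<otimes> f x = \<zero>"
        using prime[of "f x \<otimes> r \<ominus> r \<otimes> f x" i] i r fc[OF x] by auto
      then show ?thesis using r fc[OF x] by simp
    qed
    then show "f x \<in> ring_center R" using fc[OF x] by (intro centerI)
  next
    show "\<exists>x\<in>carrier R. f x \<noteq> \<zero>"
    proof (rule ccontr)
      assume "\<not> (\<exists>x\<in>carrier R. f x \<noteq> \<zero>)"
      then have "f (u \<otimes> \<one> \<otimes> v) = \<zero>" if "u \<in> carrier R" "v \<in> carrier R" for u v using that by auto
      from transposed_vanishes[OF transposed_ops_sym[OF tr] one_closed one_not_zero this, of w0]
      have "t w0 = \<zero>" using w0 by simp
      with nz show False by (simp add: t_def)
    qed
  qed
qed

text \<open>A central-valued operator \<open>f\<close> turns the coefficients of the expansion \<open>d w r = \<Sum>x. lam x r w x\<close> into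
central elements: \<open>f (u d v) r = \<Sum>x. f (u lam x r v) x\<close> for \<open>r\<close> in \<open>I\<close>.  Since \<open>z = f (u d v)\<close> can be
chosen in \<open>I\<close>, replacing \<open>r\<close> by \<open>z r\<close> extends this to all of \<open>R\<close>.\<close>

lemma central_multiple_in_span:
  obtains c where "c \<in> ring_center R" "c \<noteq> \<zero>"
    "\<And>r. r \<in> carrier R \<Longrightarrow> \<exists>k. (\<forall>x\<in>B. k x \<in> ring_center R) \<and> c \<otimes> r = (\<Oplus>x\<in>B. k x \<otimes> x)"
proof -
  obtain f where f: "f \<in> mult_ops" and fZ: "\<And>x. x \<in> carrier R \<Longrightarrow> f x \<in> ring_center R"
    and fnz: "\<exists>x\<in>carrier R. f x \<noteq> \<zero>" by (rule exists_central_valued_op) (rule that)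
  have fc [simp]: "f x \<in> carrier R" if "x \<in> carrier R" for x using f that mult_ops_closed by auto
  obtain i where i: "i \<in> I" "i \<noteq> \<zero>" by (rule I_element)
  obtain r where r: "r \<in> carrier R" and ird: "i \<otimes> r \<otimes> d \<noteq> \<zero>"
    using prime_witness[of i d] i d_nonzero by auto
  obtain a v where av: "a \<in> carrier R" "v \<in> carrier R" "f (a \<otimes> (i \<otimes> r \<otimes> d) \<otimes> v) \<noteq> \<zero>"
    using op_faithful[OF f, of "i \<otimes> r \<otimes> d"] fnz ird i r by auto
  define u where "u = a \<otimes> i \<otimes> r"
  have uI: "u \<in> I" using av i r by (simp add: u_def I_l_closed I_r_closed)
  then have u: "u \<in> carrier R" by simp
  note v = av(2)
  define z where "z = f (u \<otimes> d \<otimes> v)"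
  have zI: "z \<in> I" unfolding z_def
    using uI v by (intro mult_ops_ideal[OF ideal_axioms f]) (simp add: I_r_closed)
  then have zc: "z \<in> carrier R" by simp
  have zZ: "z \<in> ring_center R" using fZ u v by (simp add: z_def)
  have znz: "z \<noteq> \<zero>" using av i r by (simp add: z_def u_def m_assoc)
  have span: "z \<otimes> s = (\<Oplus>x\<in>B. f (u \<otimes> lam x s \<otimes> v) \<otimes> x)" if s: "s \<in> I" for s
  proof -
    define g where "g y = z \<otimes> y \<ominus> (\<Oplus>x\<in>B. f (u \<otimes> lam x y \<otimes> v) \<otimes> x)" for y
    have lhs: "(\<lambda>y. z \<otimes> y) \<in> mult_ops"
      by (rule mult_ops_lscale[OF mult_ops_id zc])
    have "(\<lambda>y. f (u \<otimes> lam x y \<otimes> v) \<otimes> x) \<in> mult_ops" if x: "x \<in> B" for x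
      using x u v by (intro mult_ops_rscale mult_ops_comp[OF f] mult_ops_scale lam_ops) auto
    then have g: "g \<in> mult_ops"
      unfolding g_def using lhs fin by (intro mult_ops_diff mult_ops_finsum) auto
    have "g y = \<zero>" if y: "y \<in> B" for y
    proof -
      have "(\<Oplus>x\<in>B. f (u \<otimes> lam x y \<otimes> v) \<otimes> x) = f (u \<otimes> lam y y \<otimes> v) \<otimes> y"
        using y u v fin lam_offdiag mult_ops_zero[OF f] by (intro finsum_only) auto
      then show ?thesis using y zc u v by (simp add: g_def lam_diag flip: z_def)
    qed
    then have "g s = \<zero>" using g I_closure s op_closureD by blast
    moreover have "(\<Oplus>x\<in>B. f (u \<otimes> lam x s \<otimes> v) \<otimes> x) \<in> carrier R"
      using s u v by (intro finsum_in_carrier) auto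
    ultimately show ?thesis using zc s by (simp add: g_def)
  qed
  show ?thesis
  proof (rule that[of "z \<otimes> z"])
    show "z \<otimes> z \<in> ring_center R" by (intro center_mult zZ)
    show "z \<otimes> z \<noteq> \<zero>"
    proof
      assume z0: "z \<otimes> z = \<zero>"
      have "z \<otimes> x \<otimes> z = \<zero>" if x: "x \<in> carrier R" for x
      proof -
        have "z \<otimes> x \<otimes> z = x \<otimes> (z \<otimes> z)"
          using center_lcomm[OF zZ x zc] x zc by (simp add: m_assoc)
        then show ?thesis using z0 x by simp
      qed
      then show False using prime[of z z] zc znz by auto
    qed
    fix s assume s: "s \<in> carrier R"
    have zs: "z \<otimes> s \<in> I" using zI s by (rule I_r_closed)
    show "\<exists>k. (\<forall>x\<in>B. k x \<in> ring_center R) \<and> z \<otimes> z \<otimes> s = (\<Oplus>x\<in>B. k x \<otimes> x)"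
      using span[OF zs] zc s u v zs
      by (intro exI[of _ "\<lambda>x. f (u \<otimes> lam x (z \<otimes> s) \<otimes> v)"]) (auto simp: m_assoc intro!: fZ)
  qed
qed

end

context elementwise_prime_ring
begin

text \<open>A set \<open>B\<close> of least size whose closure contains \<open>I\<close> has a dual basis: by minimality each \<open>x \<in> B\<close> is
separated from \<open>B - {x}\<close> by an operator \<open>F x\<close>, and multiplying the nonzero values \<open>F x x\<close> together, with
suitable ring elements in between, gives the common factor \<open>d\<close>.\<close>

lemma central_multiple_in_finite_span:
  assumes I: "ideal I R" "I \<noteq> {\<zero>}" and fin: "finite C" "C \<subseteq> carrier R" "I \<subseteq> op_closure C"
  obtains B c where "finite B" "B \<subseteq> carrier R" "c \<in> ring_center R" "c \<noteq> \<zero>"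
    "\<And>r. r \<in> carrier R \<Longrightarrow> \<exists>k. (\<forall>x\<in>B. k x \<in> ring_center R) \<and> c \<otimes> r = (\<Oplus>x\<in>B. k x \<otimes> x)"
proof -
  define P where "P n \<longleftrightarrow> (\<exists>B. finite B \<and> B \<subseteq> carrier R \<and> I \<subseteq> op_closure B \<and> card B = n)" for n
  have "P (card C)" using fin by (auto simp: P_def)
  then have least: "P (LEAST n. P n)" "\<And>n. P n \<Longrightarrow> (LEAST n. P n) \<le> n"
    by (auto intro: LeastI Least_le)
  from least(1) obtain B where B: "finite B" "B \<subseteq> carrier R" "I \<subseteq> op_closure B" "card B = (LEAST n. P n)"
    by (auto simp: P_def)
  have "\<exists>f\<in>mult_ops. (\<forall>y\<in>B - {x}. f y = \<zero>) \<and> f x \<noteq> \<zero>" if x: "x \<in> B" for x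
  proof -
    have "\<not> P (card (B - {x}))"
      using least(2)[of "card (B - {x})"] B x by (metis card_Diff1_less not_less)
    then have "\<not> I \<subseteq> op_closure (B - {x})" using B by (auto simp: P_def)
    then obtain s f where s: "s \<in> I" and f: "f \<in> mult_ops" "\<forall>y\<in>B - {x}. f y = \<zero>" "f s \<noteq> \<zero>"
      using ideal.Icarr[OF I(1)] by (auto simp: op_closure_def)
    have "f x \<noteq> \<zero>"
    proof
      assume "f x = \<zero>"
      then have "f y = \<zero>" if "y \<in> B" for y using f that by (cases "y = x") auto
      then have "f s = \<zero>" using op_closureD[of s B f] B(3) s f by auto
      with f show False by simp
    qed
    with f show ?thesis by auto
  qed
  then obtain F where F: "\<And>x. x \<in> B \<Longrightarrow> F x \<in> mult_ops" "\<And>x y. x \<in> B \<Longrightarrow> y \<in> B \<Longrightarrow> y \<noteq> x \<Longrightarrow> F x y = \<zero>"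
    "\<And>x. x \<in> B \<Longrightarrow> F x x \<noteq> \<zero>" by (metis Diff_iff singletonD)
  have Fc: "F x y \<in> carrier R" if "x \<in> B" "y \<in> carrier R" for x y using F(1) that mult_ops_closed by blast
  have "\<exists>d lam. d \<in> carrier R \<and> d \<noteq> \<zero> \<and> (\<forall>x\<in>A. lam x \<in> mult_ops \<and> lam x x = d \<and>
      (\<forall>y\<in>B. y \<noteq> x \<longrightarrow> lam x y = \<zero>))" if "A \<subseteq> B" for A
    using finite_subset[OF that B(1)] that
  proof (induction A rule: finite_induct)
    case empty
    show ?case using one_not_zero by (intro exI[of _ \<one>]) auto
  next
    case (insert a A)
    then obtain d lam where d: "d \<in> carrier R" "d \<noteq> \<zero>" and
      lam: "\<forall>x\<in>A. lam x \<in> mult_ops \<and> lam x x = d \<and> (\<forall>y\<in>B. y \<noteq> x \<longrightarrow> lam x y = \<zero>)" by auto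
    have a: "a \<in> B" "F a a \<in> carrier R" using insert B(2) Fc by auto
    obtain w where w: "w \<in> carrier R" "d \<otimes> w \<otimes> F a a \<noteq> \<zero>"
      using prime_witness[of d "F a a"] d a F(3) by blast
    define lam' where "lam' x = (if x = a then (\<lambda>y. d \<otimes> w \<otimes> F a y) else (\<lambda>y. lam x y \<otimes> (w \<otimes> F a a)))" for x
    have "lam' x \<in> mult_ops" if "x \<in> insert a A" for x
      using that w d a F(1) lam by (auto simp: lam'_def intro!: mult_ops_lscale mult_ops_rscale)
    moreover have "lam' x x = d \<otimes> w \<otimes> F a a" if "x \<in> insert a A" for x
      using that w d a lam by (auto simp: lam'_def m_assoc)
    moreover have "lam' x y = \<zero>" if "x \<in> insert a A" "y \<in> B" "y \<noteq> x" for x y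
      using that w d a lam F(2) by (auto simp: lam'_def)
    ultimately show ?case using w d a by (intro exI[of _ "d \<otimes> w \<otimes> F a a"] exI[of _ lam']) auto
  qed
  from this[OF order.refl] obtain d lam where d: "d \<in> carrier R" "d \<noteq> \<zero>" and
    lam: "\<forall>x\<in>B. lam x \<in> mult_ops \<and> lam x x = d \<and> (\<forall>y\<in>B. y \<noteq> x \<longrightarrow> lam x y = \<zero>)" by auto
  interpret dual_basis I R B lam d
    by (intro dual_basis.intro dual_basis_axioms.intro elementwise_prime_ring_axioms)
      (use I B d lam in auto)
  show ?thesis
    by (rule central_multiple_in_span) (rule that[OF B(1,2)])
qed

end

section \<open>Permutations without long decreasing subsequences\<close>

abbreviation perms :: "nat \<Rightarrow> nat list set" where
  "perms n \<equiv> permutations_of_set {..<n}"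

lemma permsD:
  assumes "\<rho> \<in> perms n"
  shows "distinct \<rho>" "set \<rho> = {..<n}" "length \<rho> = n"
  using permutations_of_setD[OF assms] distinct_card[of \<rho>] by auto

lemma rev_perms: "\<rho> \<in> perms n \<Longrightarrow> rev \<rho> \<in> perms n"
  by (auto simp: permutations_of_set_def)

definition decreasing_blocks :: "nat list list \<Rightarrow> bool" where
  "decreasing_blocks bs \<longleftrightarrow> [] \<notin> set bs \<and> sorted_wrt (\<lambda>b c. hd b > hd c) bs"

text \<open>Equivalently, the word has a decreasing subsequence of length \<open>d\<close>: its members are the heads of the blocks.
The division into blocks is what an identity of degree \<open>d\<close> can be applied to.\<close>

definition splits_decreasingly :: "nat \<Rightarrow> nat list \<Rightarrow> bool" where
  "splits_decreasingly d \<rho> \<longleftrightarrow>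
     (\<exists>w bs. \<rho> = w @ concat bs \<and> length bs = d \<and> decreasing_blocks bs)"

definition good_perms :: "nat \<Rightarrow> nat \<Rightarrow> nat list set" where
  "good_perms d n = {\<rho> \<in> perms n. \<not> splits_decreasingly d \<rho>}"

lemma finite_good_perms [simp]: "finite (good_perms d n)"
  by (simp add: good_perms_def)

text \<open>A decreasing subsequence of length \<open>k + 1\<close> ends at position \<open>p\<close>.\<close>

primrec ends_decreasing :: "nat list \<Rightarrow> nat \<Rightarrow> nat \<Rightarrow> bool" where
  "ends_decreasing \<rho> 0 p \<longleftrightarrow> p < length \<rho>"
| "ends_decreasing \<rho> (Suc k) p \<longleftrightarrow>
     p < length \<rho> \<and> (\<exists>q<p. \<rho> ! q > \<rho> ! p \<and> ends_decreasing \<rho> k q)"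

lemma ends_decreasing_le: "ends_decreasing \<rho> k p \<Longrightarrow> k \<le> p"
  by (induction k arbitrary: p) (auto, metis Suc_leI le_less_trans)

lemma ends_decreasing_Suc: "ends_decreasing \<rho> (Suc k) p \<Longrightarrow> ends_decreasing \<rho> k p"
proof (induction k arbitrary: p)
  case (Suc k)
  then obtain q where "q < p" "\<rho> ! q > \<rho> ! p" "ends_decreasing \<rho> (Suc k) q" "p < length \<rho>"
    by (subst (asm) ends_decreasing.simps(2)) auto
  with Suc.IH show ?case by (subst ends_decreasing.simps(2)) blast
qed auto

lemma ends_decreasing_mono: "ends_decreasing \<rho> k p \<Longrightarrow> j \<le> k \<Longrightarrow> ends_decreasing \<rho> j p"
proof (induction "k - j" arbitrary: k)
  case (Suc m)
  then obtain k' where "k = Suc k'" "j \<le> k'" by (cases k) auto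
  with Suc ends_decreasing_Suc show ?case by (metis Suc_diff_le diff_Suc_Suc Suc_inject)
qed auto

lemma ends_decreasing_blocks:
  assumes "ends_decreasing \<rho> k p"
  shows "\<exists>w bs. \<rho> = w @ concat (bs @ [drop p \<rho>]) \<and> length bs = k \<and> decreasing_blocks (bs @ [drop p \<rho>])"
  using assms
proof (induction k arbitrary: p)
  case 0
  then show ?case
    by (intro exI[of _ "take p \<rho>"] exI[of _ "[]"]) (auto simp: decreasing_blocks_def)
next
  case (Suc k)
  then obtain q where q: "q < p" "\<rho> ! q > \<rho> ! p" "ends_decreasing \<rho> k q" and p: "p < length \<rho>"
    by auto
  then obtain w bs where w: "\<rho> = w @ concat (bs @ [drop q \<rho>])" "length bs = k"
    "decreasing_blocks (bs @ [drop q \<rho>])" using Suc.IH by blast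
  define c where "c = take (p - q) (drop q \<rho>)"
  have c: "drop q \<rho> = c @ drop p \<rho>"
    using q(1) append_take_drop_id[of "p - q" "drop q \<rho>"] by (simp add: c_def)
  have cn: "c \<noteq> []" using q(1) p by (simp add: c_def)
  have hc: "hd c = hd (drop q \<rho>)" using c cn by simp
  have hq: "hd (drop q \<rho>) = \<rho> ! q" "hd (drop p \<rho>) = \<rho> ! p" "drop p \<rho> \<noteq> []"
    using q(1) p by (simp_all add: hd_drop_conv_nth)
  have "decreasing_blocks ((bs @ [c]) @ [drop p \<rho>])"
    using w(3) cn hc hq q(2) by (auto simp: decreasing_blocks_def sorted_wrt_append intro: less_trans)
  moreover have "\<rho> = w @ concat ((bs @ [c]) @ [drop p \<rho>])" using w(1) c by simp
  ultimately show ?case using w(2) by (intro exI[of _ w] exI[of _ "bs @ [c]"]) simp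
qed

definition label :: "nat list \<Rightarrow> nat \<Rightarrow> nat" where
  "label \<rho> p = Max {k. ends_decreasing \<rho> k p}"

lemma label_ends:
  assumes "p < length \<rho>"
  shows "ends_decreasing \<rho> (label \<rho> p) p" "ends_decreasing \<rho> k p \<Longrightarrow> k \<le> label \<rho> p"
proof -
  have "finite {k. ends_decreasing \<rho> k p}"
    by (rule finite_subset[of _ "{..p}"]) (auto dest: ends_decreasing_le)
  moreover have "{k. ends_decreasing \<rho> k p} \<noteq> {}"
    using assms ends_decreasing.simps(1) by blast
  ultimately show "ends_decreasing \<rho> (label \<rho> p) p" "ends_decreasing \<rho> k p \<Longrightarrow> k \<le> label \<rho> p"
    using Max_in[of "{k. ends_decreasing \<rho> k p}"] unfolding label_def by auto
qed

lemma label_less: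
  assumes "q < p" "p < length \<rho>" "\<rho> ! q > \<rho> ! p"
  shows "label \<rho> q < label \<rho> p"
proof -
  have "ends_decreasing \<rho> (label \<rho> q) q" using assms by (intro label_ends) simp
  then have "ends_decreasing \<rho> (Suc (label \<rho> q)) p" using assms by auto
  then show ?thesis using label_ends(2)[OF assms(2)] by fastforce
qed

lemma label_bound:
  assumes "\<not> splits_decreasingly d \<rho>" "p < length \<rho>" "d > 0"
  shows "label \<rho> p < d"
proof (rule ccontr)
  assume "\<not> label \<rho> p < d"
  then have "ends_decreasing \<rho> (d - 1) p"
    using label_ends(1)[OF assms(2)] by (auto intro: ends_decreasing_mono)
  then obtain w bs where "\<rho> = w @ concat (bs @ [drop p \<rho>])" "length bs = d - 1"
    "decreasing_blocks (bs @ [drop p \<rho>])" using ends_decreasing_blocks by blast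
  then have "splits_decreasingly d \<rho>"
    unfolding splits_decreasingly_def using assms(3)
    by (intro exI[of _ w] exI[of _ "bs @ [drop p \<rho>]"]) auto
  with assms(1) show False ..
qed

definition position :: "nat list \<Rightarrow> nat \<Rightarrow> nat" where
  "position \<rho> v = (THE p. p < length \<rho> \<and> \<rho> ! p = v)"

lemma position_nth: "distinct \<rho> \<Longrightarrow> p < length \<rho> \<Longrightarrow> position \<rho> (\<rho> ! p) = p"
  unfolding position_def by (rule the_equality) (auto simp: nth_eq_iff_index_eq)

text \<open>The labels listed by position and by value.  Entries with the same label increase from left to
right, so these two lists determine the permutation.\<close>

definition label_code :: "nat list \<Rightarrow> nat list \<times> nat list" where
  "label_code \<rho> =
     (map (label \<rho>) [0..<length \<rho>], map (\<lambda>v. label \<rho> (position \<rho> v)) [0..<length \<rho>])"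

text \<open>At the first position where two permutations with the same code differ, the smaller value would
occur later in the other permutation with the same label, which contradicts \<open>label_less\<close>.\<close>

lemma label_code_no_smaller:
  assumes \<rho>: "\<rho> \<in> perms n" and \<tau>: "\<tau> \<in> perms n" and code: "label_code \<rho> = label_code \<tau>"
    and p: "p < n" and eq: "\<And>q. q < p \<Longrightarrow> \<rho> ! q = \<tau> ! q"
  shows "\<not> \<rho> ! p < \<tau> ! p"
proof
  assume less: "\<rho> ! p < \<tau> ! p"
  note s = permsD[OF \<rho>] and t = permsD[OF \<tau>]
  have lab: "label \<rho> q = label \<tau> q" if "q < n" for q
    using code that s t by (auto simp: label_code_def)
  have pos: "label \<rho> (position \<rho> v) = label \<tau> (position \<tau> v)" if "v < n" for v
    using code that s t by (auto simp: label_code_def)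
  have v: "\<rho> ! p < n" using s p nth_mem[of p \<rho>] by auto
  then have "\<rho> ! p \<in> set \<tau>" using t by auto
  then obtain p' where p': "p' < n" "\<tau> ! p' = \<rho> ! p"
    by (metis in_set_conv_nth t(3))
  have "\<not> p' < p"
  proof
    assume "p' < p"
    then have "\<rho> ! p' = \<rho> ! p" using eq p' by simp
    then show False using nth_eq_iff_index_eq[OF s(1), of p' p] s(3) p p'(1) \<open>p' < p\<close> by simp
  qed
  moreover have "p' \<noteq> p" using p' less by auto
  ultimately have "label \<tau> p < label \<tau> p'"
    using label_less[of p p' \<tau>] p' t less by simp
  moreover have "label \<rho> p = label \<tau> p'"
    using pos[OF v] position_nth[of \<rho> p] position_nth[of \<tau> p'] s t p p' by simp
  ultimately show False using lab[OF p] by simp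
qed

lemma inj_on_label_code: "inj_on label_code (perms n)"
proof (rule inj_onI)
  fix \<rho> \<tau> assume st: "\<rho> \<in> perms n" "\<tau> \<in> perms n" "label_code \<rho> = label_code \<tau>"
  have "p < n \<longrightarrow> \<rho> ! p = \<tau> ! p" for p
  proof (induction p rule: less_induct)
    case (less p)
    then show ?case
      using label_code_no_smaller[OF st, of p] label_code_no_smaller[OF st(2,1) st(3)[symmetric], of p]
      by (metis less_trans linorder_neqE_nat)
  qed
  then show "\<rho> = \<tau>" using permsD[OF st(1)] permsD[OF st(2)] by (intro nth_equalityI) auto
qed

text \<open>Latyshev's bound.  What matters is that it grows only exponentially in \<open>n\<close>, whereas the number of all
permutations is \<open>n!\<close>.\<close>

lemma card_good_perms:
  assumes "d > 0"
  shows "card (good_perms d n) \<le> d ^ (2 * n)"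
proof -
  let ?L = "{xs. set xs \<subseteq> {..<d} \<and> length xs = n}"
  have "label_code ` good_perms d n \<subseteq> ?L \<times> ?L"
  proof
    fix c assume "c \<in> label_code ` good_perms d n"
    then obtain \<rho> where \<rho>: "\<rho> \<in> perms n" "\<not> splits_decreasingly d \<rho>" "c = label_code \<rho>"
      by (auto simp: good_perms_def)
    note s = permsD[OF \<rho>(1)]
    have "label \<rho> (position \<rho> v) < d" if "v < n" for v
    proof -
      from that s obtain p where "p < n" "\<rho> ! p = v" by (metis in_set_conv_nth lessThan_iff)
      then show ?thesis using label_bound[OF \<rho>(2) _ assms] position_nth[OF s(1)] s by auto
    qed
    then show "c \<in> ?L \<times> ?L"
      using label_bound[OF \<rho>(2) _ assms] s by (auto simp: \<rho>(3) label_code_def)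
  qed
  moreover have "finite (?L \<times> ?L)" using finite_lists_length_eq[of "{..<d}"] by simp
  ultimately have "card (label_code ` good_perms d n) \<le> card (?L \<times> ?L)"
    by (intro card_mono)
  also have "\<dots> = d ^ (2 * n)"
    using card_lists_length_eq[of "{..<d}" n] by (simp add: card_cartesian_product power_add mult_2)
  also have "card (label_code ` good_perms d n) = card (good_perms d n)"
    by (rule card_image[OF inj_on_subset[OF inj_on_label_code]]) (auto simp: good_perms_def)
  finally show ?thesis .
qed

lemma exists_power_less_fact: "\<exists>n. K ^ n < (fact n :: nat)"
proof -
  \<comment> \<open>For \<open>n = 2 m\<close>, half of the factors of \<open>n!\<close> exceed \<open>m > K^2\<close>.\<close>
  define m where "m = K ^ 2 + 1"
  have "m ^ k \<le> fact (m + k)" for k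
  proof (induction k)
    case (Suc k)
    have "m ^ Suc k \<le> (m + Suc k) * fact (m + k)" 
      using mult_mono[of m "m + Suc k" "m ^ k" "fact (m + k)"] Suc by simp
    then show ?case by simp
  qed (simp add: Suc_leI)
  then have "m ^ m \<le> fact (m + m)" .
  moreover have "K ^ (m + m) < m ^ m"
    unfolding mult_2[symmetric] power_mult by (rule power_strict_mono) (auto simp: m_def)
  ultimately show ?thesis by (metis less_le_trans)
qed

lemma mset_rearranged_blocks:
  assumes "\<pi> \<in> perms (length bs)"
  shows "mset (concat (map ((!) bs) \<pi>)) = mset (concat bs)"
proof -
  have "mset \<pi> = mset [0..<length bs]"
    by (subst set_eq_iff_mset_eq_distinct[symmetric])
      (simp_all add: permsD[OF assms] lessThan_atLeast0)
  then have "mset (map ((!) bs) \<pi>) = mset (map ((!) bs) [0..<length bs])"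
    by (simp only: mset_map)
  then have e: "mset (map ((!) bs) \<pi>) = mset bs" by (simp only: map_nth)
  have c: "mset (concat xs) = sum_mset (image_mset mset (mset xs))" for xs :: "'b list list"
    by (induction xs) simp_all
  show ?thesis unfolding c e ..
qed

text \<open>The heads of the blocks decrease, so any other order of the blocks has a smaller head at the
first place where it differs.\<close>

lemma rearranged_blocks_less:
  assumes bs: "decreasing_blocks bs" and \<pi>: "\<pi> \<in> perms (length bs)" "\<pi> \<noteq> [0..<length bs]"
  shows "(w @ concat (map ((!) bs) \<pi>), w @ concat bs) \<in> lenlex less_than"
proof -
  let ?d = "length bs"
  note p = permsD[OF \<pi>(1)]
  have len: "length (concat (map ((!) bs) \<pi>)) = length (concat bs)"
    by (rule mset_eq_length[OF mset_rearranged_blocks[OF \<pi>(1)]])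
  have "\<exists>i. i < ?d \<and> \<pi> ! i \<noteq> i"
    using \<pi>(2) p by (metis nth_equalityI length_upt nth_upt add_0 diff_zero)
  then obtain i where i: "i < ?d \<and> \<pi> ! i \<noteq> i" by blast
  define j where "j = (LEAST i. i < ?d \<and> \<pi> ! i \<noteq> i)"
  have j: "j < ?d" "\<pi> ! j \<noteq> j"
    using LeastI[of "\<lambda>i. i < ?d \<and> \<pi> ! i \<noteq> i", OF i] unfolding j_def by blast+
  have before: "\<pi> ! k = k" if "k < j" for k
    using not_less_Least[of k "\<lambda>i. i < ?d \<and> \<pi> ! i \<noteq> i"] that j(1) unfolding j_def by linarith
  have jd: "\<pi> ! j < ?d" using p j nth_mem[of j \<pi>] by auto
  have "\<not> \<pi> ! j < j"
  proof
    assume "\<pi> ! j < j"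
    then have "\<pi> ! (\<pi> ! j) = \<pi> ! j" by (rule before)
    then show False using nth_eq_iff_index_eq[OF p(1), of "\<pi> ! j" j] p(3) j jd by simp
  qed
  with j have jj: "j < \<pi> ! j" by simp
  then have hd_less: "hd (bs ! (\<pi> ! j)) < hd (bs ! j)"
    using bs jd sorted_wrt_nth_less[of "\<lambda>b c. hd b > hd c" bs j "\<pi> ! j"] by (auto simp: decreasing_blocks_def)
  have ne: "bs ! (\<pi> ! j) \<noteq> []" "bs ! j \<noteq> []" 
    using bs nth_mem[OF jd] nth_mem[OF j(1)] unfolding decreasing_blocks_def by metis+
  have "take j \<pi> = [0..<j]" using before j p by (intro nth_equalityI) auto
  then have "\<pi> = [0..<j] @ \<pi> ! j # drop (Suc j) \<pi>" using id_take_nth_drop[of j \<pi>] j p by simp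
  then have "map ((!) bs) \<pi> = map ((!) bs) [0..<j] @ bs ! (\<pi> ! j) # map ((!) bs) (drop (Suc j) \<pi>)"
    by (metis list.map(2) map_append)
  also have "map ((!) bs) [0..<j] = take j bs" using j by (intro nth_equalityI) auto
  finally have 1: "concat (map ((!) bs) \<pi>) =
      concat (take j bs) @ hd (bs ! (\<pi> ! j)) # tl (bs ! (\<pi> ! j)) @ concat (map ((!) bs) (drop (Suc j) \<pi>))"
    using ne by simp
  have "bs = take j bs @ bs ! j # drop (Suc j) bs" using id_take_nth_drop j by blast
  then have "concat bs = concat (take j bs @ bs ! j # drop (Suc j) bs)" by simp
  then have 2: "concat bs = concat (take j bs) @ hd (bs ! j) # tl (bs ! j) @ concat (drop (Suc j) bs)"
    using ne by simp
  have "(w @ concat (map ((!) bs) \<pi>), w @ concat bs) \<in> lex less_than"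
  proof -
    have "w @ concat (map ((!) bs) \<pi>) = (w @ concat (take j bs)) @ hd (bs ! (\<pi> ! j)) #
        tl (bs ! (\<pi> ! j)) @ concat (map ((!) bs) (drop (Suc j) \<pi>))"
      using 1 by simp
    moreover have "w @ concat bs =
        (w @ concat (take j bs)) @ hd (bs ! j) # tl (bs ! j) @ concat (drop (Suc j) bs)"
      using 2 by simp
    moreover have "(hd (bs ! (\<pi> ! j)), hd (bs ! j)) \<in> less_than" using hd_less by simp
    moreover have "length (w @ concat (map ((!) bs) \<pi>)) = length (w @ concat bs)" using len by simp
    ultimately show ?thesis unfolding lex_conv by blast
  qed
  then show ?thesis using len by (simp add: lenlex_conv)
qed

lemma rearranged_blocks_perms:
  assumes "w @ concat bs \<in> perms n" and \<pi>: "\<pi> \<in> perms (length bs)"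
  shows "w @ concat (map ((!) bs) \<pi>) \<in> perms n"
proof -
  have "mset (w @ concat (map ((!) bs) \<pi>)) = mset (w @ concat bs)"
    using mset_rearranged_blocks[OF \<pi>] by simp
  then show ?thesis
    using assms(1) mset_eq_setD[of _ "w @ concat bs"] mset_eq_imp_distinct_iff[of _ "w @ concat bs"]
    unfolding permutations_of_set_def by blast
qed

section \<open>Multilinear identities\<close>

context ring
begin

lemma ncmonom_eval_Nil [simp]: "ncmonom_eval R t [] = \<one>"
  and ncmonom_eval_Cons [simp]: "ncmonom_eval R t (i # v) = t i \<otimes> ncmonom_eval R t v"
  by (simp_all add: ncmonom_eval_def)

lemma ncmonom_eval_closed [simp]: "(\<And>i. t i \<in> carrier R) \<Longrightarrow> ncmonom_eval R t v \<in> carrier R"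
  by (induction v) auto

lemma ncmonom_eval_append:
  "(\<And>i. t i \<in> carrier R) \<Longrightarrow> ncmonom_eval R t (u @ v) = ncmonom_eval R t u \<otimes> ncmonom_eval R t v"
  by (induction u) (auto simp: m_assoc)

lemma ncmonom_eval_cong:
  "(\<And>i. i \<in> set v \<Longrightarrow> t i = s i) \<Longrightarrow> ncmonom_eval R t v = ncmonom_eval R s v"
  by (induction v) auto

lemma ncmonom_eval_concat:
  "(\<And>i. t i \<in> carrier R) \<Longrightarrow>
   ncmonom_eval R (\<lambda>j. ncmonom_eval R t (b j)) v = ncmonom_eval R t (concat (map b v))"
  by (induction v) (auto simp: ncmonom_eval_append)

lemma ncmonom_eval_zero:
  assumes "\<And>i. t i \<in> carrier R" "j \<in> set v" "t j = \<zero>"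
  shows "ncmonom_eval R t v = \<zero>"
  using assms(2)
proof (induction v)
  case (Cons i v)
  then show ?case using assms by (cases "i = j") auto
qed simp

lemma ncmonom_eval_sums:
  assumes t: "\<And>i. t i \<in> carrier R" and D: "finite D"
  shows "ncmonom_eval R (\<lambda>i. \<Oplus>j\<in>{j\<in>D. w j = i}. t j) v =
    (\<Oplus>u\<in>{u. set u \<subseteq> D \<and> map w u = v}. ncmonom_eval R t u)"
proof (induction v)
  case Nil
  have "{u. set u \<subseteq> D \<and> map w u = []} = {[]}" by auto
  then show ?case by (simp add: Pi_def)
next
  case (Cons i v)
  let ?J = "{j\<in>D. w j = i}" and ?U = "{u. set u \<subseteq> D \<and> map w u = v}"
  have fU: "finite ?U"
    by (rule finite_subset[OF _ finite_lists_length_eq[OF D, of "length v"]]) auto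
  have "ncmonom_eval R (\<lambda>i. \<Oplus>j\<in>{j\<in>D. w j = i}. t j) (i # v) =
    (\<Oplus>j\<in>?J. t j) \<otimes> (\<Oplus>u\<in>?U. ncmonom_eval R t u)" using Cons by simp
  also have "\<dots> = (\<Oplus>j\<in>?J. t j \<otimes> (\<Oplus>u\<in>?U. ncmonom_eval R t u))"
    using t D by (intro finsum_mult_right) auto
  also have "\<dots> = (\<Oplus>j\<in>?J. \<Oplus>u\<in>?U. ncmonom_eval R t (j # u))"
    using t fU by (intro finsum_eqI) (auto intro!: finsum_mult_left)
  also have "\<dots> = (\<Oplus>p\<in>?J \<times> ?U. ncmonom_eval R t (fst p # snd p))"
    using t fU D by (subst finsum_Sigma) auto
  also have "\<dots> = (\<Oplus>u\<in>(\<lambda>p. fst p # snd p) ` (?J \<times> ?U). ncmonom_eval R t u)"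
    using t by (intro finsum_reindex[symmetric]) (auto simp: inj_on_def simp del: ncmonom_eval_Cons)
  also have "(\<lambda>p. fst p # snd p) ` (?J \<times> ?U) = {u. set u \<subseteq> D \<and> map w u = i # v}"
    by (auto simp: image_iff Cons_eq_map_conv map_eq_Cons_conv)
  finally show ?case .
qed

text \<open>Coefficients are taken from the centre instead of the integers, so that later linear
algebra can be done over the centre of a prime ring, a domain, irrespective of the characteristic.\<close>

definition multilinear_identity :: "nat \<Rightarrow> (nat list \<Rightarrow> 'a) \<Rightarrow> bool" where
  "multilinear_identity d \<alpha> \<longleftrightarrow>
     (\<forall>\<rho>\<in>perms d. \<alpha> \<rho> \<in> ring_center R) \<and> \<alpha> [0..<d] = \<one> \<and>
     (\<forall>t. range t \<subseteq> carrier R \<longrightarrow> (\<Oplus>\<rho>\<in>perms d. \<alpha> \<rho> \<otimes> ncmonom_eval R t \<rho>) = \<zero>)"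

lemma int_multiple_central: "[k] \<cdot> \<one> \<in> ring_center R" for k :: int
  by (rule centerI) (simp_all add: add_pow_ldistr_int add_pow_rdistr_int)

text \<open>Let \<open>w\<close> be a monomial of top degree \<open>d\<close> with coefficient 1.  Replace the \<open>i\<close>-th variable by the sum of
those new variables \<open>t j\<close> for which the \<open>j\<close>-th letter of \<open>w\<close> is \<open>i\<close>, and keep the part of the result in which each of
the \<open>d\<close> new variables occurs.  No monomial is longer than \<open>d\<close>, so this part is multilinear, and \<open>t 0 \<cdots> t (d - 1)\<close>
keeps the coefficient of \<open>w\<close>.\<close>

lemma PI_ring_imp_multilinear_identity:
  assumes "PI_ring R"
  obtains d \<alpha> where "multilinear_identity d \<alpha>"
proof -
  obtain f :: ncpoly and w where w: "w \<in> Poly_Mapping.keys f" "Poly_Mapping.lookup f w = 1"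
    and maxw: "\<And>v. v \<in> Poly_Mapping.keys f \<Longrightarrow> length v \<le> length w"
    and f: "\<And>a. range a \<subseteq> carrier R \<Longrightarrow> ncpoly_eval R a f = \<zero>"
    using assms by (auto simp: PI_ring_def)
  define d where "d = length w"
  define \<alpha> where "\<alpha> u = [Poly_Mapping.lookup f (map ((!) w) u)] \<cdot> \<one>" for u
  have \<alpha>Z: "\<alpha> u \<in> ring_center R" for u unfolding \<alpha>_def by (rule int_multiple_central)
  then have \<alpha> [simp]: "\<alpha> u \<in> carrier R" for u by simp
  define U where "U v = {u. set u \<subseteq> {..<d} \<and> map ((!) w) u = v}" for v
  define W where "W = (\<Union>v\<in>Poly_Mapping.keys f. U v)"
  have fU: "finite (U v)" for v unfolding U_def
    by (rule finite_subset[OF _ finite_lists_length_eq[of "{..<d}" "length v"]]) auto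
  then have fW: "finite W" by (simp add: W_def)
  have total: "(\<Oplus>u\<in>W. \<alpha> u \<otimes> ncmonom_eval R t u) = \<zero>" if t: "\<And>i. t i \<in> carrier R" for t
  proof -
    define a where "a i = (\<Oplus>j\<in>{j\<in>{..<d}. w ! j = i}. t j)" for i
    have ac: "a i \<in> carrier R" for i using t by (auto simp: a_def)
    have "(\<Oplus>u\<in>W. \<alpha> u \<otimes> ncmonom_eval R t u) =
      (\<Oplus>v\<in>Poly_Mapping.keys f. \<Oplus>u\<in>U v. \<alpha> u \<otimes> ncmonom_eval R t u)"
      unfolding W_def
      by (rule add.finprod_UN_disjoint) (use fU t in \<open>auto simp: U_def pairwise_def disjnt_def\<close>)
    also have "\<dots> = (\<Oplus>v\<in>Poly_Mapping.keys f. [Poly_Mapping.lookup f v] \<cdot> ncmonom_eval R a v)"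
    proof (rule finsum_eqI)
      fix v
      have "(\<Oplus>u\<in>U v. \<alpha> u \<otimes> ncmonom_eval R t u) =
        (\<Oplus>u\<in>U v. ([Poly_Mapping.lookup f v] \<cdot> \<one>) \<otimes> ncmonom_eval R t u)"
        by (rule finsum_eqI) (use t in \<open>auto simp: U_def \<alpha>_def\<close>)
      also have "\<dots> = ([Poly_Mapping.lookup f v] \<cdot> \<one>) \<otimes> (\<Oplus>u\<in>U v. ncmonom_eval R t u)"
        using fU t by (intro finsum_mult_left[symmetric]) auto
      also have "(\<Oplus>u\<in>U v. ncmonom_eval R t u) = ncmonom_eval R a v"
        unfolding U_def a_def using t by (intro ncmonom_eval_sums[symmetric]) auto
      finally show "(\<Oplus>u\<in>U v. \<alpha> u \<otimes> ncmonom_eval R t u) = [Poly_Mapping.lookup f v] \<cdot> ncmonom_eval R a v"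
        using ac by (simp add: add_pow_ldistr_int)
    qed (use ac in simp)
    also have "\<dots> = ncpoly_eval R a f" by (simp add: ncpoly_eval_def)
    also have "\<dots> = \<zero>" using ac by (intro f) auto
    finally show ?thesis .
  qed
  \<comment> \<open>The words containing the first \<open>j\<close> new variables already sum to zero; at \<open>j = d\<close> these are permutations.\<close>
  have restricted: "(\<Oplus>u\<in>{u\<in>W. {..<j} \<subseteq> set u}. \<alpha> u \<otimes> ncmonom_eval R t u) = \<zero>"
    if t: "\<And>i. t i \<in> carrier R" for t and j :: nat
    using t
  proof (induction j arbitrary: t)
    case 0
    then show ?case using total by simp
  next
    case (Suc j)
    \<comment> \<open>Setting \<open>t j\<close> to zero kills exactly the words that contain \<open>j\<close>; subtract the two sums.\<close>
    let ?s = "t(j := \<zero>)"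
    let ?A = "{u\<in>W. {..<j} \<subseteq> set u}" and ?B = "{u\<in>W. {..<Suc j} \<subseteq> set u}"
    have s: "?s i \<in> carrier R" for i using Suc.prems by simp
    have split: "?A = ?B \<union> {u\<in>?A. j \<notin> set u}" by (auto simp: lessThan_Suc)
    let ?C = "{u\<in>?A. j \<notin> set u}"
    define S where "S V r = (\<Oplus>u\<in>V. \<alpha> u \<otimes> ncmonom_eval R r u)" for V r
    have S_closed: "S V r \<in> carrier R" if "\<And>i. r i \<in> carrier R" for V r
      unfolding S_def using that by (intro finsum_in_carrier) auto
    have sum: "S ?A r = S ?B r \<oplus> S ?C r" if r: "\<And>i. r i \<in> carrier R" for r
      unfolding S_def
      by (subst split, rule finsum_Un_disjoint) (use r fW in \<open>auto simp: lessThan_Suc\<close>)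
    have IH: "S ?A r = \<zero>" if "\<And>i. r i \<in> carrier R" for r
      unfolding S_def by (rule Suc.IH[OF that])
    have B0: "S ?B ?s = \<zero>"
      unfolding S_def
    proof (rule finsum_eq_zero)
      fix u assume "u \<in> ?B"
      then have "j \<in> set u" by auto
      then have "ncmonom_eval R ?s u = \<zero>" by (intro ncmonom_eval_zero[OF s]) auto
      then show "\<alpha> u \<otimes> ncmonom_eval R ?s u = \<zero>" by simp
    qed
    have "S ?C ?s = S ?B ?s \<oplus> S ?C ?s"
      unfolding B0 by (rule l_zero[symmetric], rule S_closed, rule s)
    also have "\<dots> = S ?A ?s" by (rule sum[symmetric], rule s)
    also have "\<dots> = \<zero>" by (rule IH, rule s)
    finally have C0: "S ?C ?s = \<zero>" .
    have CC: "S ?C ?s = S ?C t"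
      unfolding S_def
    proof (rule finsum_eqI)
      fix u assume "u \<in> ?C"
      then have "ncmonom_eval R ?s u = ncmonom_eval R t u" by (intro ncmonom_eval_cong) auto
      then show "\<alpha> u \<otimes> ncmonom_eval R ?s u = \<alpha> u \<otimes> ncmonom_eval R t u" by simp
    qed (use Suc.prems in auto)
    have "S ?B t = S ?B t \<oplus> S ?C t"
      unfolding CC[symmetric] C0 by (rule r_zero[symmetric], rule S_closed, rule Suc.prems)
    also have "\<dots> = S ?A t" by (rule sum[symmetric], rule Suc.prems)
    also have "\<dots> = \<zero>" by (rule IH, rule Suc.prems)
    finally have "S ?B t = \<zero>" .
    then show ?case unfolding S_def .
  qed
  have "multilinear_identity d \<alpha>"
    unfolding multilinear_identity_def
  proof (intro conjI ballI allI impI)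
    show "\<alpha> u \<in> ring_center R" for u by (rule \<alpha>Z)
    have "map ((!) w) [0..<d] = w" by (simp add: d_def map_nth)
    then show "\<alpha> [0..<d] = \<one>" using w by (simp add: \<alpha>_def add.int_pow_1)
    fix t :: "nat \<Rightarrow> 'a" assume "range t \<subseteq> carrier R"
    then have t: "t i \<in> carrier R" for i by auto
    have sub: "{u\<in>W. {..<d} \<subseteq> set u} \<subseteq> perms d"
    proof
      fix u assume u: "u \<in> {u\<in>W. {..<d} \<subseteq> set u}"
      then have su: "set u = {..<d}" by (auto simp: W_def U_def)
      have "length u \<le> d"
        using u maxw[of "map ((!) w) u"] unfolding d_def by (auto simp: W_def U_def)
      moreover have "d = card (set u)" using su by simp
      ultimately have "distinct u" using card_length[of u] by (intro card_distinct) simp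
      then show "u \<in> perms d" using su by (intro permutations_of_setI)
    qed
    have "(\<Oplus>\<rho>\<in>perms d. \<alpha> \<rho> \<otimes> ncmonom_eval R t \<rho>) =
      (\<Oplus>\<rho>\<in>{u\<in>W. {..<d} \<subseteq> set u}. \<alpha> \<rho> \<otimes> ncmonom_eval R t \<rho>)"
    proof (rule add.finprod_mono_neutral_cong_right[OF _ sub])
      show "\<alpha> u \<otimes> ncmonom_eval R t u = \<zero>" if "u \<in> perms d - {u\<in>W. {..<d} \<subseteq> set u}" for u
      proof -
        have "map ((!) w) u \<notin> Poly_Mapping.keys f"
          using that permsD[of u d] by (auto simp: W_def U_def)
        then have "\<alpha> u = \<zero>" by (simp add: \<alpha>_def in_keys_iff add_pow_def)
        then show ?thesis using t by simp
      qed
    qed (use t in auto)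
    also have "\<dots> = \<zero>" by (rule restricted[OF t])
    finally show "(\<Oplus>\<rho>\<in>perms d. \<alpha> \<rho> \<otimes> ncmonom_eval R t \<rho>) = \<zero>" .
  qed
  then show ?thesis by (rule that)
qed

text \<open>The coefficients are the same for all values \<open>t\<close> of the variables; this uniformity is what
makes the system of linear equations below finite.\<close>

definition spanned_by_good :: "nat \<Rightarrow> nat \<Rightarrow> ((nat \<Rightarrow> 'a) \<Rightarrow> 'a) \<Rightarrow> bool" where
  "spanned_by_good d n F \<longleftrightarrow>
     (\<exists>c. (\<forall>\<tau>. c \<tau> \<in> ring_center R) \<and>
       (\<forall>t. range t \<subseteq> carrier R \<longrightarrow> F t = (\<Oplus>\<tau>\<in>good_perms d n. c \<tau> \<otimes> ncmonom_eval R t \<tau>)))"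

lemma spanned_by_good_zero: "spanned_by_good d n (\<lambda>t. \<zero>)"
  unfolding spanned_by_good_def
  by (intro exI[of _ "\<lambda>_. \<zero>"]) (auto simp: center_zero range_subsetD intro!: finsum_eq_zero[symmetric])

lemma spanned_by_good_add_scaled:
  assumes F: "spanned_by_good d n F" and G: "spanned_by_good d n G" and k: "k \<in> ring_center R"
  shows "spanned_by_good d n (\<lambda>t. k \<otimes> F t \<oplus> G t)"
proof -
  obtain c where c: "\<And>\<tau>. c \<tau> \<in> ring_center R"
    "\<And>t. range t \<subseteq> carrier R \<Longrightarrow> F t = (\<Oplus>\<tau>\<in>good_perms d n. c \<tau> \<otimes> ncmonom_eval R t \<tau>)"
    using F by (auto simp: spanned_by_good_def)
  obtain e where e: "\<And>\<tau>. e \<tau> \<in> ring_center R"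
    "\<And>t. range t \<subseteq> carrier R \<Longrightarrow> G t = (\<Oplus>\<tau>\<in>good_perms d n. e \<tau> \<otimes> ncmonom_eval R t \<tau>)"
    using G by (auto simp: spanned_by_good_def)
  have "k \<otimes> F t \<oplus> G t = (\<Oplus>\<tau>\<in>good_perms d n. (k \<otimes> c \<tau> \<oplus> e \<tau>) \<otimes> ncmonom_eval R t \<tau>)"
    if t: "range t \<subseteq> carrier R" for t
  proof -
    have tc: "t i \<in> carrier R" for i using t by auto
    have "k \<otimes> F t = (\<Oplus>\<tau>\<in>good_perms d n. k \<otimes> (c \<tau> \<otimes> ncmonom_eval R t \<tau>))"
      unfolding c(2)[OF t] using tc c(1) k by (intro finsum_mult_left) auto
    then have "k \<otimes> F t \<oplus> G t =
      (\<Oplus>\<tau>\<in>good_perms d n. k \<otimes> (c \<tau> \<otimes> ncmonom_eval R t \<tau>) \<oplus> e \<tau> \<otimes> ncmonom_eval R t \<tau>)"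
      unfolding e(2)[OF t] using tc c(1) e(1) k by (subst finsum_add') auto
    also have "\<dots> = (\<Oplus>\<tau>\<in>good_perms d n. (k \<otimes> c \<tau> \<oplus> e \<tau>) \<otimes> ncmonom_eval R t \<tau>)"
      using tc c(1) e(1) k by (intro finsum_eqI) (auto simp: l_distr m_assoc)
    finally show ?thesis .
  qed
  then show ?thesis unfolding spanned_by_good_def
    using c(1) e(1) k by (intro exI[of _ "\<lambda>\<tau>. k \<otimes> c \<tau> \<oplus> e \<tau>"]) (auto intro: center_add center_mult)
qed

lemma spanned_by_good_cong:
  "spanned_by_good d n F \<Longrightarrow> (\<And>t. range t \<subseteq> carrier R \<Longrightarrow> G t = F t) \<Longrightarrow> spanned_by_good d n G"
  unfolding spanned_by_good_def by auto

lemma spanned_by_good_finsum: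
  assumes "finite A" "\<And>a. a \<in> A \<Longrightarrow> spanned_by_good d n (F a)" "\<And>a. a \<in> A \<Longrightarrow> k a \<in> ring_center R"
    and "\<And>a t. a \<in> A \<Longrightarrow> range t \<subseteq> carrier R \<Longrightarrow> F a t \<in> carrier R"
  shows "spanned_by_good d n (\<lambda>t. \<Oplus>a\<in>A. k a \<otimes> F a t)"
  using assms
proof (induction A rule: finite_induct)
  case empty
  then show ?case using spanned_by_good_zero by simp
next
  case (insert a A)
  have "spanned_by_good d n (\<lambda>t. k a \<otimes> F a t \<oplus> (\<Oplus>a\<in>A. k a \<otimes> F a t))"
    using insert by (intro spanned_by_good_add_scaled) auto
  then show ?case
    by (rule spanned_by_good_cong) (use insert in \<open>auto intro!: finsum_insert'\<close>)
qed

lemma good_perm_in_span: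
  assumes \<rho>: "\<rho> \<in> good_perms d n"
  shows "spanned_by_good d n (\<lambda>t. ncmonom_eval R t \<rho>)"
  unfolding spanned_by_good_def
proof (intro exI[of _ "\<lambda>\<tau>. if \<tau> = \<rho> then \<one> else \<zero>"] conjI allI impI)
  fix t :: "nat \<Rightarrow> 'a" assume "range t \<subseteq> carrier R"
  then have t: "t i \<in> carrier R" for i by auto
  have "(\<Oplus>\<tau>\<in>good_perms d n. (if \<tau> = \<rho> then \<one> else \<zero>) \<otimes> ncmonom_eval R t \<tau>) =
      (if \<rho> = \<rho> then \<one> else \<zero>) \<otimes> ncmonom_eval R t \<rho>"
    using \<rho> t by (intro finsum_only) auto
  then show "ncmonom_eval R t \<rho> = (\<Oplus>\<tau>\<in>good_perms d n. (if \<tau> = \<rho> then \<one> else \<zero>) \<otimes> ncmonom_eval R t \<tau>)"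
    using t by simp
qed (simp add: center_zero center_one)

text \<open>Latyshev's reduction: if a word splits into \<open>d\<close> blocks with decreasing heads, the identity of degree \<open>d\<close>,
with the blocks substituted for its variables, expresses the word by lexicographically smaller ones.\<close>

lemma perm_in_span_of_good:
  assumes id: "multilinear_identity d \<alpha>" and \<rho>: "\<rho> \<in> perms n"
  shows "spanned_by_good d n (\<lambda>t. ncmonom_eval R t \<rho>)"
  using wf_lenlex[OF wf_less_than] \<rho>
proof (induction \<rho> rule: wf_induct_rule)
  case (less \<rho>)
  show ?case
  proof (cases "splits_decreasingly d \<rho>")
    case False
    with less.prems show ?thesis by (intro good_perm_in_span) (simp add: good_perms_def)
  next
    case True
    then obtain w bs where w: "\<rho> = w @ concat bs" and len: "length bs = d" and bs: "decreasing_blocks bs"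
      by (auto simp: splits_decreasingly_def)
    let ?A = "perms d - {[0..<d]}"
    let ?F = "\<lambda>\<pi> t. ncmonom_eval R t (w @ concat (map ((!) bs) \<pi>))"
    have \<alpha>Z: "\<alpha> \<pi> \<in> ring_center R" if "\<pi> \<in> perms d" for \<pi> using id that by (simp add: multilinear_identity_def)
    have span: "spanned_by_good d n (\<lambda>t. \<Oplus>\<pi>\<in>?A. (\<ominus> \<alpha> \<pi>) \<otimes> ?F \<pi> t)"
    proof (rule spanned_by_good_finsum)
      fix \<pi> assume \<pi>: "\<pi> \<in> ?A"
      show "spanned_by_good d n (?F \<pi>)"
      proof (rule less.IH)
        show "(w @ concat (map ((!) bs) \<pi>), \<rho>) \<in> lenlex less_than"
          unfolding w using \<pi> len bs by (intro rearranged_blocks_less) auto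
        show "w @ concat (map ((!) bs) \<pi>) \<in> perms n"
          using less.prems \<pi> len unfolding w by (intro rearranged_blocks_perms) auto
      qed
      show "\<ominus> \<alpha> \<pi> \<in> ring_center R" using \<pi> \<alpha>Z by (intro center_neg) auto
    qed (auto simp: range_subsetD)
    show ?thesis
    proof (rule spanned_by_good_cong[OF span])
      fix t :: "nat \<Rightarrow> 'a" assume "range t \<subseteq> carrier R"
      then have t: "t i \<in> carrier R" for i by auto
      have upt: "[0..<d] \<in> perms d" by (auto simp: permutations_of_set_def)
      define s where "s j = ncmonom_eval R t (bs ! j)" for j
      have s: "s j \<in> carrier R" for j using t by (simp add: s_def)
      have "range s \<subseteq> carrier R" using t by (auto simp: s_def)
      then have "(\<Oplus>\<pi>\<in>perms d. \<alpha> \<pi> \<otimes> ncmonom_eval R s \<pi>) = \<zero>"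
        using id by (simp add: multilinear_identity_def)
      also have "perms d = insert [0..<d] ?A" using upt by auto
      also have "(\<Oplus>\<pi>\<in>insert [0..<d] ?A. \<alpha> \<pi> \<otimes> ncmonom_eval R s \<pi>) =
          \<alpha> [0..<d] \<otimes> ncmonom_eval R s [0..<d] \<oplus> (\<Oplus>\<pi>\<in>?A. \<alpha> \<pi> \<otimes> ncmonom_eval R s \<pi>)"
        using \<alpha>Z s upt by (intro finsum_insert') auto
      finally have eq: "ncmonom_eval R s [0..<d] \<oplus> (\<Oplus>\<pi>\<in>?A. \<alpha> \<pi> \<otimes> ncmonom_eval R s \<pi>) = \<zero>"
        using id t by (simp add: multilinear_identity_def s_def)
      have bs_id: "map ((!) bs) [0..<d] = bs" using len by (simp add: map_nth flip: len)
      have sum: "(\<Oplus>\<pi>\<in>?A. \<alpha> \<pi> \<otimes> ncmonom_eval R s \<pi>) \<in> carrier R"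
        using \<alpha>Z t by (intro finsum_in_carrier) (auto simp: s_def)
      have "ncmonom_eval R t (concat bs) = \<ominus> (\<Oplus>\<pi>\<in>?A. \<alpha> \<pi> \<otimes> ncmonom_eval R s \<pi>)"
        using eq t sum ncmonom_eval_concat[of t "(!) bs" "[0..<d]"]
        by (intro minus_equality[symmetric]) (simp_all add: bs_id a_comm flip: s_def)
      also have "\<dots> = (\<ominus> \<one>) \<otimes> (\<Oplus>\<pi>\<in>?A. \<alpha> \<pi> \<otimes> ncmonom_eval R s \<pi>)"
        using sum by (simp add: l_minus)
      finally have "ncmonom_eval R t \<rho> =
          (ncmonom_eval R t w \<otimes> (\<ominus> \<one>)) \<otimes> (\<Oplus>\<pi>\<in>?A. \<alpha> \<pi> \<otimes> ncmonom_eval R s \<pi>)"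
        using t sum by (simp add: w ncmonom_eval_append m_assoc)
      also have "\<dots> = (\<Oplus>\<pi>\<in>?A. (ncmonom_eval R t w \<otimes> (\<ominus> \<one>)) \<otimes> (\<alpha> \<pi> \<otimes> ncmonom_eval R s \<pi>))"
        using t \<alpha>Z by (intro finsum_mult_left) (auto simp: s_def)
      also have "\<dots> = (\<Oplus>\<pi>\<in>?A. (\<ominus> \<alpha> \<pi>) \<otimes> ?F \<pi> t)"
      proof (rule finsum_eqI)
        fix \<pi> assume \<pi>: "\<pi> \<in> ?A"
        have c: "\<alpha> \<pi> \<in> ring_center R" using \<alpha>Z \<pi> by auto
        have e: "ncmonom_eval R s \<pi> = ncmonom_eval R t (concat (map ((!) bs) \<pi>))"
          using ncmonom_eval_concat[of t "(!) bs" \<pi>] t unfolding s_def by simp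
        have "(ncmonom_eval R t w \<otimes> (\<ominus> \<one>)) \<otimes> (\<alpha> \<pi> \<otimes> ncmonom_eval R s \<pi>) =
            \<alpha> \<pi> \<otimes> ((ncmonom_eval R t w \<otimes> (\<ominus> \<one>)) \<otimes> ncmonom_eval R s \<pi>)"
          using t c by (intro center_lcomm) (auto simp: s_def)
        then show "(ncmonom_eval R t w \<otimes> (\<ominus> \<one>)) \<otimes> (\<alpha> \<pi> \<otimes> ncmonom_eval R s \<pi>) = (\<ominus> \<alpha> \<pi>) \<otimes> ?F \<pi> t"
          using t c by (simp add: e ncmonom_eval_append l_minus r_minus m_assoc)
      next
        fix \<pi> assume "\<pi> \<in> ?A"
        then show "(\<ominus> \<alpha> \<pi>) \<otimes> ?F \<pi> t \<in> carrier R" using \<alpha>Z t by auto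
      qed
      finally show "ncmonom_eval R t \<rho> = (\<Oplus>\<pi>\<in>?A. (\<ominus> \<alpha> \<pi>) \<otimes> ?F \<pi> t)" .
    qed
  qed
qed

end

section \<open>An identity for multiplication operators\<close>

context elementwise_prime_ring
begin

lemma center_nonzero_mult:
  assumes "z \<in> ring_center R" "x \<in> carrier R" "z \<otimes> x = \<zero>" "z \<noteq> \<zero>"
  shows "x = \<zero>"
proof -
  have "z \<otimes> y \<otimes> x = \<zero>" if y: "y \<in> carrier R" for y
  proof -
    have "z \<otimes> y \<otimes> x = z \<otimes> (y \<otimes> x)" using assms(1,2) y by (simp add: m_assoc)
    also have "\<dots> = y \<otimes> (z \<otimes> x)" by (rule center_lcomm[OF assms(1) y assms(2), symmetric])
    also have "\<dots> = \<zero>" unfolding assms(3) using y by simp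
    finally show ?thesis .
  qed
  then show ?thesis using prime[of z x] assms by auto
qed

lemma center_cancel:
  assumes "z \<in> ring_center R" "z \<noteq> \<zero>" "x \<in> carrier R" "y \<in> carrier R" "z \<otimes> x = z \<otimes> y"
  shows "x = y"
proof -
  have "z \<otimes> (x \<ominus> y) = \<zero>"
    using assms by (simp add: a_minus_def r_distr r_minus r_neg)
  then have "x \<ominus> y = \<zero>" using center_nonzero_mult[of z "x \<ominus> y"] assms by simp
  then show ?thesis using assms by simp
qed

text \<open>Gaussian elimination without division: the unknown \<open>s0\<close> is eliminated with the pivot \<open>c s0 e0\<close>, and the remaining
unknowns are multiplied by the pivot afterwards.\<close>

lemma central_system_solution:
  assumes "finite E" "finite S" "card E < card S"
    and "\<And>s e. s \<in> S \<Longrightarrow> e \<in> E \<Longrightarrow> c s e \<in> ring_center R"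
  shows "\<exists>\<beta>. (\<forall>s\<in>S. \<beta> s \<in> ring_center R) \<and> (\<exists>s\<in>S. \<beta> s \<noteq> \<zero>) \<and>
    (\<forall>e\<in>E. (\<Oplus>s\<in>S. \<beta> s \<otimes> c s e) = \<zero>)"
  using assms
proof (induction E arbitrary: S c rule: finite_induct)
  case empty
  then have "S \<noteq> {}" by auto
  then show ?case using one_not_zero center_one by (intro exI[of _ "\<lambda>_. \<one>"]) auto
next
  case (insert e0 E)
  show ?case
  proof (cases "\<forall>s\<in>S. c s e0 = \<zero>")
    case True
    obtain \<beta> where \<beta>: "\<forall>s\<in>S. \<beta> s \<in> ring_center R" "\<exists>s\<in>S. \<beta> s \<noteq> \<zero>"
      "\<forall>e\<in>E. (\<Oplus>s\<in>S. \<beta> s \<otimes> c s e) = \<zero>"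
      using insert.IH[of S c] insert.prems insert.hyps by auto
    have "(\<Oplus>s\<in>S. \<beta> s \<otimes> c s e0) = \<zero>"
      using True \<beta>(1) by (intro finsum_eq_zero) auto
    with \<beta> show ?thesis by auto
  next
    case False
    then obtain s0 where s0: "s0 \<in> S" "c s0 e0 \<noteq> \<zero>" by auto
    let ?S = "S - {s0}" and ?p = "c s0 e0"
    define c' where "c' s e = ?p \<otimes> c s e \<ominus> c s e0 \<otimes> c s0 e" for s e
    have cZ: "c s e \<in> ring_center R" if "s \<in> S" "e \<in> insert e0 E" for s e
      using insert.prems that by auto
    have c'Z: "c' s e \<in> ring_center R" if "s \<in> ?S" "e \<in> E" for s e
      unfolding c'_def a_minus_def using that s0 cZ by (intro center_add center_neg center_mult) auto
    have "card E < card ?S" using insert.prems insert.hyps s0 by simp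
    then obtain \<gamma> where \<gamma>: "\<forall>s\<in>?S. \<gamma> s \<in> ring_center R" "\<exists>s\<in>?S. \<gamma> s \<noteq> \<zero>"
      "\<forall>e\<in>E. (\<Oplus>s\<in>?S. \<gamma> s \<otimes> c' s e) = \<zero>"
      using insert.IH[of ?S c'] insert.prems c'Z by auto
    define q where "q = (\<Oplus>s\<in>?S. \<gamma> s \<otimes> c s e0)"
    have qZ: "q \<in> ring_center R"
      unfolding q_def using \<gamma>(1) cZ by (intro center_finsum center_mult) auto
    define \<beta> where "\<beta> s = (if s = s0 then \<ominus> q else \<gamma> s \<otimes> ?p)" for s
    have pZ: "?p \<in> ring_center R" using cZ s0 by auto
    have eq: "(\<Oplus>s\<in>S. \<beta> s \<otimes> c s e) = (\<Oplus>s\<in>?S. \<gamma> s \<otimes> c' s e)" if e: "e \<in> insert e0 E" for e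
    proof -
      have g: "\<gamma> s \<in> carrier R" "c s e \<in> carrier R" "c s e0 \<in> carrier R" if "s \<in> ?S" for s
        using \<gamma>(1) cZ e that by auto
      have c0: "c s0 e \<in> carrier R" "?p \<in> carrier R" "q \<in> carrier R" using cZ e s0 pZ qZ by auto
      have "(\<Oplus>s\<in>S. \<beta> s \<otimes> c s e) = (\<Oplus>s\<in>insert s0 ?S. \<beta> s \<otimes> c s e)"
        using s0 by (simp add: insert_absorb)
      also have "\<dots> = \<beta> s0 \<otimes> c s0 e \<oplus> (\<Oplus>s\<in>?S. \<beta> s \<otimes> c s e)"
        using insert.prems g c0 by (intro finsum_insert') (auto simp: \<beta>_def)
      also have "(\<Oplus>s\<in>?S. \<beta> s \<otimes> c s e) = (\<Oplus>s\<in>?S. \<gamma> s \<otimes> ?p \<otimes> c s e)"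
        using g c0 by (intro finsum_eqI) (auto simp: \<beta>_def)
      also have "\<beta> s0 \<otimes> c s0 e = (\<Oplus>s\<in>?S. \<gamma> s \<otimes> c s e0) \<otimes> (\<ominus> c s0 e)"
        using c0 by (simp add: \<beta>_def l_minus r_minus flip: q_def)
      also have "\<dots> = (\<Oplus>s\<in>?S. \<gamma> s \<otimes> c s e0 \<otimes> (\<ominus> c s0 e))"
        using insert.prems g c0 by (intro finsum_mult_right) auto
      also have "\<dots> \<oplus> (\<Oplus>s\<in>?S. \<gamma> s \<otimes> ?p \<otimes> c s e) =
          (\<Oplus>s\<in>?S. \<gamma> s \<otimes> c s e0 \<otimes> (\<ominus> c s0 e) \<oplus> \<gamma> s \<otimes> ?p \<otimes> c s e)"
        using g c0 by (intro finsum_add'[symmetric]) auto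
      also have "\<dots> = (\<Oplus>s\<in>?S. \<gamma> s \<otimes> c' s e)"
        using g c0
        by (intro finsum_eqI) (auto simp: c'_def a_minus_def r_distr r_minus m_assoc a_comm)
      finally show ?thesis .
    qed
    have "(\<Oplus>s\<in>?S. \<gamma> s \<otimes> c' s e0) = \<zero>"
    proof (rule finsum_eq_zero)
      fix s assume "s \<in> ?S"
      then have "c s e0 \<in> ring_center R" "\<gamma> s \<in> ring_center R" using cZ \<gamma>(1) by auto
      then show "\<gamma> s \<otimes> c' s e0 = \<zero>"
        using center_commute[of "c s e0" ?p] pZ by (simp add: c'_def a_minus_def r_neg)
    qed
    with eq \<gamma>(3) have "\<forall>e\<in>insert e0 E. (\<Oplus>s\<in>S. \<beta> s \<otimes> c s e) = \<zero>" by auto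
    moreover have "\<forall>s\<in>S. \<beta> s \<in> ring_center R"
      using \<gamma>(1) pZ qZ by (auto simp: \<beta>_def intro: center_neg center_mult)
    moreover have "\<exists>s\<in>S. \<beta> s \<noteq> \<zero>"
    proof -
      from \<gamma>(2) obtain s where s: "s \<in> ?S" "\<gamma> s \<noteq> \<zero>" by blast
      then have "\<gamma> s \<otimes> ?p \<noteq> \<zero>"
        using center_nonzero_mult[of "\<gamma> s" ?p] \<gamma>(1) pZ s0 by auto
      then show ?thesis using s by (intro bexI[of _ s]) (auto simp: \<beta>_def)
    qed
    ultimately show ?thesis by blast
  qed
qed

end

context ring
begin

lemma foldr_elementary:
  assumes "\<And>i. a i \<in> carrier R" "\<And>i. b i \<in> carrier R" "x \<in> carrier R"
    and "\<And>i. i \<in> set v \<Longrightarrow> T i = (\<lambda>y. a i \<otimes> y \<otimes> b i)"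
  shows "foldr T v x = ncmonom_eval R a v \<otimes> x \<otimes> ncmonom_eval R b (rev v)"
  using assms(4)
proof (induction v)
  case (Cons i v)
  then have "foldr T (i # v) x = a i \<otimes> (ncmonom_eval R a v \<otimes> x \<otimes> ncmonom_eval R b (rev v)) \<otimes> b i"
    by simp
  then show ?case using assms(1-3) by (simp add: ncmonom_eval_append m_assoc)
qed (use assms in simp)

lemma foldr_mult_ops_closed:
  "(\<And>i. i \<in> set v \<Longrightarrow> T i \<in> mult_ops) \<Longrightarrow> x \<in> carrier R \<Longrightarrow> foldr T v x \<in> carrier R"
  by (induction v) (auto intro: mult_ops_closed)

lemma foldr_mult_ops_hom:
  "(\<And>i. i \<in> set v \<Longrightarrow> T i \<in> mult_ops) \<Longrightarrow> x \<in> carrier R \<Longrightarrow> y \<in> carrier R \<Longrightarrow>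
    foldr T v (x \<oplus> y) = foldr T v x \<oplus> foldr T v y"
  by (induction v) (auto simp: mult_ops_hom foldr_mult_ops_closed)

lemma foldr_mult_ops_additive:
  assumes T: "\<And>i. i \<in> set v \<Longrightarrow> T i \<in> mult_ops" and f: "f \<in> mult_ops" and g: "g \<in> mult_ops"
    and v: "distinct v" "k \<in> set v" and x: "x \<in> carrier R"
  shows "foldr (T(k := (\<lambda>y. f y \<oplus> g y))) v x = foldr (T(k := f)) v x \<oplus> foldr (T(k := g)) v x"
proof -
  obtain u w where uw: "v = u @ k # w" using v(2) by (meson split_list)
  have nk: "k \<notin> set u" "k \<notin> set w" using v(1) uw by auto
  have eq: "foldr (T(k := h)) v x = foldr T u (h (foldr T w x))" for h
  proof -
    have "foldr (T(k := h)) w x = foldr T w x" "foldr (T(k := h)) u z = foldr T u z" for z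
      using nk by (auto intro!: foldr_cong)
    then show ?thesis by (simp add: uw)
  qed
  have w: "foldr T w x \<in> carrier R" using T x uw by (intro foldr_mult_ops_closed) auto
  show ?thesis unfolding eq
    using w f g T uw by (intro foldr_mult_ops_hom) (auto intro: mult_ops_closed)
qed

end

context elementwise_prime_ring
begin

text \<open>Regev's theorem on tensor products, for \<open>R\<close> and its opposite ring.  A word in the operators
\<open>y \<mapsto> a i y b i\<close> multiplies by a word in the \<open>a i\<close> on the left and by the reversed word in the \<open>b i\<close> on the
right; both reduce to good permutations.  Thus the \<open>n!\<close> words lie in the span of at most \<open>d ^ (4 * n)\<close>
products, and for large \<open>n\<close> they are linearly dependent with coefficients that do not depend on the \<open>a i\<close> and
\<open>b i\<close>.  Every operator is a sum of such elementary ones, and the combination of words is additive in each operator.\<close>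

lemma mult_ops_satisfy_identity:
  assumes id: "multilinear_identity d \<alpha>"
  obtains n \<beta> where "\<And>\<rho>. \<rho> \<in> perms n \<Longrightarrow> \<beta> \<rho> \<in> ring_center R" "\<exists>\<rho>\<in>perms n. \<beta> \<rho> \<noteq> \<zero>"
    "\<And>T x. \<forall>i<n. T i \<in> mult_ops \<Longrightarrow> x \<in> carrier R \<Longrightarrow>
      (\<Oplus>\<rho>\<in>perms n. \<beta> \<rho> \<otimes> foldr T \<rho> x) = \<zero>"
proof -
  have d: "d > 0"
  proof (rule ccontr)
    assume "\<not> d > 0"
    then have "d = 0" by simp
    have "(\<Oplus>\<rho>\<in>perms d. \<alpha> \<rho> \<otimes> ncmonom_eval R (\<lambda>_. \<zero>) \<rho>) = \<zero>" "\<alpha> [] = \<one>"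
      using id \<open>d = 0\<close> by (auto simp: multilinear_identity_def)
    then show False using one_not_zero \<open>d = 0\<close> by (simp add: Pi_def)
  qed
  obtain n where n: "(d ^ 4) ^ n < (fact n :: nat)" using exists_power_less_fact by blast
  let ?G = "good_perms d n"
  have "\<exists>C. \<forall>\<rho>\<in>perms n. (\<forall>\<tau>. C \<rho> \<tau> \<in> ring_center R) \<and>
      (\<forall>t. range t \<subseteq> carrier R \<longrightarrow> ncmonom_eval R t \<rho> = (\<Oplus>\<tau>\<in>?G. C \<rho> \<tau> \<otimes> ncmonom_eval R t \<tau>))"
    by (rule bchoice) (use perm_in_span_of_good[OF id] in \<open>simp add: spanned_by_good_def\<close>)
  then obtain C where CZ: "\<And>\<rho> \<tau>. \<rho> \<in> perms n \<Longrightarrow> C \<rho> \<tau> \<in> ring_center R"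
    and C: "\<And>\<rho> t. \<rho> \<in> perms n \<Longrightarrow> range t \<subseteq> carrier R \<Longrightarrow>
      ncmonom_eval R t \<rho> = (\<Oplus>\<tau>\<in>?G. C \<rho> \<tau> \<otimes> ncmonom_eval R t \<tau>)" by blast
  define c where "c \<rho> e = C \<rho> (fst e) \<otimes> C (rev \<rho>) (snd e)" for \<rho> e
  have cZ: "c \<rho> e \<in> ring_center R" if "\<rho> \<in> perms n" for \<rho> e
    unfolding c_def using that rev_perms by (intro center_mult CZ)
  have "card (?G \<times> ?G) \<le> d ^ (2 * n) * d ^ (2 * n)"
    unfolding card_cartesian_product using card_good_perms[OF d] by (intro mult_mono) auto
  also have "\<dots> = (d ^ 4) ^ n" by (simp flip: power_add power_mult)
  also have "\<dots> < card (perms n)" using n by simp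
  finally have "card (?G \<times> ?G) < card (perms n)" .
  then have "\<exists>\<beta>. (\<forall>\<rho>\<in>perms n. \<beta> \<rho> \<in> ring_center R) \<and> (\<exists>\<rho>\<in>perms n. \<beta> \<rho> \<noteq> \<zero>) \<and>
      (\<forall>e\<in>?G \<times> ?G. (\<Oplus>\<rho>\<in>perms n. \<beta> \<rho> \<otimes> c \<rho> e) = \<zero>)"
    by (intro central_system_solution cZ) auto
  then obtain \<beta> where \<beta>: "\<And>\<rho>. \<rho> \<in> perms n \<Longrightarrow> \<beta> \<rho> \<in> ring_center R" "\<exists>\<rho>\<in>perms n. \<beta> \<rho> \<noteq> \<zero>"
    and system: "\<And>e. e \<in> ?G \<times> ?G \<Longrightarrow> (\<Oplus>\<rho>\<in>perms n. \<beta> \<rho> \<otimes> c \<rho> e) = \<zero>"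
    by blast
  have elementary: "(\<Oplus>\<rho>\<in>perms n. \<beta> \<rho> \<otimes> foldr T \<rho> x) = \<zero>"
    if a: "\<And>i. a i \<in> carrier R" and b: "\<And>i. b i \<in> carrier R" and x: "x \<in> carrier R"
      and T: "\<And>i. i < n \<Longrightarrow> T i = (\<lambda>y. a i \<otimes> y \<otimes> b i)" for a b x T
  proof -
    define m where "m e = ncmonom_eval R a (fst e) \<otimes> x \<otimes> ncmonom_eval R b (snd e)" for e
    have m: "m e \<in> carrier R" for e using a b x by (simp add: m_def)
    have word: "foldr T \<rho> x = (\<Oplus>e\<in>?G \<times> ?G. c \<rho> e \<otimes> m e)" if \<rho>: "\<rho> \<in> perms n" for \<rho>
    proof -
      have r\<rho>: "rev \<rho> \<in> perms n" using \<rho> by (rule rev_perms)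
      have [simp]: "C \<rho> \<tau> \<in> carrier R" "C (rev \<rho>) \<tau> \<in> carrier R" for \<tau> using CZ \<rho> r\<rho> by auto
      have "foldr T \<rho> x = ncmonom_eval R a \<rho> \<otimes> x \<otimes> ncmonom_eval R b (rev \<rho>)"
        using a b x T permsD(2)[OF \<rho>] by (intro foldr_elementary) auto
      also have "\<dots> = (\<Oplus>\<tau>\<in>?G. C \<rho> \<tau> \<otimes> ncmonom_eval R a \<tau>) \<otimes> x \<otimes>
          (\<Oplus>\<tau>\<in>?G. C (rev \<rho>) \<tau> \<otimes> ncmonom_eval R b \<tau>)"
        using C[OF \<rho>, of a] C[OF r\<rho>, of b] a b by (simp add: image_subset_iff)
      also have "\<dots> = (\<Oplus>\<tau>\<in>?G. C \<rho> \<tau> \<otimes> ncmonom_eval R a \<tau> \<otimes> x) \<otimes>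
          (\<Oplus>\<tau>\<in>?G. C (rev \<rho>) \<tau> \<otimes> ncmonom_eval R b \<tau>)"
        using a x by (subst finsum_mult_right) auto
      also have "\<dots> = (\<Oplus>\<tau>\<in>?G. C \<rho> \<tau> \<otimes> ncmonom_eval R a \<tau> \<otimes> x \<otimes>
          (\<Oplus>\<tau>'\<in>?G. C (rev \<rho>) \<tau>' \<otimes> ncmonom_eval R b \<tau>'))"
        using a b x by (intro finsum_mult_right) auto
      also have "\<dots> = (\<Oplus>\<tau>\<in>?G. \<Oplus>\<tau>'\<in>?G. c \<rho> (\<tau>, \<tau>') \<otimes> m (\<tau>, \<tau>'))"
      proof (rule finsum_eqI)
        fix \<tau>
        have "C \<rho> \<tau> \<otimes> ncmonom_eval R a \<tau> \<otimes> x \<otimes> (\<Oplus>\<tau>'\<in>?G. C (rev \<rho>) \<tau>' \<otimes> ncmonom_eval R b \<tau>') =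
          (\<Oplus>\<tau>'\<in>?G. C \<rho> \<tau> \<otimes> ncmonom_eval R a \<tau> \<otimes> x \<otimes> (C (rev \<rho>) \<tau>' \<otimes> ncmonom_eval R b \<tau>'))"
          using a b x by (intro finsum_mult_left) auto
        also have "\<dots> = (\<Oplus>\<tau>'\<in>?G. c \<rho> (\<tau>, \<tau>') \<otimes> m (\<tau>, \<tau>'))"
        proof (rule finsum_eqI)
          fix \<tau>'
          have "ncmonom_eval R a \<tau> \<otimes> x \<otimes> (C (rev \<rho>) \<tau>' \<otimes> ncmonom_eval R b \<tau>') =
              C (rev \<rho>) \<tau>' \<otimes> (ncmonom_eval R a \<tau> \<otimes> x \<otimes> ncmonom_eval R b \<tau>')"
            using CZ[OF r\<rho>] a b x by (intro center_lcomm) auto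
          then show "C \<rho> \<tau> \<otimes> ncmonom_eval R a \<tau> \<otimes> x \<otimes> (C (rev \<rho>) \<tau>' \<otimes> ncmonom_eval R b \<tau>') =
              c \<rho> (\<tau>, \<tau>') \<otimes> m (\<tau>, \<tau>')"
            using a b x by (simp add: c_def m_def m_assoc)
        qed (use m cZ \<rho> in auto)
        finally show "C \<rho> \<tau> \<otimes> ncmonom_eval R a \<tau> \<otimes> x \<otimes> (\<Oplus>\<tau>'\<in>?G. C (rev \<rho>) \<tau>' \<otimes> ncmonom_eval R b \<tau>') =
          (\<Oplus>\<tau>'\<in>?G. c \<rho> (\<tau>, \<tau>') \<otimes> m (\<tau>, \<tau>'))" .
      qed (use m cZ \<rho> in auto)
      also have "\<dots> = (\<Oplus>e\<in>?G \<times> ?G. c \<rho> e \<otimes> m e)"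
        using m cZ \<rho> by (intro finsum_Sigma[symmetric]) auto
      finally show ?thesis .
    qed
    have "(\<Oplus>\<rho>\<in>perms n. \<beta> \<rho> \<otimes> foldr T \<rho> x) = (\<Oplus>\<rho>\<in>perms n. \<Oplus>e\<in>?G \<times> ?G. \<beta> \<rho> \<otimes> c \<rho> e \<otimes> m e)"
    proof (rule finsum_eqI)
      fix \<rho> assume \<rho>: "\<rho> \<in> perms n"
      have "\<beta> \<rho> \<otimes> foldr T \<rho> x = (\<Oplus>e\<in>?G \<times> ?G. \<beta> \<rho> \<otimes> (c \<rho> e \<otimes> m e))"
        unfolding word[OF \<rho>] using \<beta>(1) m cZ \<rho> by (intro finsum_mult_left) auto
      also have "\<dots> = (\<Oplus>e\<in>?G \<times> ?G. \<beta> \<rho> \<otimes> c \<rho> e \<otimes> m e)"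
        using \<beta>(1) m cZ \<rho> by (intro finsum_eqI) (auto simp: m_assoc)
      finally show "\<beta> \<rho> \<otimes> foldr T \<rho> x = (\<Oplus>e\<in>?G \<times> ?G. \<beta> \<rho> \<otimes> c \<rho> e \<otimes> m e)" .
    qed (use \<beta>(1) m cZ in auto)
    also have "\<dots> = (\<Oplus>e\<in>?G \<times> ?G. \<Oplus>\<rho>\<in>perms n. \<beta> \<rho> \<otimes> c \<rho> e \<otimes> m e)"
      using \<beta>(1) m cZ by (intro finsum_swap) auto
    also have "\<dots> = \<zero>"
    proof (rule finsum_eq_zero)
      fix e assume e: "e \<in> ?G \<times> ?G"
      have "(\<Oplus>\<rho>\<in>perms n. \<beta> \<rho> \<otimes> c \<rho> e \<otimes> m e) = (\<Oplus>\<rho>\<in>perms n. \<beta> \<rho> \<otimes> c \<rho> e) \<otimes> m e"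
        using \<beta>(1) m cZ by (intro finsum_mult_right[symmetric]) auto
      then show "(\<Oplus>\<rho>\<in>perms n. \<beta> \<rho> \<otimes> c \<rho> e \<otimes> m e) = \<zero>" using system[OF e] m by simp
    qed
    finally show ?thesis .
  qed
  \<comment> \<open>Replace elementary operators by arbitrary ones, one index at a time.\<close>
  have mixed: "(\<Oplus>\<rho>\<in>perms n. \<beta> \<rho> \<otimes> foldr T \<rho> x) = \<zero>"
    if "k \<le> n" and "\<And>i. i < k \<Longrightarrow> T i \<in> mult_ops" and "x \<in> carrier R"
      and "\<And>i. k \<le> i \<Longrightarrow> \<exists>p\<in>carrier R \<times> carrier R. T i = (\<lambda>y. fst p \<otimes> y \<otimes> snd p)" for k T x
    using that
  proof (induction k arbitrary: T)
    case 0
    then have "\<forall>i. \<exists>p. p \<in> carrier R \<times> carrier R \<and> T i = (\<lambda>y. fst p \<otimes> y \<otimes> snd p)" by blast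
    from choice[OF this] obtain p where
      p: "\<forall>i. p i \<in> carrier R \<times> carrier R \<and> T i = (\<lambda>y. fst (p i) \<otimes> y \<otimes> snd (p i))" by blast
    then have "fst (p i) \<in> carrier R" "snd (p i) \<in> carrier R" for i by (auto simp: mem_Times_iff)
    then show ?case using p 0 by (intro elementary[of "\<lambda>i. fst (p i)" "\<lambda>i. snd (p i)"]) blast+
  next
    case (Suc k)
    have T: "T i \<in> mult_ops" for i
    proof (cases "i < Suc k")
      case False
      then obtain p where p: "p \<in> carrier R \<times> carrier R" "T i = (\<lambda>y. fst p \<otimes> y \<otimes> snd p)"
        using Suc.prems(4)[of i] by auto
      then show ?thesis using mult_ops_elem[of "fst p" "snd p"] by (auto simp: mem_Times_iff)
    qed (rule Suc.prems(2))
    have "(\<Oplus>\<rho>\<in>perms n. \<beta> \<rho> \<otimes> foldr (T(k := f)) \<rho> x) = \<zero>" if "f \<in> mult_ops" for f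
      using that
    proof (induction rule: mult_ops_induct)
      case (elem a b)
      show ?case
      proof (rule Suc.IH)
        fix i assume "k \<le> i"
        then show "\<exists>p\<in>carrier R \<times> carrier R.
            (T(k := \<lambda>x. a \<otimes> x \<otimes> b)) i = (\<lambda>y. fst p \<otimes> y \<otimes> snd p)"
          using elem Suc.prems(4)[of i] by (cases "i = k") (auto intro: bexI[of _ "(a, b)"])
      qed (use Suc.prems T in auto)
    next
      case (add f g)
      have "(\<Oplus>\<rho>\<in>perms n. \<beta> \<rho> \<otimes> foldr (T(k := \<lambda>y. f y \<oplus> g y)) \<rho> x) =
        (\<Oplus>\<rho>\<in>perms n. \<beta> \<rho> \<otimes> foldr (T(k := f)) \<rho> x \<oplus> \<beta> \<rho> \<otimes> foldr (T(k := g)) \<rho> x)"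
      proof (rule finsum_eqI)
        fix \<rho> assume \<rho>: "\<rho> \<in> perms n"
        have "foldr (T(k := h)) \<rho> x \<in> carrier R" if "h \<in> mult_ops" for h
          using T that Suc.prems by (intro foldr_mult_ops_closed) auto
        note cl = this[OF add.hyps(1)] this[OF add.hyps(2)]
        have "foldr (T(k := \<lambda>y. f y \<oplus> g y)) \<rho> x = foldr (T(k := f)) \<rho> x \<oplus> foldr (T(k := g)) \<rho> x"
          using T add permsD[OF \<rho>] Suc.prems by (intro foldr_mult_ops_additive) auto
        then show "\<beta> \<rho> \<otimes> foldr (T(k := \<lambda>y. f y \<oplus> g y)) \<rho> x =
            \<beta> \<rho> \<otimes> foldr (T(k := f)) \<rho> x \<oplus> \<beta> \<rho> \<otimes> foldr (T(k := g)) \<rho> x"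
          using cl \<beta>(1)[OF \<rho>] by (simp add: r_distr)
        show "\<beta> \<rho> \<otimes> foldr (T(k := f)) \<rho> x \<oplus> \<beta> \<rho> \<otimes> foldr (T(k := g)) \<rho> x \<in> carrier R"
          using cl \<beta>(1)[OF \<rho>] by simp
      qed
      also have "\<dots> = (\<Oplus>\<rho>\<in>perms n. \<beta> \<rho> \<otimes> foldr (T(k := f)) \<rho> x) \<oplus>
          (\<Oplus>\<rho>\<in>perms n. \<beta> \<rho> \<otimes> foldr (T(k := g)) \<rho> x)"
        using T add Suc.prems \<beta>(1)
        by (intro finsum_add') (auto intro!: foldr_mult_ops_closed)
      also have "\<dots> = \<zero>" unfolding add.IH by simp
      finally show ?case .
    next
      case (cong f g)
      have "foldr (T(k := g)) \<rho> x = foldr (T(k := f)) \<rho> x" for \<rho>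
      proof (induction \<rho>)
        case (Cons i \<rho>)
        define y where "y = foldr (T(k := f)) \<rho> x"
        have "y \<in> carrier R"
          unfolding y_def using T cong Suc.prems by (intro foldr_mult_ops_closed) auto
        then have "(T(k := g)) i y = (T(k := f)) i y" using cong by simp
        then show ?case by (simp only: foldr.simps comp_apply Cons.IH flip: y_def)
      qed simp
      then show ?case using cong.IH by (simp only:)
    qed
    from this[OF T[of k]] show ?case by simp
  qed
  show ?thesis
  proof (rule that[OF \<beta>])
    fix T x assume T: "\<forall>i<n. T i \<in> mult_ops" and x: "x \<in> carrier R"
    define T' where "T' i = (if i < n then T i else (\<lambda>y. \<one> \<otimes> y \<otimes> \<one>))" for i
    have "(\<Oplus>\<rho>\<in>perms n. \<beta> \<rho> \<otimes> foldr T' \<rho> x) = \<zero>"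
      using T x by (intro mixed[of n]) (auto simp: T'_def intro: bexI[of _ "(\<one>, \<one>)"])
    moreover have "foldr T' \<rho> x = foldr T \<rho> x" if "\<rho> \<in> perms n" for \<rho>
      using permsD(2)[OF that] by (intro foldr_cong) (auto simp: T'_def)
    ultimately show "(\<Oplus>\<rho>\<in>perms n. \<beta> \<rho> \<otimes> foldr T \<rho> x) = \<zero>"
      using T x \<beta>(1) permsD(2)
      by (subst (asm) finsum_cong') (auto intro!: foldr_mult_ops_closed)
  qed
qed

section \<open>A nonzero ideal of finite rank\<close>

lemma op_closure_closed:
  "op_closure B \<subseteq> carrier R" "\<zero> \<in> op_closure B"
  "x \<in> op_closure B \<Longrightarrow> y \<in> op_closure B \<Longrightarrow> x \<oplus> y \<in> op_closure B"
  "x \<in> op_closure B \<Longrightarrow> \<ominus> x \<in> op_closure B"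
proof -
  show "op_closure B \<subseteq> carrier R" "\<zero> \<in> op_closure B"
    by (auto simp: op_closure_def mult_ops_zero)
  show "x \<oplus> y \<in> op_closure B" if xy: "x \<in> op_closure B" "y \<in> op_closure B"
    unfolding op_closure_def
  proof (intro CollectI conjI ballI impI)
    have c: "x \<in> carrier R" "y \<in> carrier R" using xy by (auto simp: op_closure_def)
    then show "x \<oplus> y \<in> carrier R" by simp
    fix f assume f: "f \<in> mult_ops" and z: "\<forall>x\<in>B. f x = \<zero>"
    have "f x = \<zero>" "f y = \<zero>" using xy f z by (auto simp: op_closure_def)
    then show "f (x \<oplus> y) = \<zero>" using mult_ops_hom[OF f c] by simp
  qed
  show "\<ominus> x \<in> op_closure B" if x: "x \<in> op_closure B"
    unfolding op_closure_def
  proof (intro CollectI conjI ballI impI)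
    show xc: "\<ominus> x \<in> carrier R" using x by (auto simp: op_closure_def)
    fix f assume f: "f \<in> mult_ops" and z: "\<forall>x\<in>B. f x = \<zero>"
    have c: "x \<in> carrier R" and fx: "f x = \<zero>" using x f z by (auto simp: op_closure_def)
    have "f (x \<oplus> \<ominus> x) = f x \<oplus> f (\<ominus> x)" using f c by (intro mult_ops_hom) auto
    then show "f (\<ominus> x) = \<zero>"
      using fx c f mult_ops_zero[OF f] mult_ops_closed[OF f xc] by (simp add: r_neg)
  qed
qed

text \<open>Given \<open>x 0, \<dots>, x m\<close>, an operator that kills all but the last one moves it to a nonzero element, and by
assumption some two-sided multiple of that element lies outside the closure of \<open>x 0, \<dots>, x m\<close>.\<close>

lemma escaping_chain:
  assumes escape: "\<And>C y. finite C \<Longrightarrow> C \<subseteq> carrier R \<Longrightarrow> y \<in> carrier R \<Longrightarrow> y \<noteq> \<zero> \<Longrightarrow>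
      \<exists>a\<in>carrier R. \<exists>b\<in>carrier R. a \<otimes> y \<otimes> b \<notin> op_closure C"
  shows "\<exists>S x. (\<forall>i<m. S i \<in> mult_ops \<and> S i (x i) = x (Suc i) \<and> (\<forall>j<i. S i (x j) = \<zero>)) \<and>
      (\<forall>i\<le>m. x i \<in> carrier R) \<and> x m \<notin> op_closure (x ` {..<m})"
proof (induction m)
  case 0
  have "\<one> \<notin> op_closure {}" using one_not_zero mult_ops_id by (auto simp: op_closure_def)
  then show ?case by (intro exI[of _ "\<lambda>_ y. y"] exI[of _ "\<lambda>_::nat. \<one>"]) auto
next
  case (Suc m)
  then obtain S x where
    S: "\<forall>i<m. S i \<in> mult_ops \<and> S i (x i) = x (Suc i) \<and> (\<forall>j<i. S i (x j) = \<zero>)"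
    and x: "\<forall>i\<le>m. x i \<in> carrier R" and xm: "x m \<notin> op_closure (x ` {..<m})" by blast
  then obtain f where f: "f \<in> mult_ops" "\<forall>j<m. f (x j) = \<zero>" "f (x m) \<noteq> \<zero>"
    by (auto simp: op_closure_def)
  have fc: "f (x m) \<in> carrier R" using f x mult_ops_closed by auto
  obtain a b where ab: "a \<in> carrier R" "b \<in> carrier R"
    and esc: "a \<otimes> f (x m) \<otimes> b \<notin> op_closure (x ` {..m})"
    using escape[of "x ` {..m}" "f (x m)"] x f fc by auto
  define y where "y = a \<otimes> f (x m) \<otimes> b"
  define g where "g z = a \<otimes> f z \<otimes> b" for z
  have g: "g \<in> mult_ops" unfolding g_def using f ab by (intro mult_ops_scale)
  have g0: "g (x j) = \<zero>" if "j < m" for j using f ab that by (simp add: g_def)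
  let ?S = "S(m := g)" and ?x = "x(Suc m := y)"
  have img: "?x ` {..<Suc m} = x ` {..m}" by (auto simp: lessThan_Suc_atMost)
  show ?case
  proof (intro exI[of _ ?S] exI[of _ ?x] conjI allI impI)
    fix i assume i: "i < Suc m"
    show "?S i \<in> mult_ops" using i S g by (cases "i = m") auto
    show "?S i (?x i) = ?x (Suc i)" using i S by (cases "i = m") (auto simp: g_def y_def)
    show "?S i (?x j) = \<zero>" if "j < i" for j using that i S g0 by (cases "i = m") auto
  next
    fix i assume "i \<le> Suc m"
    then show "?x i \<in> carrier R" using x ab fc by (cases "i = Suc m") (auto simp: y_def)
  next
    show "?x (Suc m) \<notin> op_closure (?x ` {..<Suc m})" unfolding img using esc by (simp add: y_def)
  qed
qed

text \<open>Since \<open>S i\<close> kills \<open>x j\<close> for \<open>j < i\<close>, and no operator may be used twice, only \<open>S 0\<close> can be applied first, only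
\<open>S 1\<close> second, and so on.\<close>

lemma foldr_triangular:
  fixes S :: "nat \<Rightarrow> 'a \<Rightarrow> 'a"
  assumes S: "\<And>i. i < n \<Longrightarrow> S i \<in> mult_ops" "\<And>i. i < n \<Longrightarrow> S i (x i) = x (Suc i)"
      "\<And>i j. j < i \<Longrightarrow> i < n \<Longrightarrow> S i (x j) = \<zero>"
    and v: "distinct v" "set v \<subseteq> {..<n}"
  shows "foldr S v (x 0) = (if v = rev [0..<length v] then x (length v) else \<zero>)"
  using v
proof (induction v)
  case (Cons i v)
  have i: "i < n" "i \<notin> set v" using Cons.prems by auto
  have IH: "foldr S v (x 0) = (if v = rev [0..<length v] then x (length v) else \<zero>)"
    using Cons by simp
  show ?case
  proof (cases "v = rev [0..<length v]")
    case True
    then have "set v = {..<length v}" by (metis set_rev set_upt lessThan_atLeast0)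
    then have "length v \<le> i" using i by auto
    then show ?thesis
      using IH True S i by (cases "i = length v") auto
  next
    case False
    then show ?thesis using IH mult_ops_zero[OF S(1)[OF i(1)]] by auto
  qed
qed simp

text \<open>Otherwise there are operators as in \<open>escaping_chain\<close> for which exactly one order of composition is nonzero.
Naming them so that this is the order of a word with nonzero coefficient contradicts the identity for operators.\<close>

lemma exists_ideal_in_finite_closure:
  assumes id: "multilinear_identity d \<alpha>"
  obtains I C where "ideal I R" "I \<noteq> {\<zero>}" "finite C" "C \<subseteq> carrier R" "I \<subseteq> op_closure C"
proof -
  have "\<exists>C y. finite C \<and> C \<subseteq> carrier R \<and> y \<in> carrier R \<and> y \<noteq> \<zero> \<and>
      (\<forall>a\<in>carrier R. \<forall>b\<in>carrier R. a \<otimes> y \<otimes> b \<in> op_closure C)"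
  proof (rule ccontr)
    assume "\<not> ?thesis"
    then have escape: "\<And>C y. finite C \<Longrightarrow> C \<subseteq> carrier R \<Longrightarrow> y \<in> carrier R \<Longrightarrow> y \<noteq> \<zero> \<Longrightarrow>
      \<exists>a\<in>carrier R. \<exists>b\<in>carrier R. a \<otimes> y \<otimes> b \<notin> op_closure C" by blast
    obtain n \<beta> where \<beta>: "\<And>\<rho>. \<rho> \<in> perms n \<Longrightarrow> \<beta> \<rho> \<in> ring_center R" "\<exists>\<rho>\<in>perms n. \<beta> \<rho> \<noteq> \<zero>"
      and ident: "\<And>T x. \<forall>i<n. T i \<in> mult_ops \<Longrightarrow> x \<in> carrier R \<Longrightarrow>
        (\<Oplus>\<rho>\<in>perms n. \<beta> \<rho> \<otimes> foldr T \<rho> x) = \<zero>"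
      by (rule mult_ops_satisfy_identity[OF id]) (rule that)
    then obtain \<pi> where \<pi>: "\<pi> \<in> perms n" "\<beta> \<pi> \<noteq> \<zero>" by blast
    note p = permsD[OF \<pi>(1)]
    obtain S x where
      S: "\<forall>i<n. S i \<in> mult_ops \<and> S i (x i) = x (Suc i) \<and> (\<forall>j<i. S i (x j) = \<zero>)"
      and x: "\<forall>i\<le>n. x i \<in> carrier R" and xn: "x n \<notin> op_closure (x ` {..<n})"
      using escaping_chain[OF escape, of n] by blast
    have xn0: "x n \<noteq> \<zero>" using xn op_closure_closed(2) by auto
    \<comment> \<open>The last letter of a word acts first, so the operator \<open>S i\<close> belongs to the \<open>i\<close>-th letter of \<open>\<pi>\<close> from the right.\<close>
    define s where "s k = n - 1 - position \<pi> k" for k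
    have s_nth: "s (\<pi> ! i) = n - 1 - i" if "i < n" for i
      using position_nth[OF p(1), of i] that p(3) by (simp add: s_def)
    have inj: "inj_on s {..<n}"
    proof (rule inj_onI)
      fix k l assume kl: "k \<in> {..<n}" "l \<in> {..<n}" "s k = s l"
      then obtain i j where ij: "i < n" "k = \<pi> ! i" "j < n" "l = \<pi> ! j"
        using p by (metis in_set_conv_nth)
      then have "n - 1 - i = n - 1 - j" using s_nth[of i] s_nth[of j] kl(3) by simp
      then have "i = j" using ij(1,3) by linarith
      then show "k = l" using ij by simp
    qed
    have s_less: "s k < n" if "k < n" for k using that by (simp add: s_def)
    have s\<pi>: "map s \<pi> = rev [0..<n]"
      using s_nth p by (intro nth_equalityI) (auto simp: rev_nth)
    have word_val: "foldr (\<lambda>k. S (s k)) \<rho> (x 0) = (if \<rho> = \<pi> then x n else \<zero>)" if \<rho>: "\<rho> \<in> perms n" for \<rho>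
    proof -
      note r = permsD[OF \<rho>]
      have "foldr (\<lambda>k. S (s k)) \<rho> (x 0) = foldr S (map s \<rho>) (x 0)"
        by (simp add: foldr_map comp_def)
      also have "\<dots> = (if map s \<rho> = rev [0..<length (map s \<rho>)] then x (length (map s \<rho>)) else \<zero>)"
        using S r s_less inj by (intro foldr_triangular[of n]) (auto simp: distinct_map)
      also have "map s \<rho> = rev [0..<length (map s \<rho>)] \<longleftrightarrow> \<rho> = \<pi>"
      proof
        assume "map s \<rho> = rev [0..<length (map s \<rho>)]"
        then have "map s \<rho> = map s \<pi>" using s\<pi> r by simp
        then show "\<rho> = \<pi>" using inj r p by (metis inj_on_map_eq_map Un_absorb)
      qed (use s\<pi> r in simp)
      finally show ?thesis using r p(3) by simp
    qed
    have "(\<Oplus>\<rho>\<in>perms n. \<beta> \<rho> \<otimes> foldr (\<lambda>k. S (s k)) \<rho> (x 0)) = \<zero>"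
      using S s_less x by (intro ident) auto
    moreover have "(\<Oplus>\<rho>\<in>perms n. \<beta> \<rho> \<otimes> foldr (\<lambda>k. S (s k)) \<rho> (x 0)) =
        \<beta> \<pi> \<otimes> foldr (\<lambda>k. S (s k)) \<pi> (x 0)"
      using \<pi> \<beta>(1) word_val x by (intro finsum_only) auto
    ultimately have "\<beta> \<pi> \<otimes> x n = \<zero>" using word_val[OF \<pi>(1)] by simp
    then show False using center_nonzero_mult[OF \<beta>(1)[OF \<pi>(1)]] \<pi> x xn0 by blast
  qed
  then obtain C y where C: "finite C" "C \<subseteq> carrier R" and y: "y \<in> carrier R" "y \<noteq> \<zero>"
    and cl: "\<And>a b. a \<in> carrier R \<Longrightarrow> b \<in> carrier R \<Longrightarrow> a \<otimes> y \<otimes> b \<in> op_closure C" by blast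
  define I where "I = {r \<in> carrier R. \<forall>a\<in>carrier R. \<forall>b\<in>carrier R. a \<otimes> r \<otimes> b \<in> op_closure C}"
  have "ideal I R"
  proof (rule idealI[OF ring_axioms])
    show "subgroup I (add_monoid R)"
    proof (rule add.subgroupI)
      show "I \<noteq> {}" using y cl by (auto simp: I_def)
    qed (auto simp: I_def r_distr l_distr r_minus l_minus op_closure_closed)
    fix r z assume r: "r \<in> I" and z: "z \<in> carrier R"
    then have "a \<otimes> (z \<otimes> r) \<otimes> b = (a \<otimes> z) \<otimes> r \<otimes> b" "a \<otimes> (r \<otimes> z) \<otimes> b = a \<otimes> r \<otimes> (z \<otimes> b)"
      if "a \<in> carrier R" "b \<in> carrier R" for a b using that by (auto simp: I_def m_assoc)
    then show "z \<otimes> r \<in> I" "r \<otimes> z \<in> I" using r z by (auto simp: I_def)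
  qed
  moreover have "I \<noteq> {\<zero>}" using y cl by (auto simp: I_def)
  moreover have "I \<subseteq> op_closure C"
  proof
    fix r assume r: "r \<in> I"
    then have "\<one> \<otimes> r \<otimes> \<one> \<in> op_closure C" "r \<in> carrier R" unfolding I_def by blast+
    then show "r \<in> op_closure C" by simp
  qed
  ultimately show ?thesis using C that by blast
qed

end

section \<open>Modules over the centre\<close>

context ring
begin

text \<open>Negatives are multiples by the central element \<open>- 1\<close>.\<close>

definition center_submodule :: "'a set \<Rightarrow> bool" where
  "center_submodule M \<longleftrightarrow> M \<subseteq> carrier R \<and> \<zero> \<in> M \<and> (\<forall>x\<in>M. \<forall>y\<in>M. x \<oplus> y \<in> M) \<and>
     (\<forall>z\<in>ring_center R. \<forall>x\<in>M. z \<otimes> x \<in> M)"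

lemma center_submodule_diff:
  assumes "center_submodule M" "x \<in> M" "y \<in> M"
  shows "x \<ominus> y \<in> M"
proof -
  have c: "x \<in> carrier R" "y \<in> carrier R" using assms by (auto simp: center_submodule_def)
  have "(\<ominus> \<one>) \<otimes> y \<in> M"
    using assms center_neg[OF center_one] unfolding center_submodule_def by blast
  then have "\<ominus> y \<in> M" using c by (simp add: l_minus)
  then show ?thesis using assms unfolding center_submodule_def a_minus_def by blast
qed

lemma center_submodule_Int:
  "center_submodule M \<Longrightarrow> center_submodule N \<Longrightarrow> center_submodule (M \<inter> N)"
  unfolding center_submodule_def by blast

definition center_span :: "'a set \<Rightarrow> 'a set" where
  "center_span B = {(\<Oplus>x\<in>B. k x \<otimes> x) | k. \<forall>x\<in>B. k x \<in> ring_center R}"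

lemma center_spanI:
  "(\<And>x. x \<in> B \<Longrightarrow> k x \<in> ring_center R) \<Longrightarrow> (\<Oplus>x\<in>B. k x \<otimes> x) \<in> center_span B"
  unfolding center_span_def by blast

lemma center_span_submodule:
  assumes B: "finite B" "B \<subseteq> carrier R"
  shows "center_submodule (center_span B)"
proof -
  have Bc: "x \<in> carrier R" if "x \<in> B" for x using that B by auto
  show ?thesis
    unfolding center_submodule_def
  proof (intro conjI ballI)
    show "center_span B \<subseteq> carrier R" using Bc by (auto simp: center_span_def)
    show "\<zero> \<in> center_span B"
      unfolding center_span_def using Bc center_zero
      by (intro CollectI exI[of _ "\<lambda>_. \<zero>"]) (auto intro!: finsum_eq_zero[symmetric])
  next
    fix x y assume "x \<in> center_span B" "y \<in> center_span B"
    then obtain k l where k: "\<forall>b\<in>B. k b \<in> ring_center R" "x = (\<Oplus>b\<in>B. k b \<otimes> b)"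
      and l: "\<forall>b\<in>B. l b \<in> ring_center R" "y = (\<Oplus>b\<in>B. l b \<otimes> b)" by (auto simp: center_span_def)
    have "x \<oplus> y = (\<Oplus>b\<in>B. k b \<otimes> b \<oplus> l b \<otimes> b)"
      unfolding k(2) l(2) using k(1) l(1) Bc by (intro finsum_add'[symmetric]) auto
    also have "\<dots> = (\<Oplus>b\<in>B. (k b \<oplus> l b) \<otimes> b)"
      using k(1) l(1) Bc by (intro finsum_eqI) (auto simp: l_distr)
    finally show "x \<oplus> y \<in> center_span B"
      using center_spanI[of B "\<lambda>b. k b \<oplus> l b"] k(1) l(1) center_add by simp
  next
    fix z x assume z: "z \<in> ring_center R" and "x \<in> center_span B"
    then obtain k where k: "\<forall>b\<in>B. k b \<in> ring_center R" "x = (\<Oplus>b\<in>B. k b \<otimes> b)"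
      by (auto simp: center_span_def)
    have "z \<otimes> x = (\<Oplus>b\<in>B. z \<otimes> (k b \<otimes> b))"
      unfolding k(2) using k(1) z Bc B by (intro finsum_mult_left) auto
    also have "\<dots> = (\<Oplus>b\<in>B. (z \<otimes> k b) \<otimes> b)"
      using k(1) z Bc by (intro finsum_eqI) (auto simp: m_assoc)
    finally show "z \<otimes> x \<in> center_span B"
      using center_spanI[of B "\<lambda>b. z \<otimes> k b"] k(1) z center_mult by simp
  qed
qed

lemma center_span_insertE:
  assumes "r \<in> center_span (insert b B)" "finite B" "b \<notin> B" "insert b B \<subseteq> carrier R"
  obtains z s where "z \<in> ring_center R" "s \<in> center_span B" "r = z \<otimes> b \<oplus> s"
proof -
  obtain k where k: "\<forall>x\<in>insert b B. k x \<in> ring_center R" "r = (\<Oplus>x\<in>insert b B. k x \<otimes> x)"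
    using assms(1) by (auto simp: center_span_def)
  have "r = k b \<otimes> b \<oplus> (\<Oplus>x\<in>B. k x \<otimes> x)"
    unfolding k(2) using assms k(1) by (intro finsum_insert') auto
  moreover have "(\<Oplus>x\<in>B. k x \<otimes> x) \<in> center_span B"
    using k(1) by (intro center_spanI) auto
  ultimately show ?thesis using k(1) that by auto
qed

text \<open>Negatives in the ring \<open>R\<lparr>carrier := ring_center R\<rparr>\<close> are a priori different from those in \<open>R\<close>; they are
obtained here as multiples, so that only products have to be compared.\<close>

lemma leading_coefficient_ideal:
  assumes Z: "ring (R\<lparr>carrier := ring_center R\<rparr>)" and M: "center_submodule M" and N: "center_submodule N"
    and b: "b \<in> carrier R"
  shows "ideal {z \<in> ring_center R. \<exists>s\<in>N. z \<otimes> b \<oplus> s \<in> M} (R\<lparr>carrier := ring_center R\<rparr>)"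
proof -
  let ?Q = "R\<lparr>carrier := ring_center R\<rparr>"
  let ?J = "{z \<in> ring_center R. \<exists>s\<in>N. z \<otimes> b \<oplus> s \<in> M}"
  interpret Q: ring ?Q by (rule Z)
  have mult: "w \<otimes> z \<in> ?J" if z: "z \<in> ?J" and w: "w \<in> ring_center R" for z w
  proof -
    obtain s where s: "s \<in> N" "z \<otimes> b \<oplus> s \<in> M" using z by auto
    have "w \<otimes> (z \<otimes> b \<oplus> s) \<in> M" "w \<otimes> s \<in> N"
      using s w M N by (auto simp: center_submodule_def)
    moreover have "w \<otimes> (z \<otimes> b \<oplus> s) = (w \<otimes> z) \<otimes> b \<oplus> w \<otimes> s"
      using z w b s N by (auto simp: r_distr m_assoc center_submodule_def)
    ultimately show ?thesis using z w center_mult by auto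
  qed
  show ?thesis
  proof (rule idealI[OF Z])
    show "subgroup ?J (add_monoid ?Q)"
    proof (rule Q.add.subgroupI)
      have "\<zero> \<otimes> b \<oplus> \<zero> \<in> M" using M b by (simp add: center_submodule_def)
      then show "?J \<noteq> {}" using N center_zero unfolding center_submodule_def by blast
      fix x assume x: "x \<in> ?J"
      then have xZ: "x \<in> carrier ?Q" by simp
      have "\<ominus>\<^bsub>?Q\<^esub> x = (\<ominus>\<^bsub>?Q\<^esub> \<one>\<^bsub>?Q\<^esub>) \<otimes>\<^bsub>?Q\<^esub> x"
        using Q.l_minus[OF Q.one_closed xZ] Q.l_one[OF xZ] by simp
      moreover have "\<ominus>\<^bsub>?Q\<^esub> \<one>\<^bsub>?Q\<^esub> \<in> ring_center R"
        using Q.a_inv_closed[OF Q.one_closed] by simp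
      ultimately show "\<ominus>\<^bsub>?Q\<^esub> x \<in> ?J" using mult[OF x] by simp
    next
      fix x y assume x: "x \<in> ?J" and y: "y \<in> ?J"
      then obtain s t where s: "s \<in> N" "x \<otimes> b \<oplus> s \<in> M" and t: "t \<in> N" "y \<otimes> b \<oplus> t \<in> M" by auto
      have "(x \<otimes> b \<oplus> s) \<oplus> (y \<otimes> b \<oplus> t) \<in> M" "s \<oplus> t \<in> N"
        using s t M N by (auto simp: center_submodule_def)
      moreover have "(x \<otimes> b \<oplus> s) \<oplus> (y \<otimes> b \<oplus> t) = (x \<oplus> y) \<otimes> b \<oplus> (s \<oplus> t)"
      proof -
        have "x \<in> carrier R" "y \<in> carrier R" "s \<in> carrier R" "t \<in> carrier R"
          using x y s t N by (auto simp: center_submodule_def)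
        then show ?thesis using b by (simp add: l_distr a_ac)
      qed
      ultimately show "x \<oplus>\<^bsub>?Q\<^esub> y \<in> ?J" using x y center_add by auto
    qed auto
    fix z w assume z: "z \<in> ?J" and w: "w \<in> carrier ?Q"
    then show "w \<otimes>\<^bsub>?Q\<^esub> z \<in> ?J" using mult by simp
    then show "z \<otimes>\<^bsub>?Q\<^esub> w \<in> ?J" using z w center_commute[of z w] by simp
  qed
qed

text \<open>As in Hilbert's basis theorem: the chains of the ideals of coefficients at \<open>b\<close>
and of the intersections with the span of the other generators become constant, and together they
determine the modules.\<close>

lemma chain_in_center_span_stabilizes:
  assumes noeth: "noetherian_ring (R\<lparr>carrier := ring_center R\<rparr>)"
    and B: "finite B" "B \<subseteq> carrier R"
    and M: "\<And>k. center_submodule (M k)" "\<And>k. M k \<subseteq> M (Suc k)" "\<And>k. M k \<subseteq> center_span B"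
  shows "\<exists>K. \<forall>k\<ge>K. M k = M K"
  using B M
proof (induction B arbitrary: M rule: finite_induct)
  case empty
  have "M k = {\<zero>}" for k
    using empty(4)[of k] empty(2)[of k] by (auto simp: center_span_def center_submodule_def)
  then show ?case by simp
next
  case (insert b B)
  let ?Q = "R\<lparr>carrier := ring_center R\<rparr>"
  interpret Q: noetherian_ring ?Q by (rule noeth)
  have b: "b \<in> carrier R" and B: "B \<subseteq> carrier R" using insert.prems by auto
  have N: "center_submodule (center_span B)" using insert.hyps B by (intro center_span_submodule)
  have mono: "M k \<subseteq> M l" if "k \<le> l" for k l using lift_Suc_mono_le[of M] insert.prems(3) that by blast
  have "\<exists>K. \<forall>k\<ge>K. M k \<inter> center_span B = M K \<inter> center_span B"
    using insert.prems N B by (intro insert.IH center_submodule_Int) blast+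
  then obtain K where K: "\<And>k. k \<ge> K \<Longrightarrow> M k \<inter> center_span B = M K \<inter> center_span B" by blast
  define J where "J k = {z \<in> ring_center R. \<exists>s\<in>center_span B. z \<otimes> b \<oplus> s \<in> M k}" for k
  have J: "ideal (J k) ?Q" for k
    unfolding J_def using insert.prems(2) N b by (intro leading_coefficient_ideal Q.ring_axioms) auto
  have J_mono: "J k \<subseteq> J l" if "k \<le> l" for k l using mono[OF that] by (auto simp: J_def)
  have "subset.chain {I. ideal I ?Q} (range J)"
    unfolding subset.chain_def using J J_mono by (auto simp: less_le) (metis nat_le_linear subsetD)+
  then have "\<Union> (range J) \<in> range J" by (intro Q.ideal_chain_is_trivial) auto
  then obtain L where L: "\<Union> (range J) = J L" by auto
  define P where "P = max K L"
  have "M k = M P" if "k \<ge> P" for k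
  proof
    show "M P \<subseteq> M k" using mono that by blast
    show "M k \<subseteq> M P"
    proof
      fix r assume r: "r \<in> M k"
      obtain z s where zs: "z \<in> ring_center R" "s \<in> center_span B" "r = z \<otimes> b \<oplus> s"
        using center_span_insertE[of r b B] r insert.prems insert.hyps by blast
      then have "z \<in> J k" using r by (auto simp: J_def)
      then have "z \<in> J L" using L by blast
      then have "z \<in> J P" using J_mono[of L P] by (auto simp: P_def)
      then obtain t where t: "t \<in> center_span B" "z \<otimes> b \<oplus> t \<in> M P" by (auto simp: J_def)
      then have tk: "z \<otimes> b \<oplus> t \<in> M k" using mono[OF that] by blast
      have c: "z \<in> carrier R" "s \<in> carrier R" "t \<in> carrier R"
        using zs t N by (auto simp: center_submodule_def)
      have st: "r \<ominus> (z \<otimes> b \<oplus> t) = s \<ominus> t"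
      proof -
        have "r \<ominus> (z \<otimes> b \<oplus> t) = (z \<otimes> b \<oplus> \<ominus> (z \<otimes> b)) \<oplus> (s \<oplus> \<ominus> t)"
          using c b by (simp add: zs(3) a_minus_def minus_add a_ac)
        then show ?thesis using c b by (simp add: r_neg a_minus_def)
      qed
      have "s \<ominus> t \<in> M k \<inter> center_span B"
        using center_submodule_diff[OF insert.prems(2) r tk] center_submodule_diff[OF N zs(2) t(1)] st by simp
      also have "\<dots> = M P \<inter> center_span B"
        using K[of k] K[of P] that by (simp add: P_def)
      finally have "s \<ominus> t \<in> M P" by simp
      then have "(z \<otimes> b \<oplus> t) \<oplus> (s \<ominus> t) \<in> M P"
        using t insert.prems(2) unfolding center_submodule_def by blast
      moreover have "(z \<otimes> b \<oplus> t) \<oplus> (s \<ominus> t) = r"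
      proof -
        have "(z \<otimes> b \<oplus> t) \<oplus> (s \<ominus> t) = (z \<otimes> b \<oplus> s) \<oplus> (t \<oplus> \<ominus> t)"
          using c b by (simp add: a_minus_def a_ac)
        then show ?thesis using c b by (simp add: r_neg zs(3))
      qed
      ultimately show "r \<in> M P" by simp
    qed
  qed
  then show ?case by blast
qed

text \<open>Values at \<open>v\<close> of polynomials of degree less than \<open>k\<close> with central coefficients.\<close>

primrec center_polys :: "'a \<Rightarrow> nat \<Rightarrow> 'a set" where
  "center_polys v 0 = {\<zero>}"
| "center_polys v (Suc k) = {p \<oplus> z \<otimes> v [^] k | p z. p \<in> center_polys v k \<and> z \<in> ring_center R}"

lemma center_polys_submodule:
  assumes v: "v \<in> carrier R"
  shows "center_submodule (center_polys v k)"
proof (induction k)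
  case 0
  then show ?case by (simp add: center_submodule_def)
next
  case (Suc k)
  have vk: "v [^] k \<in> carrier R" using v by simp
  show ?case
    unfolding center_submodule_def
  proof (intro conjI ballI)
    show "center_polys v (Suc k) \<subseteq> carrier R"
      using Suc vk by (auto simp: center_submodule_def)
    have "\<zero> = \<zero> \<oplus> \<zero> \<otimes> v [^] k" using vk by simp
    then show "\<zero> \<in> center_polys v (Suc k)"
      using Suc center_zero unfolding center_submodule_def center_polys.simps by blast
  next
    fix x y assume "x \<in> center_polys v (Suc k)" "y \<in> center_polys v (Suc k)"
    then obtain p z q w where p: "p \<in> center_polys v k" "z \<in> ring_center R" "x = p \<oplus> z \<otimes> v [^] k"
      and q: "q \<in> center_polys v k" "w \<in> ring_center R" "y = q \<oplus> w \<otimes> v [^] k" by auto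
    have c: "p \<in> carrier R" "q \<in> carrier R" "z \<in> carrier R" "w \<in> carrier R"
      using p q Suc by (auto simp: center_submodule_def)
    have "x \<oplus> y = (p \<oplus> q) \<oplus> (z \<oplus> w) \<otimes> v [^] k"
      using c vk by (simp add: p q l_distr a_ac)
    moreover have "p \<oplus> q \<in> center_polys v k" using p q Suc by (auto simp: center_submodule_def)
    ultimately show "x \<oplus> y \<in> center_polys v (Suc k)" using p q center_add by auto
  next
    fix w x assume w: "w \<in> ring_center R" and "x \<in> center_polys v (Suc k)"
    then obtain p z where p: "p \<in> center_polys v k" "z \<in> ring_center R" "x = p \<oplus> z \<otimes> v [^] k" by auto
    have c: "p \<in> carrier R" "z \<in> carrier R" "w \<in> carrier R"
      using p w Suc by (auto simp: center_submodule_def)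
    have "w \<otimes> x = w \<otimes> p \<oplus> (w \<otimes> z) \<otimes> v [^] k" using c vk by (simp add: p r_distr m_assoc)
    moreover have "w \<otimes> p \<in> center_polys v k" using p w Suc by (auto simp: center_submodule_def)
    ultimately show "w \<otimes> x \<in> center_polys v (Suc k)" using p w center_mult by auto
  qed
qed

lemma center_polys_carrier: "v \<in> carrier R \<Longrightarrow> center_polys v k \<subseteq> carrier R"
  using center_polys_submodule unfolding center_submodule_def by blast

lemma inverse_power_cancel:
  assumes "u \<in> carrier R" "v \<in> carrier R" "u \<otimes> v = \<one>"
  shows "u [^] (k::nat) \<otimes> v [^] k = \<one>"
proof (induction k)
  case (Suc k)
  have vk: "v [^] k \<in> carrier R" "u [^] k \<in> carrier R" using assms by simp_all
  have "u [^] Suc k \<otimes> v [^] Suc k = (u [^] k \<otimes> u) \<otimes> (v \<otimes> v [^] k)"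
    unfolding nat_pow_Suc2[OF assms(2)] by simp
  also have "\<dots> = u [^] k \<otimes> ((u \<otimes> v) \<otimes> v [^] k)"
    using m_assoc[OF assms(1,2) vk(1)] m_assoc[OF vk(2) assms(1), of "v \<otimes> v [^] k"] assms vk by simp
  also have "\<dots> = \<one>" using Suc assms vk by simp
  finally show ?case .
qed simp

text \<open>Each \<open>v^i\<close> with \<open>i < k\<close> becomes \<open>u^(k-i)\<close>, which has a factor \<open>u\<close> and otherwise lies in \<open>S\<close>.\<close>

lemma power_times_center_poly:
  assumes S: "subring S R" "ring_center R \<subseteq> S" and u: "u \<in> S" and v: "v \<in> carrier R" "u \<otimes> v = \<one>"
    and p: "p \<in> center_polys v k"
  shows "\<exists>s\<in>S. u [^] k \<otimes> p = u \<otimes> s"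
proof -
  interpret S: subring S R by (rule S)
  have uc: "u \<in> carrier R" using u S.subset by blast
  show ?thesis
    using p
  proof (induction k arbitrary: p)
    case 0
    then show ?case using uc subringE(2)[OF S(1)] by (intro bexI[of _ \<zero>]) auto
  next
    case (Suc k)
    then obtain q z where q: "q \<in> center_polys v k" "z \<in> ring_center R" "p = q \<oplus> z \<otimes> v [^] k" by auto
    obtain s where s: "s \<in> S" "u [^] k \<otimes> q = u \<otimes> s" using Suc.IH[OF q(1)] by blast
    have c: "q \<in> carrier R" "z \<in> carrier R" "s \<in> carrier R" "u [^] k \<in> carrier R" "v [^] k \<in> carrier R"
      using q s S.subset subsetD[OF center_polys_carrier[OF v(1)] q(1)] uc v by auto
    have "u [^] Suc k \<otimes> p = u \<otimes> (u [^] k \<otimes> p)"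
      using nat_pow_Suc2[OF uc, of k] uc c by (simp add: q(3) m_assoc)
    also have "u [^] k \<otimes> p = u \<otimes> s \<oplus> z \<otimes> (u [^] k \<otimes> v [^] k)"
      using center_lcomm[OF q(2), of "u [^] k" "v [^] k"] c by (simp add: q(3) r_distr s(2))
    also have "\<dots> = u \<otimes> s \<oplus> z" using inverse_power_cancel[OF uc v] c by simp
    finally have "u [^] Suc k \<otimes> p = u \<otimes> (u \<otimes> s \<oplus> z)" .
    moreover have "u \<otimes> s \<oplus> z \<in> S" 
      using u s q S(2) subringE(6)[OF S(1) u s(1)] subringE(7)[OF S(1)] by blast
    ultimately show ?case by blast
  qed
qed

end

text \<open>The modules \<open>c (Z + Z v + \<dots> + Z v^(k - 1))\<close> become constant, and cancelling \<open>c\<close> gives an equation of integral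
dependence \<open>v^K = p\<close> with \<open>p\<close> of lower degree in \<open>v\<close>.  Multiplied by \<open>u^K\<close> it reads \<open>1 = u s\<close>, where \<open>s\<close> is a polynomial in
\<open>u\<close> with central coefficients.\<close>

lemma (in elementwise_prime_ring) inverse_in_intermediate_subring:
  assumes noeth: "noetherian_ring (R\<lparr>carrier := ring_center R\<rparr>)"
    and B: "finite B" "B \<subseteq> carrier R" and c: "c \<in> ring_center R" "c \<noteq> \<zero>"
    and span: "\<And>r. r \<in> carrier R \<Longrightarrow> c \<otimes> r \<in> center_span B"
    and S: "subring S R" "ring_center R \<subseteq> S"
    and u: "u \<in> S" and v: "v \<in> carrier R" "u \<otimes> v = \<one>" "v \<otimes> u = \<one>"
  shows "v \<in> S"
proof -
  interpret S: subring S R by (rule S)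
  have uc: "u \<in> carrier R" using u S.subset by blast
  have cc: "c \<in> carrier R" using c by simp
  define M where "M k = (\<otimes>) c ` center_polys v k" for k
  have P: "center_submodule (center_polys v k)" for k by (rule center_polys_submodule[OF v(1)])
  have Pc: "p \<in> carrier R" if "p \<in> center_polys v k" for p k
    using that center_polys_carrier[OF v(1)] by blast
  have "center_submodule (M k)" for k
    unfolding center_submodule_def
  proof (intro conjI ballI)
    show "M k \<subseteq> carrier R" using Pc cc by (auto simp: M_def)
    show "\<zero> \<in> M k" using P[of k] cc by (auto simp: M_def center_submodule_def intro!: image_eqI[of _ _ \<zero>])
    fix x y assume "x \<in> M k" "y \<in> M k"
    then obtain p q where p: "p \<in> center_polys v k" "x = c \<otimes> p" and q: "q \<in> center_polys v k" "y = c \<otimes> q"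
      by (auto simp: M_def)
    then have "x \<oplus> y = c \<otimes> (p \<oplus> q)" using Pc cc by (simp add: r_distr)
    then show "x \<oplus> y \<in> M k" using P[of k] p q by (auto simp: M_def center_submodule_def)
  next
    fix z x assume z: "z \<in> ring_center R" and "x \<in> M k"
    then obtain p where p: "p \<in> center_polys v k" "x = c \<otimes> p" by (auto simp: M_def)
    have "z \<otimes> x = c \<otimes> (z \<otimes> p)" unfolding p(2) using center_lcomm[OF c(1) _ Pc[OF p(1)]] z by simp
    then show "z \<otimes> x \<in> M k" using P[of k] p z by (auto simp: M_def center_submodule_def)
  qed
  moreover have "M k \<subseteq> M (Suc k)" for k
  proof -
    have "p \<in> center_polys v (Suc k)" if p: "p \<in> center_polys v k" for p
    proof -
      have "p = p \<oplus> \<zero> \<otimes> v [^] k" using Pc[OF p] v by simp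
      then show ?thesis using p center_zero unfolding center_polys.simps by blast
    qed
    then show ?thesis by (auto simp: M_def)
  qed
  moreover have "M k \<subseteq> center_span B" for k using span Pc by (auto simp: M_def)
  ultimately obtain K where K: "\<And>k. k \<ge> K \<Longrightarrow> M k = M K"
    using chain_in_center_span_stabilizes[OF noeth B, of M] by blast
  have "v [^] K = \<zero> \<oplus> \<one> \<otimes> v [^] K" using v by simp
  moreover have "\<zero> \<in> center_polys v K" using P[of K] by (simp add: center_submodule_def)
  ultimately have "v [^] K \<in> center_polys v (Suc K)"
    using center_one unfolding center_polys.simps by blast
  then have "c \<otimes> v [^] K \<in> M (Suc K)" by (simp add: M_def del: center_polys.simps)
  then have "c \<otimes> v [^] K \<in> M K" using K[of "Suc K"] by simp
  then obtain p where p: "p \<in> center_polys v K" "c \<otimes> v [^] K = c \<otimes> p" by (auto simp: M_def)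
  then have "v [^] K = p" using center_cancel[OF c] v Pc by simp
  then obtain s where s: "s \<in> S" "u [^] K \<otimes> v [^] K = u \<otimes> s"
    using power_times_center_poly[OF S u v(1,2) p(1)] by blast
  then have us: "u \<otimes> s = \<one>" using inverse_power_cancel[OF uc v(1,2)] by simp
  have sc: "s \<in> carrier R" using s S.subset by blast
  have "v = v \<otimes> (u \<otimes> s)" using us v by simp
  also have "\<dots> = s" using v uc sc by (simp flip: m_assoc)
  finally show ?thesis using s by simp
qed

theorem theorem2p4:
  fixes R :: "('a, 'b) ring_scheme" and S :: "'a set"
  assumes "prime_ring R"
    and "PI_ring R"
    and "noetherian_ring (R\<lparr>carrier := ring_center R\<rparr>)"
    and "subring S R"
    and "ring_center R \<subseteq> S"
  shows "S \<inter> Units R = Units (R\<lparr>carrier := S\<rparr>)"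
proof -
  interpret elementwise_prime_ring R by (rule prime_ring_imp_elementwise[OF assms(1)])
  interpret S: subring S R by (rule assms(4))
  obtain d \<alpha> where id: "multilinear_identity d \<alpha>"
    by (rule PI_ring_imp_multilinear_identity[OF assms(2)])
  obtain I C where "ideal I R" "I \<noteq> {\<zero>\<^bsub>R\<^esub>}" "finite C" "C \<subseteq> carrier R" "I \<subseteq> op_closure C"
    by (rule exists_ideal_in_finite_closure[OF id])
  then obtain B c where B: "finite B" "B \<subseteq> carrier R" and c: "c \<in> ring_center R" "c \<noteq> \<zero>\<^bsub>R\<^esub>"
    and span: "\<And>r. r \<in> carrier R \<Longrightarrow>
      \<exists>k. (\<forall>x\<in>B. k x \<in> ring_center R) \<and> c \<otimes>\<^bsub>R\<^esub> r = (\<Oplus>\<^bsub>R\<^esub>x\<in>B. k x \<otimes>\<^bsub>R\<^esub> x)"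
    by (rule central_multiple_in_finite_span) (rule that)
  have "c \<otimes>\<^bsub>R\<^esub> r \<in> center_span B" if "r \<in> carrier R" for r
    using span[OF that] unfolding center_span_def by blast
  then have inv: "v \<in> S" if "u \<in> S" "v \<in> carrier R" "u \<otimes>\<^bsub>R\<^esub> v = \<one>\<^bsub>R\<^esub>" "v \<otimes>\<^bsub>R\<^esub> u = \<one>\<^bsub>R\<^esub>" for u v
    using inverse_in_intermediate_subring[OF assms(3) B c _ assms(4,5) that] by blast
  show ?thesis
  proof
    show "S \<inter> Units R \<subseteq> Units (R\<lparr>carrier := S\<rparr>)" using inv by (auto simp: Units_def)
    show "Units (R\<lparr>carrier := S\<rparr>) \<subseteq> S \<inter> Units R" using S.subset by (auto simp: Units_def)
  qed
qed

end
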